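(* Let $\Delta t>0$, let $u_0\in U_h$ with $\operatorname{div}u_0=0$ and $\rho_0\in F_h$, and let $u_1,u_2,\ldots\in U_h$, $\rho_1,\rho_2,\ldots\in F_h$, $p_1,p_2,\ldots\in Q_h$ satisfy, for every $k\ge 0$ and every $(v,\sigma,q)\in U_h\times F_h\times Q_h$, $$\sum_{e \in \mathcal{E}_h} \int_e \alpha_e(u_{k+1/2}) (n \times \llbracket (\rho u)_{k+1/2} \rrbracket ) \cdot \llbracket u_{k+1/2} \times v \rrbracket \, ds + \sum_{e \in \mathcal{E}_h} \int_e \frac{\beta_e(u_{k+1/2})}{2|u_{k+1/2} \cdot n|^2} (u_{k+1/2} \cdot n)(v \cdot n) \llbracket \overline{u_k \cdot u_{k+1}} \rrbracket \cdot \llbracket \rho_{k+1/2} \rrbracket \, ds$$ $$+ \left\langle \frac{ \rho_{k+1} u_{k+1}-\rho_k u_k }{ \Delta t }, v \right\rangle + a_h( (\rho u)_{k+1/2}, u_{k+1/2}, v ) - \frac{1}{2}b_h\left( v, \overline{ u_k \cdot u_{k+1} }, \rho_{k+1/2} \right) - \langle p_{k+1}, \operatorname{div} v \rangle = 0,$$ $$\left\langle \frac{\rho_{k+1}-\rho_k}{\Delta t}, \sigma \right\rangle - b_h( u_{k+1/2}, \sigma, \rho_{k+1/2} ) + \sum_{e \in \mathcal{E}_h} \int_e \beta_e(u_{k+1/2}) \llbracket \sigma \rrbracket \cdot \llbracket \rho_{k+1/2} \rrbracket \, ds = 0,$$ $$\langle \operatorname{div} u_{k+1}, q \rangle = 0,$$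 where $u_{k+1/2}=\frac{u_k+u_{k+1}}{2}$, $\rho_{k+1/2}=\frac{\rho_k+\rho_{k+1}}{2}$ and $(\rho u)_{k+1/2}=\frac{\rho_ku_k+\rho_{k+1}u_{k+1}}{2}$. Then, for every $k$, $$\int_\Omega\rho_{k+1}\,dx=\int_\Omega\rho_k\,dx,$$ $$\int_\Omega\rho_{k+1}^2\,dx\le\int_\Omega\rho_k^2\,dx,\ \text{ with equality if }\beta_e=0\text{ for all }e\in\mathcal{E}_h,$$ $$\int_\Omega\rho_{k+1}u_{k+1}\cdot u_{k+1}\,dx=\int_\Omega\rho_ku_k\cdot u_k\,dx.$$
   Context: Let $n\in\{2,3\}$ be the dimension and $\Omega\subset\mathbb{R}^n$ a bounded domain with a triangulation $\mathcal{T}_h$ into simplices; $\mathcal{E}_h$ is the set of interior $(n-1)$-dimensional faces. (The symbol $n$ also denotes unit normal vectors.) $P_r(K)$ is the space of polynomials of degree at most $r$ on $K$. Let $H_0(\operatorname{div},\Omega)=\{u\in L^2(\Omega)^n \mid \operatorname{div}u\in L^2(\Omega),\ u\cdot n=0 \text{ on }\partial\Omega\}$. Fix integers $s,m\ge 0$ and set: - $RT_s(\mathcal{T}_h)=\{u\in H_0(\operatorname{div},\Omega)\mid u|_K\in P_s(K)^n+xP_s(K)\ \forall K\in\mathcal{T}_h\}$; - $BDM_{s+1}(\mathcal{T}_h)=\{u\in H_0(\operatorname{div},\Omega)\mid u|_K\in P_{s+1}(K)^n\ \forall K\in\mathcal{T}_h\}$; - $DG_r(\mathcal{T}_h)=\{f\in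 L^2(\Omega)\mid f|_K\in P_r(K)\ \forall K\in\mathcal{T}_h\}$; - $U_h\in\{RT_s(\mathcal{T}_h),BDM_{s+1}(\mathcal{T}_h)\}$, $F_h=DG_m(\mathcal{T}_h)$, $Q_h=DG_s(\mathcal{T}_h)$. $W_h$ is the space of vector fields on $\Omega$ that are piecewise smooth with respect to $\mathcal{T}_h$. $\langle\cdot,\cdot\rangle$ is the $L^2(\Omega)$ inner product (of scalar or vector fields). $\overline{f}\in F_h$ denotes the $L^2$-orthogonal projection of $f$ onto $F_h$. Jumps and averages on $e=K_1\cap K_2\in\mathcal{E}_h$: for scalar $f$ with $f_i=f|_{K_i}$, $\llbracket f\rrbracket=f_1n_1+f_2n_2$ and $\{f\}=\frac{f_1+f_2}{2}$, where $n_1$ is the unit normal to $e$ pointing from $K_1$ to $K_2$ and $n_2=-n_1$. For vector fields, fix a unit normal $n$ for each $e$, order $K_1,K_2$ so that $n$ points from $K_1$ to $K_2$, and set $\llbracket u\rrbracket=u_1-u_2$, $\{u\}=\frac{u_1+u_2}{2}$ (here subscripts $1,2$ denote restrictions to $K_1,K_2$); the jump $\llbracket u\times v\rrbracket$ is the difference of the values of $u\times v$ from $K_1$ and from $K_2$. In dimension 2, vectors are embedded in $\mathbb{R}^3$ with zero third component to form cross products. For $u\in U_h$, $u\cdot n$ is single-valued on $e$. Trilinear forms $a_h:W_h\times U_h\times U_h\to\mathbb{R}$ and $b_h:U_h\times F_h\times F_h\to\mathbb{R}$: $$a_h(w,u,v)=\sum_{K\in\mathcal{T}_h}\int_K w\cdot(v\cdot\nabla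 u-u\cdot\nabla v)\,dx+\sum_{e\in\mathcal{E}_h}\int_e(n\times\{w\})\cdot\llbracket u\times v\rrbracket\,ds,$$ $$b_h(u,f,g)=\sum_{K\in\mathcal{T}_h}\int_K(u\cdot\nabla f)g\,dx-\sum_{e\in\mathcal{E}_h}\int_e u\cdot\llbracket f\rrbracket\{g\}\,ds.$$ Parameters: for each $e\in\mathcal{E}_h$ and $u\in U_h$, $\alpha_e(u)$ and $\beta_e(u)$ are functions on $e$ that may depend on $u$, such that the integrals in the scheme are well defined. $\beta_e(u)\ge 0$; $\alpha_e(u)$ is either nonnegative or of the form $c_1\frac{u\cdot n}{|u\cdot n|}$ with $c_1\in[0,\frac12]$ (taken to be $0$ where $u\cdot n=0$). Where $u\cdot n=0$, $\beta_e(u)$ is assumed to vanish (as for the standard choice $\beta_e(u)=c_2|u\cdot n|$, $c_2\in[0,\frac12]$), and the coefficient $\frac{\beta_e(u)}{2|u\cdot n|^2}(u\cdot n)(v\cdot n)$ is taken to be $0$ there. *)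

theory Defs
  imports "HOL-Analysis.Analysis"
begin

section \<open>Function spaces on a domain\<close>

text \<open>Elements of \<open>L\<^sup>2(\<Omega>)\<close> are represented by functions on the whole space; only their
  values on \<open>\<Omega>\<close> matter.\<close>

definition L2 :: "'a::euclidean_space set \<Rightarrow> ('a \<Rightarrow> 'b::euclidean_space) \<Rightarrow> bool" where
  "L2 \<Omega> f \<longleftrightarrow> f \<in> borel_measurable (lebesgue_on \<Omega>) \<and>
     integrable (lebesgue_on \<Omega>) (\<lambda>x. (norm (f x))\<^sup>2)"

definition l2_inner :: "'a::euclidean_space set \<Rightarrow> ('a \<Rightarrow> 'b::euclidean_space) \<Rightarrow> ('a \<Rightarrow> 'b) \<Rightarrow> real" where
  "l2_inner \<Omega> f g = (LINT x|lebesgue_on \<Omega>. f x \<bullet> g x)"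

definition C1_with_grad :: "'a::euclidean_space set \<Rightarrow> ('a \<Rightarrow> real) \<Rightarrow> ('a \<Rightarrow> 'a) \<Rightarrow> bool" where
  "C1_with_grad \<Omega> \<phi> G \<longleftrightarrow> (\<forall>x\<in>\<Omega>. GDERIV \<phi> x :> G x) \<and> continuous_on \<Omega> G"

text \<open>The weak divergence, tested against \<open>C\<^sup>1\<close> functions with compact support in \<open>\<Omega>\<close>.\<close>

definition has_weak_div :: "'a::euclidean_space set \<Rightarrow> ('a \<Rightarrow> 'a) \<Rightarrow> ('a \<Rightarrow> real) \<Rightarrow> bool" where
  "has_weak_div \<Omega> u g \<longleftrightarrow> L2 \<Omega> g \<and>
     (\<forall>\<phi> G. C1_with_grad \<Omega> \<phi> G \<and> (\<exists>C. compact C \<and> C \<subseteq> \<Omega> \<and> (\<forall>x. x \<notin> C \<longrightarrow> \<phi> x = 0 \<and> G x = 0))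
        \<longrightarrow> l2_inner \<Omega> u G = - l2_inner \<Omega> g \<phi>)"

definition weak_div :: "'a::euclidean_space set \<Rightarrow> ('a \<Rightarrow> 'a) \<Rightarrow> 'a \<Rightarrow> real" where
  "weak_div \<Omega> u = (SOME g. has_weak_div \<Omega> u g)"

text \<open>\<open>H\<^sub>0(div,\<Omega>)\<close>. The normal trace of \<open>u\<close> on the boundary is the functional
  \<open>\<phi> \<mapsto> \<integral>\<^sub>\<Omega> u \<bullet> \<nabla>\<phi> + (div u) \<phi>\<close> on \<open>H\<^sup>1(\<Omega>)\<close>, and \<open>u \<bullet> n = 0\<close> says that it vanishes.
  It suffices to test with the functions in \<open>C\<^sup>1(\<Omega>) \<inter> H\<^sup>1(\<Omega>)\<close>, which are dense
  in \<open>H\<^sup>1(\<Omega>)\<close> for every open set \<open>\<Omega>\<close> (Meyers--Serrin).\<close>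

definition normal_trace_zero :: "'a::euclidean_space set \<Rightarrow> ('a \<Rightarrow> 'a) \<Rightarrow> ('a \<Rightarrow> real) \<Rightarrow> bool" where
  "normal_trace_zero \<Omega> u g \<longleftrightarrow>
     (\<forall>\<phi> G. C1_with_grad \<Omega> \<phi> G \<and> L2 \<Omega> \<phi> \<and> L2 \<Omega> G \<longrightarrow> l2_inner \<Omega> u G + l2_inner \<Omega> g \<phi> = 0)"

definition H0div :: "'a::euclidean_space set \<Rightarrow> ('a \<Rightarrow> 'a) set" where
  "H0div \<Omega> = {u. L2 \<Omega> u \<and> (\<exists>g. has_weak_div \<Omega> u g \<and> normal_trace_zero \<Omega> u g)}"

text \<open>The \<open>L\<^sup>2\<close>-orthogonal projection onto \<open>F\<close>.\<close>

definition L2_proj :: "'a::euclidean_space set \<Rightarrow> ('a \<Rightarrow> real) set \<Rightarrow> ('a \<Rightarrow> real) \<Rightarrow> 'a \<Rightarrow> real" where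
  "L2_proj \<Omega> F f = (SOME g. g \<in> F \<and> (\<forall>h\<in>F. l2_inner \<Omega> g h = l2_inner \<Omega> f h))"

section \<open>Meshes\<close>

definition simplicial_mesh :: "(real^'n::finite) set \<Rightarrow> (real^'n) set set \<Rightarrow> bool" where
  "simplicial_mesh \<Omega> \<T> \<longleftrightarrow> triangulation \<T> \<and> closure \<Omega> = \<Union>\<T> \<and>
     (\<forall>K\<in>\<T>. int CARD('n) simplex K \<and> interior K \<subseteq> \<Omega>)"

text \<open>A facet shared by two elements is interior if it is not part of the boundary of the domain
  (it can be if \<open>\<Omega>\<close> has a slit).\<close>

definition interior_faces :: "(real^'n::finite) set \<Rightarrow> (real^'n) set set \<Rightarrow> (real^'n) set set" where
  "interior_faces \<Omega> \<T> = {e. \<not> e \<subseteq> frontier \<Omega> \<and>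
     (\<exists>K1\<in>\<T>. \<exists>K2\<in>\<T>. K1 \<noteq> K2 \<and> e = K1 \<inter> K2 \<and> e facet_of K1 \<and> e facet_of K2)}"

definition unit_normal :: "(real^'n::finite) set \<Rightarrow> real^'n \<Rightarrow> bool" where
  "unit_normal e n \<longleftrightarrow> norm n = 1 \<and> (\<forall>x\<in>e. \<forall>y\<in>e. (x - y) \<bullet> n = 0)"

text \<open>The two elements at an interior face \<open>e\<close>, ordered such that the chosen unit normal
  \<open>\<nu> e\<close> points from \<open>elem1 \<T> \<nu> e\<close> to \<open>elem2 \<T> \<nu> e\<close>.\<close>

definition elem1 :: "(real^'n::finite) set set \<Rightarrow> ((real^'n) set \<Rightarrow> real^'n) \<Rightarrow> (real^'n) set \<Rightarrow> (real^'n) set" where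
  "elem1 \<T> \<nu> e = (THE K. K \<in> \<T> \<and> e facet_of K \<and> (\<forall>x\<in>K. \<forall>y\<in>e. (x - y) \<bullet> \<nu> e \<le> 0))"

definition elem2 :: "(real^'n::finite) set set \<Rightarrow> ((real^'n) set \<Rightarrow> real^'n) \<Rightarrow> (real^'n) set \<Rightarrow> (real^'n) set" where
  "elem2 \<T> \<nu> e = (THE K. K \<in> \<T> \<and> e facet_of K \<and> (\<forall>x\<in>K. \<forall>y\<in>e. (x - y) \<bullet> \<nu> e \<ge> 0))"

text \<open>The \<open>(n-1)\<close>-dimensional Lebesgue measure on a flat face \<open>e\<close>: the \<open>n\<close>-dimensional Lebesgue
  measure on the right prism of height \<open>1\<close> over \<open>e\<close>, pushed forward by the orthogonal projection
  onto the hyperplane spanned by \<open>e\<close>.\<close>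

definition prism :: "(real^'n::finite) set \<Rightarrow> (real^'n) set" where
  "prism e = {x. closest_point (affine hull e) x \<in> e \<and>
                 dist x (closest_point (affine hull e) x) \<le> 1/2}"

definition face_measure :: "(real^'n::finite) set \<Rightarrow> (real^'n) measure" where
  "face_measure e = completion (distr (lebesgue_on (prism e)) borel (closest_point (affine hull e)))"

section \<open>Finite element spaces\<close>

text \<open>Polynomial functions of total degree at most \<open>r\<close>.\<close>

definition Poly :: "nat \<Rightarrow> (real^'n::finite \<Rightarrow> real) set" where
  "Poly r = {p. \<exists>c :: ('n \<Rightarrow> nat) \<Rightarrow> real.
     p = (\<lambda>x. \<Sum>a\<in>{a. (\<Sum>i\<in>UNIV. a i) \<le> r}. c a * (\<Prod>i\<in>UNIV. (x$i) ^ a i))}"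

definition VPoly :: "nat \<Rightarrow> (real^'n::finite \<Rightarrow> real^'n) set" where
  "VPoly r = {p. \<forall>i. (\<lambda>x. p x $ i) \<in> Poly r}"

text \<open>Piecewise polynomial fields are represented by functions that agree with the
  respective polynomial on the interior of each element; the values on the mesh skeleton (a null
  set) are arbitrary and never used.\<close>

definition DG :: "(real^'n::finite) set \<Rightarrow> (real^'n) set set \<Rightarrow> nat \<Rightarrow> (real^'n \<Rightarrow> real) set" where
  "DG \<Omega> \<T> r = {f. L2 \<Omega> f \<and> (\<forall>K\<in>\<T>. \<exists>p\<in>Poly r. \<forall>x\<in>interior K. f x = p x)}"

definition RT :: "(real^'n::finite) set \<Rightarrow> (real^'n) set set \<Rightarrow> nat \<Rightarrow> (real^'n \<Rightarrow> real^'n) set" where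
  "RT \<Omega> \<T> s = {u \<in> H0div \<Omega>.
     \<forall>K\<in>\<T>. \<exists>a\<in>VPoly s. \<exists>b\<in>Poly s. \<forall>x\<in>interior K. u x = a x + b x *\<^sub>R x}"

definition BDM :: "(real^'n::finite) set \<Rightarrow> (real^'n) set set \<Rightarrow> nat \<Rightarrow> (real^'n \<Rightarrow> real^'n) set" where
  "BDM \<Omega> \<T> r = {u \<in> H0div \<Omega>. \<forall>K\<in>\<T>. \<exists>a\<in>VPoly r. \<forall>x\<in>interior K. u x = a x}"

section \<open>Traces, jumps and averages\<close>

definition face_trace :: "(real^'n::finite) set \<Rightarrow> (real^'n \<Rightarrow> 'b::t2_space) \<Rightarrow> real^'n \<Rightarrow> 'b" where
  "face_trace K f x = Lim (at x within interior K) f"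

definition avg :: "(real^'n::finite) set set \<Rightarrow> ((real^'n) set \<Rightarrow> real^'n) \<Rightarrow> (real^'n) set
    \<Rightarrow> (real^'n \<Rightarrow> 'b::real_normed_vector) \<Rightarrow> real^'n \<Rightarrow> 'b" where
  "avg \<T> \<nu> e f x = (1/2) *\<^sub>R (face_trace (elem1 \<T> \<nu> e) f x + face_trace (elem2 \<T> \<nu> e) f x)"

definition jump_scalar :: "(real^'n::finite) set set \<Rightarrow> ((real^'n) set \<Rightarrow> real^'n) \<Rightarrow> (real^'n) set
    \<Rightarrow> (real^'n \<Rightarrow> real) \<Rightarrow> real^'n \<Rightarrow> real^'n" where
  "jump_scalar \<T> \<nu> e f x =
     face_trace (elem1 \<T> \<nu> e) f x *\<^sub>R \<nu> e + face_trace (elem2 \<T> \<nu> e) f x *\<^sub>R (- \<nu> e)"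

definition jump_vec :: "(real^'n::finite) set set \<Rightarrow> ((real^'n) set \<Rightarrow> real^'n) \<Rightarrow> (real^'n) set
    \<Rightarrow> (real^'n \<Rightarrow> 'b::real_normed_vector) \<Rightarrow> real^'n \<Rightarrow> 'b" where
  "jump_vec \<T> \<nu> e u x = face_trace (elem1 \<T> \<nu> e) u x - face_trace (elem2 \<T> \<nu> e) u x"

text \<open>On the finite element spaces in \<open>H\<^sub>0(div,\<Omega>)\<close> the normal component is single-valued on
  interior faces, so that it can be taken from either side.\<close>

definition normal_comp :: "(real^'n::finite) set set \<Rightarrow> ((real^'n) set \<Rightarrow> real^'n) \<Rightarrow> (real^'n) set
    \<Rightarrow> (real^'n \<Rightarrow> real^'n) \<Rightarrow> real^'n \<Rightarrow> real" where
  "normal_comp \<T> \<nu> e u x = face_trace (elem1 \<T> \<nu> e) u x \<bullet> \<nu> e"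

text \<open>Cross products are formed in \<open>\<real>\<^sup>3\<close>. The injection \<open>\<iota>\<close> names the coordinates; in dimension
  two its range is \<open>{1,2}\<close> and the third component is zero.\<close>

definition embed3 :: "('n::finite \<Rightarrow> 3) \<Rightarrow> real^'n \<Rightarrow> real^3" where
  "embed3 \<iota> x = (\<Sum>i\<in>UNIV. (x$i) *\<^sub>R axis (\<iota> i) 1)"

definition cross :: "('n::finite \<Rightarrow> 3) \<Rightarrow> real^'n \<Rightarrow> real^'n \<Rightarrow> real^3" where
  "cross \<iota> x y = cross3 (embed3 \<iota> x) (embed3 \<iota> y)"

definition jump_cross :: "('n::finite \<Rightarrow> 3) \<Rightarrow> (real^'n) set set \<Rightarrow> ((real^'n) set \<Rightarrow> real^'n) \<Rightarrow> (real^'n) set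
    \<Rightarrow> (real^'n \<Rightarrow> real^'n) \<Rightarrow> (real^'n \<Rightarrow> real^'n) \<Rightarrow> real^'n \<Rightarrow> real^3" where
  "jump_cross \<iota> \<T> \<nu> e u v x =
     cross \<iota> (face_trace (elem1 \<T> \<nu> e) u x) (face_trace (elem1 \<T> \<nu> e) v x)
   - cross \<iota> (face_trace (elem2 \<T> \<nu> e) u x) (face_trace (elem2 \<T> \<nu> e) v x)"

section \<open>The discrete forms\<close>

text \<open>The Frechet derivative of \<open>u\<close> at \<open>x\<close> applied to \<open>v x\<close> is the directional derivative
  \<open>v \<bullet> \<nabla>u\<close>. It is meaningful in the interior of each element, hence almost everywhere.\<close>

definition a_form :: "('n::finite \<Rightarrow> 3) \<Rightarrow> (real^'n) set \<Rightarrow> (real^'n) set set \<Rightarrow> ((real^'n) set \<Rightarrow> real^'n)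
    \<Rightarrow> (real^'n \<Rightarrow> real^'n) \<Rightarrow> (real^'n \<Rightarrow> real^'n) \<Rightarrow> (real^'n \<Rightarrow> real^'n) \<Rightarrow> real" where
  "a_form \<iota> \<Omega> \<T> \<nu> w u v =
     (\<Sum>K\<in>\<T>. LINT x|lebesgue_on K.
        w x \<bullet> (frechet_derivative u (at x) (v x) - frechet_derivative v (at x) (u x)))
   + (\<Sum>e\<in>interior_faces \<Omega> \<T>. LINT x|face_measure e.
        cross \<iota> (\<nu> e) (avg \<T> \<nu> e w x) \<bullet> jump_cross \<iota> \<T> \<nu> e u v x)"

definition b_form :: "(real^'n::finite) set \<Rightarrow> (real^'n) set set \<Rightarrow> ((real^'n) set \<Rightarrow> real^'n)
    \<Rightarrow> (real^'n \<Rightarrow> real^'n) \<Rightarrow> (real^'n \<Rightarrow> real) \<Rightarrow> (real^'n \<Rightarrow> real) \<Rightarrow> real" where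
  "b_form \<Omega> \<T> \<nu> u f g =
     (\<Sum>K\<in>\<T>. LINT x|lebesgue_on K. frechet_derivative f (at x) (u x) * g x)
   - (\<Sum>e\<in>interior_faces \<Omega> \<T>. LINT x|face_measure e.
        (face_trace (elem1 \<T> \<nu> e) u x \<bullet> jump_scalar \<T> \<nu> e f x) * avg \<T> \<nu> e g x)"

text \<open>The integrands of the three stabilisation terms; \<open>a\<close> and \<open>b\<close> stand for \<open>\<alpha>\<^sub>e(u)\<close> and
  \<open>\<beta>\<^sub>e(u)\<close>. Since division by zero yields zero, the coefficient in the second one is zero
  where \<open>u \<bullet> n = 0\<close>.\<close>

definition alpha_integrand :: "('n::finite \<Rightarrow> 3) \<Rightarrow> (real^'n) set set \<Rightarrow> ((real^'n) set \<Rightarrow> real^'n)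
    \<Rightarrow> (real^'n) set \<Rightarrow> (real^'n \<Rightarrow> real) \<Rightarrow> (real^'n \<Rightarrow> real^'n) \<Rightarrow> (real^'n \<Rightarrow> real^'n)
    \<Rightarrow> (real^'n \<Rightarrow> real^'n) \<Rightarrow> real^'n \<Rightarrow> real" where
  "alpha_integrand \<iota> \<T> \<nu> e a w u v x =
     a x * (cross \<iota> (\<nu> e) (jump_vec \<T> \<nu> e w x) \<bullet> jump_cross \<iota> \<T> \<nu> e u v x)"

definition beta_momentum_integrand :: "(real^'n::finite) set set \<Rightarrow> ((real^'n) set \<Rightarrow> real^'n)
    \<Rightarrow> (real^'n) set \<Rightarrow> (real^'n \<Rightarrow> real) \<Rightarrow> (real^'n \<Rightarrow> real^'n) \<Rightarrow> (real^'n \<Rightarrow> real^'n)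
    \<Rightarrow> (real^'n \<Rightarrow> real) \<Rightarrow> (real^'n \<Rightarrow> real) \<Rightarrow> real^'n \<Rightarrow> real" where
  "beta_momentum_integrand \<T> \<nu> e b u v f r x =
     b x / (2 * \<bar>normal_comp \<T> \<nu> e u x\<bar>\<^sup>2) * (normal_comp \<T> \<nu> e u x * normal_comp \<T> \<nu> e v x)
       * (jump_scalar \<T> \<nu> e f x \<bullet> jump_scalar \<T> \<nu> e r x)"

definition beta_density_integrand :: "(real^'n::finite) set set \<Rightarrow> ((real^'n) set \<Rightarrow> real^'n)
    \<Rightarrow> (real^'n) set \<Rightarrow> (real^'n \<Rightarrow> real) \<Rightarrow> (real^'n \<Rightarrow> real) \<Rightarrow> (real^'n \<Rightarrow> real) \<Rightarrow> real^'n \<Rightarrow> real" where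
  "beta_density_integrand \<T> \<nu> e b f r x =
     b x * (jump_scalar \<T> \<nu> e f x \<bullet> jump_scalar \<T> \<nu> e r x)"

definition half_step :: "(nat \<Rightarrow> 'a \<Rightarrow> 'b::real_vector) \<Rightarrow> nat \<Rightarrow> 'a \<Rightarrow> 'b" where
  "half_step f k x = (1/2) *\<^sub>R (f k x + f (Suc k) x)"

end

(* Testing the density equation with the constant 1 and with the density at the half step gives the
   first two claims, since b_h(u,f,f) = 0 for a discretely divergence-free u. Testing the momentum
   equation with the velocity at the half step and the density equation with the projection of
   u_k . u_{k+1}, the b_h- and beta-terms cancel; since the density increment lies in F_h, the
   projection may be dropped, and the third claim is an algebraic identity.

   The analytic content is b_h(u,f,f) = 0. A vector field F on a simplex with vertices a, outward facet
   normals n_a and heights h_a is the sum over a of (F . n_a / h_a) (x - a), so the divergence theorem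
   reduces to radial fields on a cone. There it follows by scaling the cone, together with a change of
   variables with constant Jacobian that maps the prism defining the face measure onto the cone.
   Testing membership in H_0(div) with bump functions (restricted to one side at a boundary facet)
   shows that the polynomial normal traces match on interior faces and vanish on all other facets. *)

theory Submission
  imports Defs
begin

text \<open>Membership in H_0(div) is a weak statement: divergence and boundary condition are known
  only through integrals against C1 functions on \<open>\<Omega>\<close>, and
  \<open>weak_div\<close> is an arbitrary choice. So the weak divergence is first identified with
  the classical one on each element; after that it can be paired with functions that jump across
  faces, and the choice has no influence.

  One-sided test functions are called for at a boundary facet because \<open>\<Omega>\<close> may
  have a slit: such a facet can have elements on both sides although no function on
  \<open>\<Omega>\<close> sees a connection between them.

  The identity b_h(u,f,f) = 0 is a Green formula for half the square of f. Both parts of the form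
  are exact: f times the derivative of f along u is the derivative of f^2/2, and the jump of f times
  the average of f is the jump of f^2/2. This is where the centred average in b_h matters.

  The factor 1/2 before b_h and the mixed product u_k . u_{k+1} come from the momentum increment
  tested with the mean velocity: besides the change of kinetic energy it leaves half the density
  increment times exactly this product.\<close>

section \<open>Cones and prisms over a face\<close>

text \<open>Cramer's lemma read backwards: replacing column \<open>k\<close> of \<open>r\<close>
  times the identity by its product with a vector \<open>x\<close> multiplies the determinant by
  \<open>x $ k\<close>. The vector is chosen so that this product is the desired column, hence the
  division by \<open>r\<close>.\<close>

lemma det_scale_plus_column:
  fixes w :: "real^'n" and r :: real
  assumes "r \<noteq> 0"
  shows "det (\<chi> i j. (if i = j then r else 0) + (if j = k then w $ i else 0)) = r ^ (CARD('n) - 1) * (r + w $ k)"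
proof -
  define x where "x = (\<chi> i. (if i = k then 1 else 0) + w $ i / r)"
  define M where "M = (mat r :: real^'n^'n)"
  have M: "M $ i $ j = (if i = j then r else 0)" for i j
    by (simp add: M_def mat_def)
  have "(M *v x) $ i = (\<Sum>j\<in>UNIV. if i = j then r * x $ j else 0)" for i
    unfolding matrix_vector_mult_def M by (subst vec_lambda_beta, rule sum.cong) auto
  then have Mx: "(M *v x) $ i = (if i = k then r else 0) + w $ i" for i
    using assms by (simp add: x_def distrib_left)
  have eq: "(\<chi> i j. if j = k then (M *v x) $ i else M $ i $ j)
      = (\<chi> i j. (if i = j then r else 0) + (if j = k then w $ i else 0))"
    unfolding Mx M by (auto simp: vec_eq_iff)
  have "det (\<chi> i j. (if i = j then r else 0) + (if j = k then w $ i else 0))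
      = x $ k * det M"
    using cramer_lemma[of k M x] unfolding eq .
  also have "det M = r ^ CARD('n)"
    by (subst det_diagonal) (auto simp: M)
  also have "r ^ CARD('n) = r ^ (CARD('n) - 1) * r"
    by (simp only: power_minus_mult zero_less_card_finite)
  also have "x $ k * (r ^ (CARD('n) - 1) * r) = r ^ (CARD('n) - 1) * (r + w $ k)"
    using assms by (simp add: x_def distrib_left distrib_right)
  finally show ?thesis .
qed

text \<open>Conjugation by an orthogonal map that sends a coordinate axis to \<open>n\<close> keeps
  the determinant and turns the rank-one term into a change of a single column.\<close>

lemma det_scale_plus_rank_one:
  fixes w n :: "real^'n" and r :: real
  assumes n: "norm n = 1" and r: "r \<noteq> 0"
  shows "det (matrix (\<lambda>v. r *\<^sub>R v + (v \<bullet> n) *\<^sub>R w)) = r ^ (CARD('n) - 1) * (r + w \<bullet> n)"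
proof -
  fix k :: 'n
  let ?A = "\<lambda>v. r *\<^sub>R v + (v \<bullet> n) *\<^sub>R w"
  obtain Q where Q: "orthogonal_transformation Q" "Q (axis k (1::real)) = n"
    using orthogonal_transformation_exists_1[of "axis k 1" n] n by auto
  define Q' where "Q' = inv Q"
  have "bij Q"
    using Q(1) by (rule orthogonal_transformation_bij)
  then have Q': "orthogonal_transformation Q'" "Q' (Q x) = x" "Q (Q' x) = x" for x
    using Q(1) by (simp_all add: Q'_def orthogonal_transformation_inv bij_is_inj bij_is_surj surj_f_inv_f)
  have lin: "linear Q" "linear Q'"
    using Q(1) Q'(1) by (auto intro: orthogonal_transformation_linear)
  have linA: "linear ?A"
    by (auto simp: linear_iff algebra_simps inner_add_left)
  have inner_Q: "Q x \<bullet> Q y = x \<bullet> y" for x y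
    using Q(1) by (simp add: orthogonal_transformation_def)
  have isom: "Q' x \<bullet> y = x \<bullet> Q y" for x y
    using inner_Q[of "Q' x" y] Q'(3)[of x] by simp
  have "det (matrix (Q' \<circ> ?A \<circ> Q)) = det (matrix Q') * det (matrix ?A) * det (matrix Q)"
    using lin linA by (simp add: matrix_compose linear_compose det_mul)
  also have "\<dots> = det (matrix (Q' \<circ> Q)) * det (matrix ?A)"
    using lin by (simp add: matrix_compose det_mul)
  also have "Q' \<circ> Q = id"
    using Q' by auto
  finally have "det (matrix (Q' \<circ> ?A \<circ> Q)) = det (matrix ?A)"
    by (simp only: matrix_id_mat_1 det_I mult_1_left)
  then have "det (matrix ?A) = det (matrix (Q' \<circ> ?A \<circ> Q))" ..
  also have "Q' \<circ> ?A \<circ> Q = (\<lambda>v. r *\<^sub>R v + (v $ k) *\<^sub>R Q' w)"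
  proof
    fix v
    have "Q v \<bullet> n = v $ k"
      using inner_Q[of v "axis k 1"] Q(2) by (simp add: cart_eq_inner_axis)
    then show "(Q' \<circ> ?A \<circ> Q) v = r *\<^sub>R v + (v $ k) *\<^sub>R Q' w"
      using lin Q' by (simp add: linear_add linear_scale)
  qed
  also have "matrix \<dots> = (\<chi> i j. (if i = j then r else 0) + (if j = k then Q' w $ i else 0))"
    by (auto simp: matrix_def vec_eq_iff axis_def)
  also have "det \<dots> = r ^ (CARD('n) - 1) * (r + Q' w $ k)"
    by (rule det_scale_plus_column[OF r])
  also have "Q' w $ k = w \<bullet> n"
    using isom[of w "axis k 1"] Q(2) by (simp add: cart_eq_inner_axis)
  finally show ?thesis .
qed

lemma bounded_measurable_imp_absolutely_integrable:
  fixes f :: "'a::euclidean_space \<Rightarrow> real"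
  assumes S: "S \<in> lmeasurable" and f: "f \<in> borel_measurable (lebesgue_on S)"
    and B: "\<And>x. x \<in> S \<Longrightarrow> \<bar>f x\<bar> \<le> B"
  shows "f absolutely_integrable_on S"
proof -
  have "integrable (lebesgue_on S) (\<lambda>x. B)"
    using S by (simp add: integrable_restrict_space lmeasurable_iff_integrable fmeasurableD)
  then have "integrable (lebesgue_on S) f"
    by (rule Bochner_Integration.integrable_bound) (use f B in \<open>auto simp: space_restrict_space intro!: AE_I2 order_trans[OF B]\<close>)
  then show ?thesis
    using S by (simp add: integrable_restrict_space set_integrable_def fmeasurableD)
qed

lemma bounded_prism:
  fixes e :: "'a::euclidean_space set"
  assumes "compact e"
  shows "bounded {x. x - (x \<bullet> n - c) *\<^sub>R n \<in> e \<and> -1/2 \<le> x \<bullet> n - c \<and> x \<bullet> n - c \<le> 1/2}" (is "bounded ?P")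
proof (rule bounded_subset)
  show "bounded ((\<lambda>(y, s). y + s *\<^sub>R n) ` (e \<times> {-1/2..1/2}))"
    using assms by (intro compact_imp_bounded compact_continuous_image compact_Times compact_Icc)
      (auto simp: split_beta intro!: continuous_intros)
  show "?P \<subseteq> (\<lambda>(y, s). y + s *\<^sub>R n) ` (e \<times> {-1/2..1/2})"
  proof
    fix x assume "x \<in> ?P"
    then have "x = (\<lambda>(y, s). y + s *\<^sub>R n) (x - (x \<bullet> n - c) *\<^sub>R n, x \<bullet> n - c)"
      "(x - (x \<bullet> n - c) *\<^sub>R n, x \<bullet> n - c) \<in> e \<times> {-1/2..1/2}"
      by auto
    then show "x \<in> (\<lambda>(y, s). y + s *\<^sub>R n) ` (e \<times> {-1/2..1/2})"
      by (rule image_eqI)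
  qed
qed

text \<open>The substitution \<open>y + t n \<mapsto> a + (t + 1/2)\<^sup>1\<^sup>/\<^sup>N (y - a)\<close> maps the prism onto the cone; the exponent is
  chosen to make its Jacobian the constant \<open>h / N\<close>.\<close>

lemma integral_cone_prism_wellorder:
  fixes e :: "(real^'n::{finite,wellorder}) set" and g :: "real^'n::_ \<Rightarrow> real"
  assumes n: "norm n = 1" and e: "compact e" "\<And>y. y \<in> e \<Longrightarrow> y \<bullet> n = c"
    and a: "a \<bullet> n = c - h" and h: "h > 0" and g: "continuous_on UNIV g"
  defines "K \<equiv> {x. 0 < (x - a) \<bullet> n \<and> (x - a) \<bullet> n \<le> h \<and> a + (h / ((x - a) \<bullet> n)) *\<^sub>R (x - a) \<in> e}"
  defines "S \<equiv> {x. x - (x \<bullet> n - c) *\<^sub>R n \<in> e \<and> -1/2 < x \<bullet> n - c \<and> x \<bullet> n - c \<le> 1/2}"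
  shows "real CARD('n) * integral K (\<lambda>x. g (a + (h / ((x - a) \<bullet> n)) *\<^sub>R (x - a)))
         = h * integral S (\<lambda>x. g (x - (x \<bullet> n - c) *\<^sub>R n))"
    "(\<lambda>x. g (a + (h / ((x - a) \<bullet> n)) *\<^sub>R (x - a))) absolutely_integrable_on K"
    "(\<lambda>x. g (x - (x \<bullet> n - c) *\<^sub>R n)) absolutely_integrable_on S"
proof -
  define N where "N = real CARD('n)"
  have N: "N > 0" by (simp add: N_def)
  define q where "q x = x - (x \<bullet> n - c) *\<^sub>R n" for x
  define t where "t x = x \<bullet> n - c + 1/2" for x
  define G where "G x = a + (t x powr (1/N)) *\<^sub>R (q x - a)" for x
  \<comment> \<open>Differentiating the product of \<open>t x powr (1/N)\<close> and
    \<open>q x - a\<close> gives a multiple of the identity plus a term that sees \<open>v\<close>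
    only through \<open>v \<bullet> n\<close>, the shape treated by
    \<open>det_scale_plus_rank_one\<close>.\<close>
  define G' where "G' x v = (t x powr (1/N)) *\<^sub>R v + (v \<bullet> n) *\<^sub>R
     (((1/N) * t x powr (1/N - 1)) *\<^sub>R (q x - a) - (t x powr (1/N)) *\<^sub>R n)" for x v
  define f where "f x = g (a + (h / ((x - a) \<bullet> n)) *\<^sub>R (x - a))" for x
  have nn: "n \<bullet> n = 1" using n by (simp add: norm_eq_sqrt_inner)
  have qn: "q x \<bullet> n = c" for x by (simp add: q_def inner_diff_left nn)
  have qa: "(q x - a) \<bullet> n = h" for x by (simp add: inner_diff_left qn a)
  \<comment> \<open>The bottom of the prism, where \<open>t x = 0\<close>, is left out so that
    \<open>powr\<close> is differentiated only at positive arguments; correspondingly the cone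
    \<open>K\<close> omits its apex.\<close>
  have S_eq: "S = {x. q x \<in> e \<and> 0 < t x \<and> t x \<le> 1}"
    by (auto simp: S_def q_def t_def)
  have contq: "continuous_on A q" and contt: "continuous_on A t" for A
    unfolding q_def t_def by (intro continuous_intros)+
  have bS: "bounded S"
    by (rule bounded_subset[OF bounded_prism[OF e(1), of n c]]) (auto simp: S_def)
  have "closed {x. q x \<in> e}"
    using continuous_closed_vimage[OF compact_imp_closed[OF e(1)], of q] contq[of UNIV]
    by (simp add: vimage_def continuous_on_eq_continuous_at)
  moreover have "{x. 0 < t x} \<in> sets borel" "{x. t x \<le> 1} \<in> sets borel"
    unfolding t_def by measurable
  moreover have "S = {x. q x \<in> e} \<inter> {x. 0 < t x} \<inter> {x. t x \<le> 1}" by (auto simp: S_eq)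
  ultimately have Sb: "S \<in> sets borel" by auto
  then have Slm: "S \<in> lmeasurable"
    using bS by (intro bounded_set_imp_lmeasurable) auto
  have der: "(G has_derivative G' x) (at x within S)" if "x \<in> S" for x
  proof -
    have tx: "t x > 0" using that by (simp add: S_eq)
    have "(t has_derivative (\<lambda>v. v \<bullet> n)) (at x within S)"
      unfolding t_def by (auto intro!: derivative_eq_intros)
    then have "((\<lambda>x. t x powr (1/N)) has_derivative (\<lambda>v. (v \<bullet> n) * ((1/N) * t x powr (1/N - 1)))) (at x within S)"
      by (rule DERIV_compose_FDERIV[where f = "\<lambda>z. z powr (1/N)" and g = t, OF has_real_derivative_powr[OF tx]])
    moreover have "((\<lambda>x. q x - a) has_derivative (\<lambda>v. v - (v \<bullet> n) *\<^sub>R n)) (at x within S)"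
      unfolding q_def by (auto intro!: derivative_eq_intros)
    ultimately have "((\<lambda>x. (t x powr (1/N)) *\<^sub>R (q x - a)) has_derivative
        (\<lambda>v. (t x powr (1/N)) *\<^sub>R (v - (v \<bullet> n) *\<^sub>R n) + ((v \<bullet> n) * ((1/N) * t x powr (1/N - 1))) *\<^sub>R (q x - a))) (at x within S)"
      by (rule has_derivative_scaleR)
    then have "((\<lambda>x. a + (t x powr (1/N)) *\<^sub>R (q x - a)) has_derivative
        (\<lambda>v. 0 + ((t x powr (1/N)) *\<^sub>R (v - (v \<bullet> n) *\<^sub>R n) + ((v \<bullet> n) * ((1/N) * t x powr (1/N - 1))) *\<^sub>R (q x - a)))) (at x within S)"
      by (intro has_derivative_add has_derivative_const)
    moreover have "(\<lambda>v. 0 + ((t x powr (1/N)) *\<^sub>R (v - (v \<bullet> n) *\<^sub>R n) + ((v \<bullet> n) * ((1/N) * t x powr (1/N - 1))) *\<^sub>R (q x - a))) = G' x"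
      by (simp add: G'_def scaleR_diff_right mult.commute[of _ "_ \<bullet> _"] fun_eq_iff)
    ultimately show ?thesis
      by (simp only: G_def[abs_def])
  qed
  have det: "det (matrix (G' x)) = h / N" if "x \<in> S" for x
  proof -
    have tx: "t x > 0" using that by (simp add: S_eq)
    let ?r = "t x powr (1/N)"
    have "det (matrix (G' x)) = ?r ^ (CARD('n) - 1) * (?r + (((1/N) * t x powr (1/N - 1)) *\<^sub>R (q x - a) - ?r *\<^sub>R n) \<bullet> n)"
      unfolding G'_def using tx by (subst det_scale_plus_rank_one[OF n]) auto
    \<comment> \<open>Since \<open>n\<close> is a unit vector, the summand \<open>?r\<close>
      cancels. The two powers of \<open>t x\<close> that remain have opposite exponents, so the
      Jacobian is constant.\<close>
    also have "\<dots> = ?r ^ (CARD('n) - 1) * ((1/N) * t x powr (1/N - 1) * h)"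
      by (simp add: inner_diff_left[of "_ *\<^sub>R _"] nn qa)
    also have "?r ^ (CARD('n) - 1) = t x powr (1 - 1/N)"
      using tx N by (subst powr_realpow[symmetric]) (auto simp: powr_powr N_def of_nat_diff field_simps)
    also have "t x powr (1 - 1/N) * ((1/N) * t x powr (1/N - 1) * h) = h / N"
      using tx by (simp add: powr_diff field_simps)
    finally show ?thesis .
  qed
  have Ga: "(G x - a) \<bullet> n = (t x powr (1/N)) * h" for x
    by (simp add: G_def qa)
  have Gq: "a + (h / ((G x - a) \<bullet> n)) *\<^sub>R (G x - a) = q x" if "x \<in> S" for x
    using that h by (simp add: Ga) (simp add: G_def S_eq)
  have tG: "t x = ((G x - a) \<bullet> n / h) powr N" if "x \<in> S" for x
    using that h N by (auto simp: Ga powr_powr S_eq)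
  have inj: "inj_on G S"
  proof (rule inj_onI)
    fix x y assume *: "x \<in> S" "y \<in> S" "G x = G y"
    then have "q x = q y" "t x = t y"
      using Gq tG by metis+
    moreover have "z = q z + (t z - 1/2) *\<^sub>R n" for z by (simp add: q_def t_def)
    ultimately show "x = y" by metis
  qed
  have img: "G ` S = K"
  proof (intro equalityI subsetI)
    fix z assume "z \<in> G ` S"
    then obtain x where x: "x \<in> S" "z = G x" by auto
    then have tx: "0 < t x" "t x \<le> 1" "q x \<in> e" by (auto simp: S_eq)
    then have "t x powr (1/N) \<le> 1"
      using N by (simp add: powr_le1)
    then have "t x powr (1/N) * h \<le> h" using h by simp
    then show "z \<in> K"
      using tx Gq[OF x(1)] Ga[of x] x h by (auto simp: K_def)
  next
    fix z assume z: "z \<in> K"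
    define r where "r = (z - a) \<bullet> n / h"
    have r: "0 < r" "r \<le> 1" using z h by (auto simp: K_def r_def)
    define y where "y = a + (1 / r) *\<^sub>R (z - a)"
    have y: "y \<in> e" using z by (simp add: K_def r_def y_def)
    then have yn: "y \<bullet> n = c" using e by auto
    \<comment> \<open>Solves \<open>G x = z\<close>: the foot of \<open>x\<close> is the radial
      projection \<open>y\<close> of \<open>z\<close>, the power \<open>N\<close> undoes the
      exponent \<open>1/N\<close> on the height fraction \<open>r\<close>, and \<open>1/2\<close>
      undoes the shift in \<open>t\<close>.\<close>
    define x where "x = y + (r powr N - 1/2) *\<^sub>R n"
    have tx: "t x = r powr N" and qx: "q x = y"
      using yn nn by (auto simp: t_def q_def x_def inner_add_left)
    have "x \<in> S" using tx qx y r N by (auto simp: S_eq powr_le1)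
    moreover have "G x = z"
      using r N by (auto simp: G_def tx qx powr_powr) (auto simp: y_def)
    ultimately show "z \<in> G ` S" by blast
  qed
  have cont: "continuous_on UNIV (\<lambda>x. g (q x))"
    using continuous_on_compose2[OF g contq] by auto
  have "bounded (g ` e)"
    using compact_imp_bounded[OF compact_continuous_image[OF continuous_on_subset[OF g] e(1)]] by simp
  then obtain B where B: "\<And>y. y \<in> e \<Longrightarrow> \<bar>g y\<bar> \<le> B"
    unfolding bounded_iff by auto
  have abs: "(\<lambda>x. g (q x)) absolutely_integrable_on S"
    using cont Slm B by (intro bounded_measurable_imp_absolutely_integrable[of _ _ B]
        continuous_imp_measurable_on_sets_lebesgue) (auto intro: continuous_on_subset simp: S_eq)
  then show "(\<lambda>x. g (x - (x \<bullet> n - c) *\<^sub>R n)) absolutely_integrable_on S"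
    by (simp add: q_def)
  have "(\<lambda>x. \<bar>h / N\<bar> *\<^sub>R g (q x)) absolutely_integrable_on S"
    by (rule absolutely_integrable_scaleR_left[OF abs])
  then have "(\<lambda>x. \<bar>det (matrix (G' x))\<bar> *\<^sub>R f (G x)) absolutely_integrable_on S"
    by (subst set_integrable_cong[OF refl refl]) (auto simp: det f_def Gq)
  \<comment> \<open>\<open>integral_change_of_variables\<close> takes vector-valued integrands, so
    the scalar one is carried through \<open>real^1\<close>.\<close>
  then have abs': "(\<lambda>x. \<bar>det (matrix (G' x))\<bar> *\<^sub>R (vec (f (G x)) :: real^1)) absolutely_integrable_on S"
    by (simp add: absolutely_integrable_on_1_iff)
  have "integral (G ` S) (\<lambda>x. vec (f x) :: real^1) = integral S (\<lambda>x. \<bar>det (matrix (G' x))\<bar> *\<^sub>R (vec (f (G x)) :: real^1))"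
    by (rule integral_change_of_variables[OF _ der inj]) (use Slm abs' in auto)
  then have "integral (G ` S) f = integral S (\<lambda>x. \<bar>det (matrix (G' x))\<bar> * f (G x))"
    by (simp add: integral_on_1_eq vec_eq_iff)
  also have "\<dots> = integral S (\<lambda>x. (h / N) * g (q x))"
    by (rule integral_cong) (use h N in \<open>simp add: det f_def Gq\<close>)
  finally show "real CARD('n) * integral K (\<lambda>x. g (a + (h / ((x - a) \<bullet> n)) *\<^sub>R (x - a)))
         = h * integral S (\<lambda>x. g (x - (x \<bullet> n - c) *\<^sub>R n))"
    using N unfolding img f_def q_def by (simp add: N_def)
  have "(\<lambda>x. vec (f x) :: real^1) absolutely_integrable_on G ` S"
    using abs' Slm by (subst absolutely_integrable_change_of_variables[OF _ der inj]) auto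
  then show "(\<lambda>x. g (a + (h / ((x - a) \<bullet> n)) *\<^sub>R (x - a))) absolutely_integrable_on K"
    by (simp add: absolutely_integrable_on_1_iff img f_def)
qed

section \<open>Lebesgue measure under renaming of coordinates\<close>

lemma prod_Basis_vec:
  fixes f :: "real^'n::finite \<Rightarrow> 'b::comm_monoid_mult"
  shows "(\<Prod>b\<in>(Basis :: (real^'n) set). f b) = (\<Prod>i\<in>UNIV. f (axis i 1))"
proof -
  have inj: "inj (\<lambda>i::'n. axis i (1::real))"
    by (simp add: inj_on_def axis_eq_axis)
  have eq: "(Basis :: (real^'n) set) = (\<lambda>i. axis i 1) ` UNIV"
    by (auto simp: Basis_vec_def)
  show ?thesis
    unfolding eq by (subst prod.reindex[OF inj]) simp
qed

text \<open>Lebesgue measure is determined by the volumes of boxes. The preimage of a box is the box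
  with renamed corners, and its volume is the same product in another order.\<close>

lemma lborel_permute:
  fixes \<pi> :: "'m::finite \<Rightarrow> 'n::finite"
  assumes \<pi>: "bij \<pi>"
  shows "distr lborel borel (\<lambda>x::real^'n. \<chi> i. x $ \<pi> i) = (lborel :: (real^'m) measure)"
proof (rule lborel_eqI[symmetric])
  fix l u :: "real^'m"
  assume lu: "\<And>b. b \<in> Basis \<Longrightarrow> l \<bullet> b \<le> u \<bullet> b"
  let ?P = "\<lambda>x::real^'n. (\<chi> i. x $ \<pi> i) :: real^'m"
  let ?P' = "\<lambda>x::real^'m. (\<chi> i. x $ inv \<pi> i) :: real^'n"
  have le: "l $ i \<le> u $ i" for i
    using lu[of "axis i 1"] by (simp add: inner_axis)
  have inv: "\<pi> (inv \<pi> i) = i" "inv \<pi> (\<pi> j) = j" for i j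
    using \<pi> by (simp_all add: bij_is_inj bij_is_surj surj_f_inv_f)
  have meas: "?P \<in> borel_measurable borel"
    by (intro borel_measurable_continuous_onI continuous_on_vec_lambda continuous_intros)
  have "?P -` box l u = box (?P' l) (?P' u)"
    unfolding set_eq_iff vimage_eq mem_box_cart vec_lambda_beta by (metis inv)
  then have "emeasure (distr lborel borel ?P) (box l u) = emeasure lborel (box (?P' l) (?P' u))"
    using meas by (simp add: emeasure_distr)
  also have "\<dots> = (\<Prod>b\<in>Basis. (?P' u - ?P' l) \<bullet> b)"
    by (rule emeasure_lborel_box) (auto simp: Basis_vec_def inner_axis le)
  also have "(\<Prod>b\<in>Basis. (?P' u - ?P' l) \<bullet> b) = (\<Prod>i\<in>UNIV. (u - l) $ inv \<pi> i)"
    by (simp add: prod_Basis_vec inner_axis)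
  also have "\<dots> = (\<Prod>i\<in>UNIV. (u - l) $ i)"
    by (rule prod.reindex_bij_betw) (use \<pi> in \<open>simp add: bij_imp_bij_inv\<close>)
  also have "\<dots> = (\<Prod>b\<in>Basis. (u - l) \<bullet> b)"
    by (simp add: prod_Basis_vec inner_axis)
  finally show "emeasure (distr lborel borel ?P) (box l u) = (\<Prod>b\<in>Basis. (u - l) \<bullet> b)" .
qed simp

lemma integral_permute:
  fixes \<pi> :: "'m::finite \<Rightarrow> 'n::finite" and f :: "real^'m \<Rightarrow> real"
  assumes \<pi>: "bij \<pi>" and f: "f \<in> borel_measurable borel"
  shows "integral\<^sup>L lborel (\<lambda>x. f (\<chi> i. x $ \<pi> i)) = integral\<^sup>L lborel f"
proof -
  have "(\<lambda>x::real^'n. (\<chi> i. x $ \<pi> i) :: real^'m) \<in> borel_measurable borel"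
    by (intro borel_measurable_continuous_onI continuous_on_vec_lambda continuous_intros)
  then show ?thesis
    using f by (subst lborel_permute[OF \<pi>, symmetric], subst integral_distr) simp_all
qed

lemma integral_on_borel_eq_lborel:
  fixes f :: "'a::euclidean_space \<Rightarrow> real"
  assumes "A \<in> sets borel" "(\<lambda>x. indicator A x * f x) \<in> borel_measurable borel"
    and "f absolutely_integrable_on A"
  shows "integral A f = (LINT x|lborel. indicator A x * f x)"
proof -
  have "integral A f = (LINT x:A|lebesgue. f x)"
    using assms by (simp add: set_lebesgue_integral_eq_integral)
  also have "\<dots> = (LINT x|lborel. indicator A x * f x)"
    unfolding set_lebesgue_integral_def using assms by (simp add: integral_completion)
  finally show ?thesis .
qed

text \<open>The library proves change of variables only for well-ordered index types.\<close>

lemma integral_cone_prism_transfer: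
  fixes e :: "(real^'n::finite) set" and g :: "real^'n \<Rightarrow> real" and \<pi> :: "'m::{finite,wellorder} \<Rightarrow> 'n"
  assumes \<pi>: "bij \<pi>"
    and n: "norm n = 1" and e: "compact e" "\<And>y. y \<in> e \<Longrightarrow> y \<bullet> n = c"
    and a: "a \<bullet> n = c - h" and h: "h > 0" and g: "continuous_on UNIV g"
  defines "K \<equiv> {x. 0 < (x - a) \<bullet> n \<and> (x - a) \<bullet> n \<le> h \<and> a + (h / ((x - a) \<bullet> n)) *\<^sub>R (x - a) \<in> e}"
  defines "S \<equiv> {x. x - (x \<bullet> n - c) *\<^sub>R n \<in> e \<and> -1/2 < x \<bullet> n - c \<and> x \<bullet> n - c \<le> 1/2}"
  shows "real CARD('n) * (LINT x|lborel. indicator K x * g (a + (h / ((x - a) \<bullet> n)) *\<^sub>R (x - a)))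
         = h * (LINT x|lborel. indicator S x * g (x - (x \<bullet> n - c) *\<^sub>R n))"
proof -
  \<comment> \<open>A renaming of coordinates is a linear isometry, so the inequalities and the
    radial projection that define cone and prism keep their form under \<open>T\<close>.\<close>
  define T where "T = (\<lambda>x::real^'n. (\<chi> i. x $ \<pi> i) :: real^'m::_)"
  define T' where "T' = (\<lambda>x::real^'m::_. (\<chi> i. x $ inv \<pi> i) :: real^'n)"
  have inv: "\<pi> (inv \<pi> i) = i" "inv \<pi> (\<pi> j) = j" for i j
    using \<pi> by (simp_all add: bij_is_inj bij_is_surj surj_f_inv_f)
  have T'T: "T' (T x) = x" and TT': "T (T' y) = y" for x y
    by (simp_all add: T_def T'_def vec_eq_iff inv)
  have linT: "T (x + y) = T x + T y" "T (x - y) = T x - T y" "T (r *\<^sub>R x) = r *\<^sub>R T x" for x y r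
    by (simp_all add: T_def vec_eq_iff)
  have inner: "T x \<bullet> T y = x \<bullet> y" for x y
    unfolding inner_vec_def T_def
    using sum.reindex_bij_betw[of \<pi> UNIV UNIV "\<lambda>i. x $ i \<bullet> y $ i"] \<pi> by simp
  have contT: "continuous_on A T" and contT': "continuous_on B T'" for A B
    unfolding T_def T'_def by (intro continuous_on_vec_lambda continuous_intros)+
  have mem: "x \<in> T ` e \<longleftrightarrow> T' x \<in> e" for x
    using T'T TT' by (metis image_iff)
  define K1 where "K1 = {x. 0 < (x - T a) \<bullet> T n \<and> (x - T a) \<bullet> T n \<le> h \<and> T a + (h / ((x - T a) \<bullet> T n)) *\<^sub>R (x - T a) \<in> T ` e}"
  define S1 where "S1 = {x. x - (x \<bullet> T n - c) *\<^sub>R T n \<in> T ` e \<and> -1/2 < x \<bullet> T n - c \<and> x \<bullet> T n - c \<le> 1/2}"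
  define gK where "gK x = indicator K1 x * (g \<circ> T') (T a + (h / ((x - T a) \<bullet> T n)) *\<^sub>R (x - T a))" for x
  define gS where "gS x = indicator S1 x * (g \<circ> T') (x - (x \<bullet> T n - c) *\<^sub>R T n)" for x
  have ce: "compact (T ` e)"
    by (intro compact_continuous_image contT e)
  have gT': "continuous_on UNIV (g \<circ> T')"
    by (intro continuous_on_compose contT' continuous_on_subset[OF g]) auto
  have [measurable]: "g \<circ> T' \<in> borel_measurable borel" "T ` e \<in> sets borel"
    using gT' ce by (auto intro: borel_measurable_continuous_onI borel_compact)
  have [measurable]: "K1 \<in> sets borel" "S1 \<in> sets borel"
    unfolding K1_def S1_def by measurable
  have [measurable]: "gK \<in> borel_measurable borel" "gS \<in> borel_measurable borel"
    unfolding gK_def gS_def by measurable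
  have prem: "norm (T n) = 1" "\<And>y. y \<in> T ` e \<Longrightarrow> y \<bullet> T n = c" "T a \<bullet> T n = c - h"
    using n e a by (auto simp: inner norm_eq_sqrt_inner)
  note cp = integral_cone_prism_wellorder[OF prem(1) ce prem(2,3) h gT', folded K1_def S1_def]
  have absK: "(\<lambda>x. (g \<circ> T') (T a + (h / ((x - T a) \<bullet> T n)) *\<^sub>R (x - T a))) absolutely_integrable_on K1"
    by (rule cp(2))
  have absS: "(\<lambda>x. (g \<circ> T') (x - (x \<bullet> T n - c) *\<^sub>R T n)) absolutely_integrable_on S1"
    by (rule cp(3))
  have lbK: "integral K1 (\<lambda>x. (g \<circ> T') (T a + (h / ((x - T a) \<bullet> T n)) *\<^sub>R (x - T a))) = integral\<^sup>L lborel gK"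
    unfolding gK_def by (rule integral_on_borel_eq_lborel[OF _ _ absK]) (fold gK_def, measurable)
  have lbS: "integral S1 (\<lambda>x. (g \<circ> T') (x - (x \<bullet> T n - c) *\<^sub>R T n)) = integral\<^sup>L lborel gS"
    unfolding gS_def by (rule integral_on_borel_eq_lborel[OF _ _ absS]) (fold gS_def, measurable)
  have "gK (T x) = indicator K x * g (a + (h / ((x - a) \<bullet> n)) *\<^sub>R (x - a))" for x
    unfolding gK_def K1_def K_def
    by (simp add: inner linT(2)[symmetric] linT(3)[symmetric] linT(1)[symmetric] mem T'T indicator_def)
  moreover have "gS (T x) = indicator S x * g (x - (x \<bullet> n - c) *\<^sub>R n)" for x
    unfolding gS_def S1_def S_def
    by (simp add: inner linT(2)[symmetric] linT(3)[symmetric] linT(1)[symmetric] mem T'T indicator_def)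
  moreover have "integral\<^sup>L lborel (\<lambda>x. gK (T x)) = integral\<^sup>L lborel gK" "integral\<^sup>L lborel (\<lambda>x. gS (T x)) = integral\<^sup>L lborel gS"
    unfolding T_def by (rule integral_permute[OF \<pi>]; measurable)+
  moreover have "CARD('m) = CARD('n)"
    using \<pi> by (rule bij_betw_same_card)
  ultimately show ?thesis
    using cp(1) unfolding lbK lbS by simp
qed

text \<open>The numeral types \<open>2\<close> and \<open>3\<close> are well-ordered index types of
  the two admissible cardinalities; any bijection from one of them will do.\<close>

lemma integral_cone_prism:
  fixes e :: "(real^'n::finite) set" and g :: "real^'n \<Rightarrow> real"
  assumes dim: "CARD('n) = 2 \<or> CARD('n) = 3"
    and n: "norm n = 1" and e: "compact e" "\<And>y. y \<in> e \<Longrightarrow> y \<bullet> n = c"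
    and a: "a \<bullet> n = c - h" and h: "h > 0" and g: "continuous_on UNIV g"
  defines "K \<equiv> {x. 0 < (x - a) \<bullet> n \<and> (x - a) \<bullet> n \<le> h \<and> a + (h / ((x - a) \<bullet> n)) *\<^sub>R (x - a) \<in> e}"
  defines "S \<equiv> {x. x - (x \<bullet> n - c) *\<^sub>R n \<in> e \<and> -1/2 < x \<bullet> n - c \<and> x \<bullet> n - c \<le> 1/2}"
  shows "real CARD('n) * (LINT x|lborel. indicator K x * g (a + (h / ((x - a) \<bullet> n)) *\<^sub>R (x - a)))
         = h * (LINT x|lborel. indicator S x * g (x - (x \<bullet> n - c) *\<^sub>R n))"
proof -
  consider "CARD('n) = CARD(2)" | "CARD('n) = CARD(3)"
    using dim by auto
  then show ?thesis
  proof cases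
    case 1
    then obtain \<pi> :: "2 \<Rightarrow> 'n" where "bij \<pi>"
      by (metis finite_same_card_bij finite_class.finite_UNIV)
    then show ?thesis
      unfolding K_def S_def by (rule integral_cone_prism_transfer) (use assms in auto)
  next
    case 2
    then obtain \<pi> :: "3 \<Rightarrow> 'n" where "bij \<pi>"
      by (metis finite_same_card_bij finite_class.finite_UNIV)
    then show ?thesis
      unfolding K_def S_def by (rule integral_cone_prism_transfer) (use assms in auto)
  qed
qed

section \<open>Integration over a flat face\<close>

lemma AE_face_measure:
  assumes "closed e"
  shows "AE x in face_measure e. x \<in> e"
proof -
  have "AE x in distr (lebesgue_on (prism e)) borel (closest_point (affine hull e)). x \<in> e"
  proof (subst AE_distr_iff)
    have "closest_point (affine hull e) \<in> borel_measurable borel"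
    proof (cases "e = {}")
      case True
      then show ?thesis by (simp add: closest_point_def[abs_def])
    next
      case False
      then show ?thesis
        by (intro borel_measurable_continuous_onI continuous_on_closest_point) (auto intro: affine_imp_convex affine_affine_hull closed_affine_hull)
    qed
    then show "closest_point (affine hull e) \<in> borel_measurable (lebesgue_on (prism e))"
      by (intro measurable_restrict_space1 measurable_completion) simp
    show "AE x in lebesgue_on (prism e). closest_point (affine hull e) x \<in> e"
      by (rule AE_I2) (simp add: space_restrict_space prism_def)
  qed (use assms in auto)
  then show ?thesis
    unfolding face_measure_def by (rule AE_completion)
qed

text \<open>Rests on the completion in \<open>face_measure\<close>: preimages under \<open>f\<close>
  and \<open>g\<close> differ only off \<open>e\<close>, in a null set. It serves integrands made of
  traces, about which nothing is known off \<open>e\<close>.\<close>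

lemma face_measurable:
  fixes f g :: "real^'n::finite \<Rightarrow> real"
  assumes e: "closed e" and g: "g \<in> borel_measurable borel" and fg: "\<And>x. x \<in> e \<Longrightarrow> f x = g x"
  shows "f \<in> borel_measurable (face_measure e)"
proof (rule measurableI)
  fix A :: "real set" assume A: "A \<in> sets borel"
  have gm: "g \<in> borel_measurable (face_measure e)"
    unfolding face_measure_def by (rule measurable_completion) (simp add: g)
  have ae: "AE x in face_measure e. x \<in> g -` A \<longleftrightarrow> x \<in> f -` A"
    using AE_face_measure[OF e] by eventually_elim (simp add: fg)
  have sp: "space (face_measure e) = UNIV"
    by (simp add: face_measure_def)
  have gA: "g -` A \<in> sets (face_measure e)"
    using measurable_sets[OF gm A] by (simp add: sp)
  have "f -` A \<in> sets (face_measure e)"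
    using completion.in_sets_AE[OF ae[unfolded face_measure_def] gA[unfolded face_measure_def]]
    by (simp add: face_measure_def)
  then show "f -` A \<inter> space (face_measure e) \<in> sets (face_measure e)"
    by (simp add: sp)
qed simp

lemma hyperplane_closest_point:
  fixes n :: "real^'n"
  assumes n: "norm n = 1"
  shows "closest_point {y. y \<bullet> n = c} x = x - (x \<bullet> n - c) *\<^sub>R n"
proof (rule closest_point_unique[symmetric])
  have H: "{y. y \<bullet> n = c} = {y. n \<bullet> y = c}"
    by (simp add: inner_commute)
  show "convex {y. y \<bullet> n = c}" "closed {y. y \<bullet> n = c}"
    unfolding H by (rule convex_hyperplane closed_hyperplane)+
  have nn: "n \<bullet> n = 1"
    using n by (simp add: norm_eq_sqrt_inner)
  then show "x - (x \<bullet> n - c) *\<^sub>R n \<in> {y. y \<bullet> n = c}"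
    by (simp add: inner_diff_left)
  show "\<forall>z\<in>{y. y \<bullet> n = c}. dist x (x - (x \<bullet> n - c) *\<^sub>R n) \<le> dist x z"
  proof clarify
    fix z assume "c = z \<bullet> n"
    then have "\<bar>x \<bullet> n - z \<bullet> n\<bar> \<le> norm (x - z) * norm n"
      using Cauchy_Schwarz_ineq2[of "x - z" n] by (simp add: inner_diff_left)
    then show "dist x (x - (x \<bullet> n - z \<bullet> n) *\<^sub>R n) \<le> dist x z"
      using n by (simp add: dist_norm)
  qed
qed

text \<open>Turns a face integral into a volume integral over the half-open prism of the cone
  substitution. The continuous \<open>g\<close> stands in for an integrand that is controlled on
  \<open>e\<close> only.\<close>

lemma face_integral:
  fixes f g :: "real^'n::finite \<Rightarrow> real"
  assumes n: "norm n = 1" and e: "compact e" "affine hull e = {y. y \<bullet> n = c}"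
    and g: "continuous_on UNIV g" and fg: "\<And>x. x \<in> e \<Longrightarrow> f x = g x"
  defines "S \<equiv> {x. x - (x \<bullet> n - c) *\<^sub>R n \<in> e \<and> -1/2 < x \<bullet> n - c \<and> x \<bullet> n - c \<le> 1/2}"
  shows "integrable (face_measure e) f"
    and "(LINT x|face_measure e. f x) = (LINT x|lborel. indicator S x * g (x - (x \<bullet> n - c) *\<^sub>R n))"
proof -
  define q where "q x = x - (x \<bullet> n - c) *\<^sub>R n" for x
  have cp: "closest_point (affine hull e) = q"
    by (rule ext) (simp add: e hyperplane_closest_point n q_def)
  have "continuous_on UNIV q"
    unfolding q_def by (intro continuous_intros)
  then have [measurable]: "q \<in> borel_measurable borel"
    by (rule borel_measurable_continuous_onI)
  have [measurable]: "g \<in> borel_measurable borel" "e \<in> sets borel"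
    using g e by (auto intro: borel_measurable_continuous_onI borel_compact)
  have "closed e" using e(1) by (rule compact_imp_closed)
  have prism: "prism e = {x. q x \<in> e \<and> -1/2 \<le> x \<bullet> n - c \<and> x \<bullet> n - c \<le> 1/2}"
  proof -
    have "dist x (q x) = \<bar>x \<bullet> n - c\<bar>" for x
      using n by (simp add: q_def dist_norm)
    moreover have "\<bar>r\<bar> \<le> 1/2 \<longleftrightarrow> -1/2 \<le> r \<and> r \<le> 1/2" for r :: real
      by auto
    ultimately show ?thesis
      unfolding prism_def cp by simp
  qed
  have Pm [measurable]: "prism e \<in> sets borel"
    unfolding prism by measurable
  have Sm [measurable]: "S \<in> sets borel"
    unfolding S_def q_def[symmetric] by measurable
  have fm: "f \<in> borel_measurable (face_measure e)"
    by (rule face_measurable[OF \<open>closed e\<close>, where g = g]) (auto simp: fg)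
  have gm: "g \<in> borel_measurable (face_measure e)"
    unfolding face_measure_def by (rule measurable_completion) simp
  have ae: "AE x in face_measure e. f x = g x"
    using AE_face_measure[OF \<open>closed e\<close>] by eventually_elim (rule fg)
  have qm: "q \<in> borel_measurable (lebesgue_on (prism e))"
    by (intro measurable_restrict_space1) (auto intro: measurable_completion)
  have "bounded (g ` e)"
    using compact_imp_bounded[OF compact_continuous_image[OF continuous_on_subset[OF g] e(1)]] by simp
  then obtain B where B: "\<And>y. y \<in> e \<Longrightarrow> \<bar>g y\<bar> \<le> B"
    unfolding bounded_iff by auto
  have "bounded (prism e)"
    by (rule bounded_subset[OF bounded_prism[OF e(1), of n c]]) (auto simp: prism q_def)
  then have Plm: "prism e \<in> lmeasurable"
    by (rule bounded_set_imp_lmeasurable) (use Pm in auto)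
  have "(\<lambda>x. g (q x)) absolutely_integrable_on prism e"
    by (rule bounded_measurable_imp_absolutely_integrable[OF Plm measurable_compose[OF qm], of _ B])
       (auto simp: B prism)
  then have int: "integrable (lebesgue_on (prism e)) (\<lambda>x. g (q x))"
    using Plm by (simp add: integrable_restrict_space set_integrable_def)
  have "integrable (face_measure e) g"
    unfolding face_measure_def cp using int qm
    by (simp add: integrable_completion integrable_distr_eq)
  then show "integrable (face_measure e) f"
    using integrable_cong_AE[OF fm gm ae] by simp
  have "(LINT x|face_measure e. f x) = (LINT x|face_measure e. g x)"
    by (rule integral_cong_AE[OF fm gm ae])
  also have "\<dots> = (LINT x|lebesgue_on (prism e). g (q x))"
    unfolding face_measure_def cp using qm by (simp add: integral_completion integral_distr)
  also have "\<dots> = (LINT x|lborel. indicator (prism e) x * g (q x))"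
    using Pm by (simp add: integral_restrict_space integral_completion)
  \<comment> \<open>The bottom of the closed prism lies in a hyperplane and is null; dropping it
    gives the half-open prism \<open>S\<close>.\<close>
  also have "\<dots> = (LINT x|lborel. indicator S x * g (q x))"
  proof (rule integral_cong_AE)
    have "negligible {x. n \<bullet> x = c - 1/2}"
      using n by (intro negligible_hyperplane) auto
    then have "{x. n \<bullet> x = c - 1/2} \<in> null_sets lborel"
      by (simp add: negligible_iff_null_sets null_sets_completion_iff closed_hyperplane)
    then have "AE x in lborel. n \<bullet> x \<noteq> c - 1/2"
      by (auto dest: AE_not_in)
    then show "AE x in lborel. indicator (prism e) x * g (q x) = indicator S x * g (q x)"
      by eventually_elim (auto simp: prism S_def q_def indicator_def inner_commute)
  qed measurable
  finally show "(LINT x|face_measure e. f x) = (LINT x|lborel. indicator S x * g (x - (x \<bullet> n - c) *\<^sub>R n))"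
    by (simp add: q_def)
qed

section \<open>Continuously differentiable functions and cones\<close>

lemma C1_with_grad_const: "C1_with_grad UNIV (\<lambda>x. c) (\<lambda>x. 0)"
  by (simp add: C1_with_grad_def GDERIV_const)

lemma C1_with_grad_inner: "C1_with_grad UNIV (\<lambda>x. x \<bullet> v) (\<lambda>x. v)"
  unfolding C1_with_grad_def gderiv_def by (auto intro!: derivative_eq_intros)

lemma C1_with_grad_add:
  assumes "C1_with_grad S f F" "C1_with_grad S g G"
  shows "C1_with_grad S (\<lambda>x. f x + g x) (\<lambda>x. F x + G x)"
  using assms unfolding C1_with_grad_def by (auto intro: GDERIV_add continuous_on_add)

lemma C1_with_grad_imp_continuous:
  assumes "C1_with_grad S f F"
  shows "continuous_on S f"
  using assms unfolding C1_with_grad_def gderiv_def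
  by (auto intro!: continuous_at_imp_continuous_on has_derivative_continuous)

lemma C1_with_grad_mult:
  assumes "C1_with_grad S f F" "C1_with_grad S g G"
  shows "C1_with_grad S (\<lambda>x. f x * g x) (\<lambda>x. f x *\<^sub>R G x + g x *\<^sub>R F x)"
  using assms C1_with_grad_imp_continuous[OF assms(1)] C1_with_grad_imp_continuous[OF assms(2)]
  unfolding C1_with_grad_def by (auto intro: GDERIV_mult intro!: continuous_intros)

lemma C1_with_grad_compose:
  assumes f: "C1_with_grad S f F"
    and h: "\<And>t. (h has_real_derivative h' t) (at t)" "continuous_on UNIV h'"
  shows "C1_with_grad S (\<lambda>x. h (f x)) (\<lambda>x. h' (f x) *\<^sub>R F x)"
  unfolding C1_with_grad_def
proof (intro conjI ballI)
  show "GDERIV (\<lambda>x. h (f x)) x :> h' (f x) *\<^sub>R F x" if "x \<in> S" for x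
    using f h(1) that unfolding C1_with_grad_def by (intro GDERIV_DERIV_compose) auto
  show "continuous_on S (\<lambda>x. h' (f x) *\<^sub>R F x)"
    using f C1_with_grad_imp_continuous[OF f] unfolding C1_with_grad_def
    by (intro continuous_intros continuous_on_compose2[OF h(2)]) auto
qed

lemma C1_with_grad_unique:
  assumes "C1_with_grad UNIV f F" "C1_with_grad UNIV f G"
  shows "F = G"
proof
  fix x
  have "(\<lambda>h. h \<bullet> F x) = (\<lambda>h. h \<bullet> G x)"
    using assms unfolding C1_with_grad_def gderiv_def by (blast intro: has_derivative_unique)
  then show "F x = G x"
    by (metis vector_eq_ldot)
qed

definition C1 :: "('a::euclidean_space \<Rightarrow> real) \<Rightarrow> bool" where
  "C1 f \<longleftrightarrow> (\<exists>F. C1_with_grad UNIV f F)"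

text \<open>Determined for \<open>C1\<close> functions because a derivative fixes the vector that
  represents it (\<open>C1_with_grad_unique\<close>); for other functions the value is
  unspecified.\<close>

definition grad :: "('a::euclidean_space \<Rightarrow> real) \<Rightarrow> 'a \<Rightarrow> 'a" where
  "grad f = (THE F. C1_with_grad UNIV f F)"

lemma grad_eq:
  assumes "C1_with_grad UNIV f F"
  shows "grad f = F"
  unfolding grad_def using assms C1_with_grad_unique by blast

lemma C1_grad: "C1 f \<Longrightarrow> C1_with_grad UNIV f (grad f)"
  unfolding C1_def using grad_eq by blast

lemma C1_intro: "C1_with_grad UNIV f F \<Longrightarrow> C1 f"
  unfolding C1_def by blast

lemma C1_const [simp]: "C1 (\<lambda>x. c)"
  by (rule C1_intro[OF C1_with_grad_const])

lemma C1_inner [simp]: "C1 (\<lambda>x. x \<bullet> v)"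
  by (rule C1_intro[OF C1_with_grad_inner])

lemma C1_nth [simp]: "C1 (\<lambda>x::real^'n. x $ i)"
  using C1_inner[of "axis i 1"] by (simp add: cart_eq_inner_axis)

lemma C1_add: "C1 f \<Longrightarrow> C1 g \<Longrightarrow> C1 (\<lambda>x. f x + g x)"
  by (blast intro: C1_intro C1_with_grad_add C1_grad)

lemma C1_mult: "C1 f \<Longrightarrow> C1 g \<Longrightarrow> C1 (\<lambda>x. f x * g x)"
  by (blast intro: C1_intro C1_with_grad_mult C1_grad)

lemma C1_diff: "C1 f \<Longrightarrow> C1 g \<Longrightarrow> C1 (\<lambda>x. f x - g x)"
  using C1_add[of f "\<lambda>x. (-1) * g x"] C1_mult[OF C1_const[of "-1"], of g] by simp

lemma C1_sum: "(\<And>i. i \<in> I \<Longrightarrow> C1 (f i)) \<Longrightarrow> C1 (\<lambda>x. \<Sum>i\<in>I. f i x)"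
  by (induction I rule: infinite_finite_induct) (auto intro: C1_add)

lemma C1_prod: "(\<And>i. i \<in> I \<Longrightarrow> C1 (f i)) \<Longrightarrow> C1 (\<lambda>x. \<Prod>i\<in>I. f i x)"
  by (induction I rule: infinite_finite_induct) (auto intro: C1_mult)

lemma C1_power: "C1 f \<Longrightarrow> C1 (\<lambda>x. f x ^ k)"
  by (induction k) (auto intro: C1_mult)

lemma C1_compose:
  assumes "C1 f" "\<And>t. (h has_real_derivative h' t) (at t)" "continuous_on UNIV h'"
  shows "C1 (\<lambda>x. h (f x))"
  by (rule C1_intro[OF C1_with_grad_compose[OF C1_grad[OF assms(1)] assms(2,3)]])

lemma C1_continuous: "C1 f \<Longrightarrow> continuous_on S f"
  using C1_with_grad_imp_continuous[OF C1_grad] continuous_on_subset by blast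

lemma C1_grad_continuous: "C1 f \<Longrightarrow> continuous_on S (grad f)"
  using C1_grad[of f] continuous_on_subset unfolding C1_with_grad_def by blast

lemma C1_has_derivative: "C1 f \<Longrightarrow> (f has_derivative (\<lambda>v. v \<bullet> grad f x)) (at x)"
  using C1_grad[of f] unfolding C1_with_grad_def gderiv_def by blast

lemma grad_mult:
  assumes "C1 f" "C1 g"
  shows "grad (\<lambda>x. f x * g x) x = f x *\<^sub>R grad g x + g x *\<^sub>R grad f x"
  using grad_eq[OF C1_with_grad_mult[OF C1_grad[OF assms(1)] C1_grad[OF assms(2)]]] by simp

lemma grad_add:
  assumes "C1 f" "C1 g"
  shows "grad (\<lambda>x. f x + g x) x = grad f x + grad g x"
  using grad_eq[OF C1_with_grad_add[OF C1_grad[OF assms(1)] C1_grad[OF assms(2)]]] by simp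

lemma grad_const [simp]: "grad (\<lambda>x. c) = (\<lambda>x. 0)"
  by (rule grad_eq[OF C1_with_grad_const])

lemma grad_sum:
  "(\<And>i. i \<in> I \<Longrightarrow> C1 (f i)) \<Longrightarrow> grad (\<lambda>x. \<Sum>i\<in>I. f i x) x = (\<Sum>i\<in>I. grad (f i) x)"
  by (induction I rule: infinite_finite_induct) (auto simp: grad_add C1_sum)

lemma lborel_integral_affine:
  fixes f :: "'a::euclidean_space \<Rightarrow> real"
  assumes c: "c > 0" and f: "f \<in> borel_measurable borel"
  shows "integral\<^sup>L lborel f = c ^ DIM('a) * integral\<^sup>L lborel (\<lambda>x. f (t + c *\<^sub>R x))"
proof -
  have "integral\<^sup>L lborel f = integral\<^sup>L (density (distr lborel borel (\<lambda>x. t + c *\<^sub>R x)) (\<lambda>_. \<bar>c\<bar> ^ DIM('a))) f"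
    using c by (subst lborel_affine[of c t]) auto
  also have "\<dots> = c ^ DIM('a) * integral\<^sup>L lborel (\<lambda>x. f (t + c *\<^sub>R x))"
    using c f by (subst integral_density) (auto simp: integral_distr)
  finally show ?thesis .
qed

text \<open>Both sides are the derivative at \<open>t = 1\<close> of the integral of \<open>f - f \<circ> \<pi>\<close> over the cone scaled
  by \<open>t\<close>, where \<open>\<pi>\<close> is the radial projection onto the base. That derivative vanishes because the
  integrand is small near the base.\<close>

lemma cone_divergence:
  fixes e :: "(real^'n::finite) set" and f :: "real^'n \<Rightarrow> real"
  assumes dim: "CARD('n) = 2 \<or> CARD('n) = 3"
    and n: "norm n = 1" and e: "compact e" "affine hull e = {y. y \<bullet> n = c}"
    and a: "a \<bullet> n = c - h" and h: "h > 0" and f: "C1 f"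
  defines "K \<equiv> {a + r *\<^sub>R (y - a) | r y. r \<in> {0..1} \<and> y \<in> e}"
  shows "(LINT x|lborel. indicator K x * (real CARD('n) * f x + grad f x \<bullet> (x - a)))
         = h * (LINT x|face_measure e. f x)"
proof -
  define N where "N = CARD('n)"
  define \<pi> where "\<pi> x = a + (h / ((x - a) \<bullet> n)) *\<^sub>R (x - a)" for x
  define K0 where "K0 = {x. 0 < (x - a) \<bullet> n \<and> (x - a) \<bullet> n \<le> h \<and> \<pi> x \<in> e}"
  have en: "y \<bullet> n = c" if "y \<in> e" for y
    using that hull_subset[of e affine] e(2) by auto
  have ray: "(y - a) \<bullet> n = h" if "y \<in> e" for y
    using en[OF that] a by (simp add: inner_diff_left)
  have ray_pi: "\<pi> (a + r *\<^sub>R (y - a)) = y" if "y \<in> e" "r > 0" for r y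
    using ray[OF that(1)] that(2) h by (simp add: \<pi>_def)
  have K_image: "K = (\<lambda>(r,y). a + r *\<^sub>R (y - a)) ` ({0..1} \<times> e)"
    by (force simp: K_def)
  have cK: "compact K"
    unfolding K_image using e(1)
    by (intro compact_continuous_image compact_Times compact_Icc)
       (auto simp: split_beta intro!: continuous_intros)
  \<comment> \<open>The description by the radial projection and the one by segments can disagree
    only at the apex, which is a null set.\<close>
  have K0: "x \<in> K0 \<longleftrightarrow> x \<in> K" if "x \<noteq> a" for x
  proof
    assume "x \<in> K0"
    then have "x = a + ((x - a) \<bullet> n / h) *\<^sub>R (\<pi> x - a)" "(x - a) \<bullet> n / h \<in> {0..1}" "\<pi> x \<in> e"
      using h by (auto simp: K0_def \<pi>_def)
    then show "x \<in> K" unfolding K_def by blast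
  next
    assume "x \<in> K"
    then obtain r y where "x = a + r *\<^sub>R (y - a)" "r \<in> {0..1}" "y \<in> e"
      by (auto simp: K_def)
    moreover from this have "r > 0" using that by (cases "r = 0") auto
    ultimately show "x \<in> K0"
      using h by (auto simp: K0_def ray ray_pi)
  qed
  have Km [measurable]: "K \<in> sets borel"
    using cK by (rule borel_compact)
  have [measurable]: "f \<in> borel_measurable borel" "grad f \<in> borel_measurable borel"
    using C1_continuous[OF f] C1_grad_continuous[OF f] by (auto intro: borel_measurable_continuous_onI)
  have [measurable]: "\<pi> \<in> borel_measurable borel"
    unfolding \<pi>_def by measurable
  have em [measurable]: "e \<in> sets borel" using e(1) by (rule borel_compact)
  have K0m [measurable]: "K0 \<in> sets borel"
    unfolding K0_def by measurable
  \<comment> \<open>A radially constant integrand is exactly what the substitution between cone and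
    prism handles.\<close>
  have radial: "real N * (LINT x|lborel. indicator K x * f (\<pi> x)) = h * (LINT x|face_measure e. f x)"
  proof -
    have "real N * (LINT x|lborel. indicator K0 x * f (\<pi> x)) = h * (LINT x|face_measure e. f x)"
      unfolding N_def K0_def \<pi>_def
      by (subst integral_cone_prism[OF dim n e(1) en a h C1_continuous[OF f]])
         (simp_all add: face_integral[OF n e C1_continuous[OF f] refl])
    moreover have "(LINT x|lborel. indicator K0 x * f (\<pi> x)) = (LINT x|lborel. indicator K x * f (\<pi> x))"
    proof (rule integral_cong_AE)
      have "AE x in lborel. x \<noteq> a" by (rule AE_lborel_singleton)
      then show "AE x in lborel. indicator K0 x * f (\<pi> x) = indicator K x * f (\<pi> x)"
        by eventually_elim (simp add: K0 indicator_def)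
    qed measurable
    ultimately show ?thesis by simp
  qed
  obtain F where F: "\<And>x. x \<in> K \<Longrightarrow> \<bar>f x\<bar> \<le> F"
    using compact_imp_bounded[OF compact_continuous_image[OF C1_continuous[OF f] cK]]
    by (auto simp: bounded_iff)
  obtain G where G: "\<And>x. x \<in> K \<Longrightarrow> norm (grad f x) \<le> G"
    using compact_imp_bounded[OF compact_continuous_image[OF C1_grad_continuous[OF f] cK]]
    by (auto simp: bounded_iff)
  obtain R where R: "\<And>x. x \<in> K \<Longrightarrow> norm (x - a) \<le> R"
  proof -
    have "bounded ((\<lambda>x. x - a) ` K)"
      using cK by (intro compact_imp_bounded compact_continuous_image continuous_intros)
    then show ?thesis
      using that by (auto simp: bounded_iff)
  qed
  define M where "M = G * R"
  have GR: "\<bar>grad f z \<bullet> (x - a)\<bar> \<le> M" if "z \<in> K" "x \<in> K" for x z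
  proof -
    have "\<bar>grad f z \<bullet> (x - a)\<bar> \<le> norm (grad f z) * norm (x - a)"
      by (rule Cauchy_Schwarz_ineq2)
    also have "\<dots> \<le> G * R"
      using G[OF that(1)] R[OF that(2)] by (intro mult_mono) (auto intro: order_trans[OF norm_ge_zero])
    finally show ?thesis by (simp add: M_def)
  qed
  have scale: "a + s *\<^sub>R (x - a) \<in> K" if x: "x \<in> K" and s: "0 \<le> s" "s \<le> 1" for x s
  proof -
    obtain r y where "x = a + r *\<^sub>R (y - a)" "r \<in> {0..1}" "y \<in> e"
      using x by (auto simp: K_def)
    then have "a + s *\<^sub>R (x - a) = a + (s * r) *\<^sub>R (y - a)" "s * r \<in> {0..1}"
      using s by (auto intro: mult_le_one)
    then show ?thesis using \<open>y \<in> e\<close> unfolding K_def by blast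
  qed
  have eK: "y \<in> K" if "y \<in> e" for y
    unfolding K_def using that by (auto intro!: exI[of _ "1::real"] exI[of _ y])
  have deriv: "((\<lambda>s. f (a + s *\<^sub>R (x - a))) has_real_derivative grad f (a + s *\<^sub>R (x - a)) \<bullet> (x - a)) (at s)" for x s
  proof -
    have "((\<lambda>s. a + s *\<^sub>R (x - a)) has_derivative (\<lambda>t. t *\<^sub>R (x - a))) (at s)"
      by (auto intro!: derivative_eq_intros)
    from has_derivative_compose[OF this C1_has_derivative[OF f]]
    show ?thesis
      by (simp add: has_field_derivative_def inner_commute mult_commute_abs)
  qed
  \<comment> \<open>If dilation by \<open>1 / t\<close> moves \<open>x\<close> out of the cone, then
    \<open>x\<close> lies beyond the fraction \<open>t\<close> of its ray, and the mean value
    theorem on the rest of the ray gives the bound.\<close>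
  have near: "\<bar>f x - f (\<pi> x)\<bar> \<le> M * (1 - t)" if x: "x \<in> K" "a + (1 / t) *\<^sub>R (x - a) \<notin> K" and t: "0 < t" "t < 1" for x t
  proof -
    obtain r y where ry: "x = a + r *\<^sub>R (y - a)" "r \<in> {0..1}" "y \<in> e"
      using x(1) by (auto simp: K_def)
    have "r > t"
    proof (rule ccontr)
      assume "\<not> r > t"
      then have "r / t \<in> {0..1}" "a + (1 / t) *\<^sub>R (x - a) = a + (r / t) *\<^sub>R (y - a)"
        using ry t by auto
      then show False using x(2) ry(3) unfolding K_def by blast
    qed
    have gb: "norm (grad f (a + z *\<^sub>R (y - a)) \<bullet> (y - a)) \<le> M" if "z \<in> {0..1}" for z
      using GR[OF scale[OF eK[OF ry(3)]] eK[OF ry(3)], of z] that by simp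
    have "norm (f (a + 1 *\<^sub>R (y - a)) - f (a + r *\<^sub>R (y - a))) \<le> M * norm (1 - r)"
      by (rule field_differentiable_bound[of "{0..1}" "\<lambda>s. f (a + s *\<^sub>R (y - a))", OF _ DERIV_subset[OF deriv] gb])
         (use ry in auto)
    moreover have "\<pi> x = y" using ry ray_pi t \<open>r > t\<close> by auto
    moreover have "M * (1 - r) \<le> M * (1 - t)"
      using \<open>r > t\<close> GR[OF x(1) x(1)] by (intro mult_left_mono) auto
    ultimately show ?thesis using ry by (auto simp: abs_minus_commute)
  qed
  define d where "d x = f x - f (\<pi> x)" for x
  have dm [measurable]: "d \<in> borel_measurable borel" unfolding d_def by measurable
  have fpi: "\<bar>f (\<pi> x)\<bar> \<le> F" if "x \<in> K" "x \<noteq> a" for x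
    using K0[OF that(2)] that(1) eK F by (auto simp: K0_def)
  \<comment> \<open>The offset 2 keeps \<open>\<epsilon> j\<close> strictly below 1, so that the
    scaling factor \<open>1 - \<epsilon> j\<close> is positive.\<close>
  define \<epsilon> where "\<epsilon> j = 1 / (real j + 2)" for j :: nat
  have eps: "0 < \<epsilon> j" "\<epsilon> j < 1" for j by (auto simp: \<epsilon>_def)
  have eps0: "\<epsilon> \<longlonglongrightarrow> 0"
    unfolding \<epsilon>_def using LIMSEQ_Suc[OF LIMSEQ_inverse_real_of_nat]
    by (simp add: inverse_eq_divide algebra_simps)
  define V where "V = (LINT x|lborel. indicator K x :: real)"
  \<comment> \<open>The integrand over the cone scaled by \<open>t\<close>, pulled back to the
    unscaled cone: \<open>t ^ N\<close> is the Jacobian, and \<open>\<pi>\<close> is constant on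
    rays. The functions \<open>u j\<close> are the backward difference quotients at
    \<open>t = 1\<close>.\<close>
  define \<psi> where "\<psi> x t = t ^ N * (f (a + t *\<^sub>R (x - a)) - f (\<pi> x))" for x t
  define u where "u j x = indicator K x * ((\<psi> x 1 - \<psi> x (1 - \<epsilon> j)) / \<epsilon> j)" for j x
  define B where "B = real N * (2 * F) + M"
  have \<psi>_deriv: "(\<psi> x has_real_derivative (real N * s ^ (N - 1)) * (f (a + s *\<^sub>R (x - a)) - f (\<pi> x)) + (grad f (a + s *\<^sub>R (x - a)) \<bullet> (x - a)) * s ^ N) (at s)" for x s
    unfolding \<psi>_def by (rule derivative_eq_intros deriv | simp)+
  have u_lim: "(\<lambda>j. u j x) \<longlonglongrightarrow> indicator K x * (real N * d x + grad f x \<bullet> (x - a))" for x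
  proof -
    have "(\<lambda>h. (\<psi> x (1 + h) - \<psi> x 1) / h) \<midarrow>0\<rightarrow> real N * d x + grad f x \<bullet> (x - a)"
      using \<psi>_deriv[of x 1] by (simp add: DERIV_def d_def)
    moreover have "filterlim (\<lambda>j. - \<epsilon> j) (at 0) sequentially"
      using tendsto_minus[OF eps0] less_imp_neq[OF eps(1)]
      by (auto simp: filterlim_at intro!: always_eventually)
    ultimately have "(\<lambda>j. (\<psi> x (1 + - \<epsilon> j) - \<psi> x 1) / (- \<epsilon> j)) \<longlonglongrightarrow> real N * d x + grad f x \<bullet> (x - a)"
      by (rule filterlim_compose)
    then have "(\<lambda>j. indicator K x * ((\<psi> x (1 + - \<epsilon> j) - \<psi> x 1) / (- \<epsilon> j))) \<longlonglongrightarrow> indicator K x * (real N * d x + grad f x \<bullet> (x - a))"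
      by (rule tendsto_mult_left)
    moreover have eq: "(\<psi> x (1 + - \<epsilon> j) - \<psi> x 1) / (- \<epsilon> j) = (\<psi> x 1 - \<psi> x (1 - \<epsilon> j)) / \<epsilon> j" for j
      by (simp add: diff_divide_distrib)
    ultimately show ?thesis unfolding u_def eq by simp
  qed
  \<comment> \<open>\<open>B\<close> bounds the derivative of \<open>\<psi> x\<close> on
    \<open>{0..1}\<close> and hence all difference quotients; it provides the majorant for dominated
    convergence.\<close>
  have u_bound: "\<bar>u j x\<bar> \<le> indicator K x * B" if "x \<noteq> a" for j x
  proof (cases "x \<in> K")
    case True
    have bd: "norm ((real N * s ^ (N - 1)) * (f (a + s *\<^sub>R (x - a)) - f (\<pi> x)) + (grad f (a + s *\<^sub>R (x - a)) \<bullet> (x - a)) * s ^ N) \<le> B"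
      if s: "s \<in> {0..1}" for s
    proof -
      have z: "a + s *\<^sub>R (x - a) \<in> K" using scale True s by auto
      have "\<bar>(real N * s ^ (N - 1)) * (f (a + s *\<^sub>R (x - a)) - f (\<pi> x))\<bar> \<le> (real N * 1) * (2 * F)"
        unfolding abs_mult using F[OF z] fpi[OF True \<open>x \<noteq> a\<close>] s
        by (intro mult_mono) (auto simp: power_le_one)
      moreover have "\<bar>(grad f (a + s *\<^sub>R (x - a)) \<bullet> (x - a)) * s ^ N\<bar> \<le> M * 1"
        unfolding abs_mult using GR[OF z True] s
        by (intro mult_mono) (auto simp: power_le_one)
      ultimately show ?thesis unfolding B_def real_norm_def by linarith
    qed
    have "norm (\<psi> x 1 - \<psi> x (1 - \<epsilon> j)) \<le> B * norm (1 - (1 - \<epsilon> j))"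
      by (rule field_differentiable_bound[of "{0..1}", OF _ DERIV_subset[OF \<psi>_deriv] bd])
         (use eps[of j] in auto)
    then show ?thesis
      using True eps[of j] by (simp add: u_def divide_le_eq)
  qed (simp add: u_def)
  have intK: "integrable lborel (\<lambda>x. indicator K x * C)" for C :: real
    using emeasure_bounded_finite[OF compact_imp_bounded[OF cK]]
    by (intro integrable_mult_left integrable_real_indicator) auto
  have bdd: "integrable lborel (\<lambda>x. indicator K x * w x)"
    if [measurable]: "w \<in> borel_measurable borel" and "\<And>x. x \<in> K \<Longrightarrow> x \<noteq> a \<Longrightarrow> \<bar>w x\<bar> \<le> C" for w :: "real^'n \<Rightarrow> real" and C
  proof (rule Bochner_Integration.integrable_bound[OF intK[of C]])
    have "AE x in lborel. x \<noteq> a" by (rule AE_lborel_singleton)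
    then show "AE x in lborel. norm (indicator K x * w x) \<le> norm (indicator K x * C)"
      by eventually_elim (use that in \<open>force simp: indicator_def\<close>)
  qed measurable
  have um [measurable]: "u j \<in> borel_measurable lborel" for j
    unfolding u_def \<psi>_def by measurable
  have "(\<lambda>j. integral\<^sup>L lborel (u j)) \<longlonglongrightarrow> (LINT x|lborel. indicator K x * (real N * d x + grad f x \<bullet> (x - a)))"
  proof (rule integral_dominated_convergence[OF _ um intK[of B]])
    have "AE x in lborel. x \<noteq> a" by (rule AE_lborel_singleton)
    then show "AE x in lborel. norm (u j x) \<le> indicator K x * B" for j
      by eventually_elim (use u_bound in auto)
  qed (use u_lim in auto)
  moreover have "(\<lambda>j. integral\<^sup>L lborel (u j)) \<longlonglongrightarrow> 0"
  proof (rule tendsto_rabs_zero_cancel, rule tendsto_sandwich[OF _ _ tendsto_const])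
    show "\<forall>\<^sub>F j in sequentially. 0 \<le> \<bar>integral\<^sup>L lborel (u j)\<bar>" by simp
    show "\<forall>\<^sub>F j in sequentially. \<bar>integral\<^sup>L lborel (u j)\<bar> \<le> M * V * (1 - (1 - \<epsilon> j) ^ N)"
    proof (rule always_eventually, rule allI)
      fix j
      define t where "t = 1 - \<epsilon> j"
      have t: "0 < t" "t < 1" using eps by (auto simp: t_def)
      \<comment> \<open>The indicator of the cone shrunk by \<open>t\<close> towards its
        apex.\<close>
      define Kt where "Kt x = (indicator K (a + (1 / t) *\<^sub>R (x - a)) :: real)" for x
      have [measurable]: "Kt \<in> borel_measurable borel" unfolding Kt_def by measurable
      have Kt_le: "Kt x \<le> indicator K x" for x
        using scale[of "a + (1 / t) *\<^sub>R (x - a)" t] t by (auto simp: Kt_def indicator_def)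
      have Kt_nonneg: "0 \<le> Kt x" for x
        by (simp add: Kt_def)
      have scaled: "t ^ N * (LINT x|lborel. indicator K x * w (a + t *\<^sub>R (x - a))) = (LINT x|lborel. Kt x * w x)"
        if [measurable]: "w \<in> borel_measurable borel" for w :: "real^'n \<Rightarrow> real"
      proof -
        have eq: "a - t *\<^sub>R a + t *\<^sub>R x = a + t *\<^sub>R (x - a)" for x by (simp add: algebra_simps)
        have "(LINT x|lborel. Kt x * w x) = t ^ N * (LINT x|lborel. Kt (a - t *\<^sub>R a + t *\<^sub>R x) * w (a - t *\<^sub>R a + t *\<^sub>R x))"
          using t by (subst lborel_integral_affine[of t _ "a - t *\<^sub>R a"]) (auto simp: N_def)
        then show ?thesis using t unfolding eq by (simp add: Kt_def)
      qed
      have V: "(LINT x|lborel. Kt x) = t ^ N * V"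
        using scaled[of "\<lambda>_. 1"] by (simp add: V_def)
      have "\<pi> (a + t *\<^sub>R (x - a)) = \<pi> x" for x
        using t by (simp add: \<pi>_def)
      then have u_eq: "u j x = (indicator K x * d x - t ^ N * (indicator K x * d (a + t *\<^sub>R (x - a)))) / \<epsilon> j" for x
        by (simp add: u_def \<psi>_def d_def t_def algebra_simps)
      have d_bound: "\<bar>d x\<bar> \<le> 2 * F" if "x \<in> K" "x \<noteq> a" for x
        using F[OF that(1)] fpi[OF that] by (simp add: d_def)
      have int1: "integrable lborel (\<lambda>x. indicator K x * d x)"
        by (rule bdd[OF dm d_bound])
      have int2: "integrable lborel (\<lambda>x. indicator K x * d (a + t *\<^sub>R (x - a)))"
        by (rule bdd[of _ "2 * F"]) (use t in \<open>auto intro!: d_bound scale\<close>)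
      have int3: "integrable lborel (\<lambda>x. Kt x * d x)"
      proof (rule Bochner_Integration.integrable_bound[OF int1])
        show "AE x in lborel. norm (Kt x * d x) \<le> norm (indicator K x * d x)"
          by (rule AE_I2) (simp add: abs_mult mult_right_mono Kt_le Kt_nonneg)
      qed measurable
      have int4: "integrable lborel Kt"
      proof (rule Bochner_Integration.integrable_bound[OF intK[of 1]])
        show "AE x in lborel. norm (Kt x) \<le> norm (indicator K x * 1 :: real)"
          by (rule AE_I2) (simp add: Kt_le Kt_nonneg)
      qed measurable
      have "integral\<^sup>L lborel (u j) = ((LINT x|lborel. indicator K x * d x) - (LINT x|lborel. Kt x * d x)) / \<epsilon> j"
        unfolding u_eq using int1 int2 by (simp add: scaled[OF dm])
      also have "\<dots> = (LINT x|lborel. (indicator K x - Kt x) * d x) / \<epsilon> j"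
        using int1 int3 by (simp add: left_diff_distrib)
      finally have "\<bar>integral\<^sup>L lborel (u j)\<bar> = \<bar>LINT x|lborel. (indicator K x - Kt x) * d x\<bar> / \<epsilon> j"
        using eps[of j] by simp
      \<comment> \<open>Only the shell between the cone and its shrunken copy is left. There
        \<open>d\<close> is at most \<open>M * \<epsilon> j\<close> by \<open>near\<close>, which
        absorbs the division by \<open>\<epsilon> j\<close>; the volume of the shell tends to
        zero.\<close>
      also have "\<dots> \<le> (LINT x|lborel. (indicator K x - Kt x) * (M * \<epsilon> j)) / \<epsilon> j"
      proof (intro divide_right_mono integral_abs_bound_integral)
        show "integrable lborel (\<lambda>x. (indicator K x - Kt x) * d x)"
          using int1 int3 by (simp add: left_diff_distrib)
        show "integrable lborel (\<lambda>x. (indicator K x - Kt x) * (M * \<epsilon> j))"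
          using intK[of 1] int4 by (intro integrable_mult_left) simp
        fix x
        show "\<bar>(indicator K x - Kt x) * d x\<bar> \<le> (indicator K x - Kt x) * (M * \<epsilon> j)"
          using Kt_le[of x] near[of x t] t
          by (auto simp: Kt_def indicator_def d_def t_def split: if_splits)
      qed (use eps[of j] in auto)
      also have "(LINT x|lborel. (indicator K x - Kt x) * (M * \<epsilon> j)) = (LINT x|lborel. indicator K x - Kt x) * (M * \<epsilon> j)"
        by (rule integral_mult_left_zero)
      also have "(LINT x|lborel. indicator K x - Kt x) = V - t ^ N * V"
        using Bochner_Integration.integral_diff[OF intK[of 1] int4] by (simp only: V_def V mult_1_right)
      also have "(V - t ^ N * V) * (M * \<epsilon> j) / \<epsilon> j = M * V * (1 - (1 - \<epsilon> j) ^ N)"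
        using eps[of j] by (simp add: t_def field_simps)
      finally show "\<bar>integral\<^sup>L lborel (u j)\<bar> \<le> M * V * (1 - (1 - \<epsilon> j) ^ N)" .
    qed
    have "(\<lambda>j. M * V * (1 - (1 - \<epsilon> j) ^ N)) \<longlonglongrightarrow> M * V * (1 - (1 - 0) ^ N)"
      by (intro tendsto_intros eps0)
    then show "(\<lambda>j. M * V * (1 - (1 - \<epsilon> j) ^ N)) \<longlonglongrightarrow> 0" by simp
  qed
  ultimately have zero: "(LINT x|lborel. indicator K x * (real N * d x + grad f x \<bullet> (x - a))) = 0"
    using LIMSEQ_unique by blast
  \<comment> \<open>Splits \<open>f\<close> into its values on the base, extended constantly along
    rays, and the remainder \<open>d\<close>, whose contribution vanishes by
    \<open>zero\<close>.\<close>
  have "(LINT x|lborel. indicator K x * (real N * f x + grad f x \<bullet> (x - a)))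
     = (LINT x|lborel. indicator K x * (real N * d x + grad f x \<bullet> (x - a)) + real N * (indicator K x * f (\<pi> x)))"
    by (simp add: d_def algebra_simps)
  also have "\<dots> = real N * (LINT x|lborel. indicator K x * f (\<pi> x))"
  proof (subst Bochner_Integration.integral_add)
    show "integrable lborel (\<lambda>x. indicator K x * (real N * d x + grad f x \<bullet> (x - a)))"
    proof (rule bdd)
      fix x assume x: "x \<in> K" "x \<noteq> a"
      have "\<bar>d x\<bar> \<le> 2 * F"
        using F[OF x(1)] fpi[OF x] by (simp add: d_def)
      then have "\<bar>real N * d x\<bar> \<le> real N * (2 * F)"
        unfolding abs_mult by (intro mult_mono) auto
      then show "\<bar>real N * d x + grad f x \<bullet> (x - a)\<bar> \<le> B"
        using GR[OF x(1) x(1)] unfolding B_def by linarith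
    qed measurable
    show "integrable lborel (\<lambda>x. real N * (indicator K x * f (\<pi> x)))"
      by (intro integrable_mult_right bdd[of _ F] fpi) measurable
  qed (simp add: zero)
  also have "\<dots> = h * (LINT x|face_measure e. f x)" by (rule radial)
  finally show ?thesis by (simp add: N_def)
qed

section \<open>The divergence theorem on a simplex\<close>

definition C1v :: "(real^'n::finite \<Rightarrow> real^'n) \<Rightarrow> bool" where
  "C1v w \<longleftrightarrow> (\<forall>i. C1 (\<lambda>x. w x $ i))"

definition divg :: "(real^'n::finite \<Rightarrow> real^'n) \<Rightarrow> real^'n \<Rightarrow> real" where
  "divg w x = (\<Sum>i\<in>UNIV. grad (\<lambda>x. w x $ i) x $ i)"

lemma C1v_continuous: "C1v w \<Longrightarrow> continuous_on S w"
  unfolding C1v_def by (subst continuous_on_componentwise) (auto simp: Basis_vec_def inner_axis C1_continuous)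

lemma divg_continuous: "C1v w \<Longrightarrow> continuous_on S (divg w)"
  unfolding C1v_def divg_def[abs_def] by (intro continuous_intros C1_grad_continuous) auto

lemma integrable_indicator_compact:
  fixes w :: "'a::euclidean_space \<Rightarrow> real"
  assumes "compact K" "continuous_on K w"
  shows "integrable lborel (\<lambda>x. indicator K x * w x)"
  using borel_integrable_compact[OF assms] by simp

text \<open>Facets are indexed by the opposite vertex: for a vertex \<open>a\<close> of
  \<open>C\<close>, the opposite facet has outward unit normal \<open>\<nu> a\<close> and plane
  offset \<open>c a\<close>, and \<open>h a\<close> is the distance of \<open>a\<close> from that
  plane.\<close>

locale simplex_frame =
  fixes C :: "(real^'n::finite) set" and \<nu> :: "real^'n \<Rightarrow> real^'n" and c h :: "real^'n \<Rightarrow> real"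
  assumes dim: "CARD('n) = 2 \<or> CARD('n) = 3"
    and indep: "\<not> affine_dependent C" and card_C: "card C = Suc CARD('n)"
    and norm_nu: "a \<in> C \<Longrightarrow> norm (\<nu> a) = 1"
    and facet_plane: "a \<in> C \<Longrightarrow> affine hull (C - {a}) = {y. y \<bullet> \<nu> a = c a}"
    and apex: "a \<in> C \<Longrightarrow> a \<bullet> \<nu> a = c a - h a"
    and height: "a \<in> C \<Longrightarrow> h a > 0"
begin

text \<open>The barycentric coordinate of the vertex \<open>a\<close>, written as signed distance
  from the opposite facet plane relative to the height. This makes it visibly affine and ties it to
  the normal.\<close>

definition bary :: "real^'n \<Rightarrow> real^'n \<Rightarrow> real" where
  "bary a x = (c a - x \<bullet> \<nu> a) / h a"

abbreviation K where "K \<equiv> convex hull C"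
abbreviation facet where "facet a \<equiv> convex hull (C - {a})"

lemma finite_C: "finite C"
  using card_C card.infinite by fastforce

lemma bary_vertex: "a \<in> C \<Longrightarrow> b \<in> C \<Longrightarrow> bary a b = (if a = b then 1 else 0)"
  using facet_plane[of a] hull_subset[of "C - {a}" affine] height[of a] apex[of a]
  by (auto simp: bary_def)

text \<open>\<open>bary a\<close> is affine and is a Kronecker delta on the vertices.\<close>

lemma bary_affine_combination:
  assumes "(\<Sum>b\<in>C. w b) = 1" "a \<in> C"
  shows "bary a (\<Sum>b\<in>C. w b *\<^sub>R b) = w a"
proof -
  have "bary a (\<Sum>b\<in>C. w b *\<^sub>R b) = (\<Sum>b\<in>C. w b * bary a b)"
    unfolding bary_def times_divide_eq_right sum_divide_distrib[symmetric] right_diff_distrib sum_subtractf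
    using assms by (simp add: inner_sum_left sum_distrib_right[symmetric])
  also have "\<dots> = (\<Sum>b\<in>C. if b = a then w b else 0)"
    using assms by (intro sum.cong) (auto simp: bary_vertex)
  finally show ?thesis using assms finite_C by simp
qed

text \<open>There is one more vertex than the dimension, so the vertices affinely span the whole
  space; the identities hold for points outside the simplex too.\<close>

lemma bary_representation:
  shows sum_bary: "(\<Sum>a\<in>C. bary a x) = 1" and bary_combination: "(\<Sum>a\<in>C. bary a x *\<^sub>R a) = x"
proof -
  have "x \<in> affine hull C"
    using affine_independent_span_eq[OF indep] card_C by simp
  then obtain w where w: "sum w C = 1" "(\<Sum>b\<in>C. w b *\<^sub>R b) = x"
    by (auto simp: affine_hull_finite finite_C)
  then have "bary a x = w a" if "a \<in> C" for a
    using bary_affine_combination[OF w(1) that] by simp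
  with w show "(\<Sum>a\<in>C. bary a x) = 1" "(\<Sum>a\<in>C. bary a x *\<^sub>R a) = x"
    by simp_all
qed

lemma mem_K: "x \<in> K \<longleftrightarrow> (\<forall>a\<in>C. 0 \<le> bary a x)"
proof
  assume "x \<in> K"
  then obtain w where "\<forall>a\<in>C. 0 \<le> w a" "sum w C = 1" "(\<Sum>b\<in>C. w b *\<^sub>R b) = x"
    by (auto simp: convex_hull_finite[OF finite_C])
  then show "\<forall>a\<in>C. 0 \<le> bary a x"
    using bary_affine_combination by auto
next
  assume "\<forall>a\<in>C. 0 \<le> bary a x"
  then show "x \<in> K"
    using bary_representation[of x] by (auto simp: convex_hull_finite[OF finite_C] intro!: exI[of _ "\<lambda>a. bary a x"])
qed

lemma mem_facet: "a \<in> C \<Longrightarrow> x \<in> facet a \<longleftrightarrow> x \<in> K \<and> bary a x = 0"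
proof
  assume a: "a \<in> C" and x: "x \<in> facet a"
  then have "x \<in> affine hull (C - {a})"
    using convex_hull_subset_affine_hull by blast
  then show "x \<in> K \<and> bary a x = 0"
    using x facet_plane[OF a] hull_mono[of "C - {a}" C convex] by (auto simp: bary_def)
next
  assume a: "a \<in> C" and x: "x \<in> K \<and> bary a x = 0"
  have "(\<Sum>b\<in>C - {a}. bary b x) = 1" "(\<Sum>b\<in>C - {a}. bary b x *\<^sub>R b) = x"
    using bary_representation[of x] x a finite_C by (simp_all add: sum_diff1)
  moreover have "finite (C - {a})" using finite_C by simp
  ultimately show "x \<in> facet a"
    using x mem_K[of x] by (auto simp: convex_hull_finite intro!: exI[of _ "\<lambda>a. bary a x"])
qed

lemma bary_continuous: "continuous_on S (bary a)"
  unfolding bary_def[abs_def] divide_inverse by (intro continuous_intros)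

lemma interior_K: "interior K = {x. \<forall>a\<in>C. 0 < bary a x}"
proof (intro equalityI)
  have "open {x. 0 < bary a x}" for a
    using open_Collect_less[OF continuous_on_const bary_continuous, of 0 a] by simp
  then have "open (\<Inter>a\<in>C. {x. 0 < bary a x})"
    using finite_C by (intro open_INT) auto
  moreover have "(\<Inter>a\<in>C. {x. 0 < bary a x}) = {x. \<forall>a\<in>C. 0 < bary a x}"
    by auto
  ultimately have "open {x. \<forall>a\<in>C. 0 < bary a x}"
    by simp
  then show "{x. \<forall>a\<in>C. 0 < bary a x} \<subseteq> interior K"
    by (intro interior_maximal) (auto simp: mem_K less_imp_le)
  show "interior K \<subseteq> {x. \<forall>a\<in>C. 0 < bary a x}"
  proof (clarify)
    fix x a assume x: "x \<in> interior K" and a: "a \<in> C"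
    then obtain r where r: "r > 0" "ball x r \<subseteq> K"
      by (auto simp: mem_interior)
    \<comment> \<open>A short step along the outward normal stays in the simplex but strictly lowers
      \<open>bary a\<close>, which must therefore have been positive.\<close>
    have "x + (r / 2) *\<^sub>R \<nu> a \<in> ball x r"
      using r norm_nu[OF a] by (simp add: dist_norm)
    then have "0 \<le> bary a (x + (r / 2) *\<^sub>R \<nu> a)"
      using r a mem_K by blast
    moreover have "\<nu> a \<bullet> \<nu> a = 1"
      using norm_nu[OF a] by (simp add: norm_eq_sqrt_inner)
    ultimately show "0 < bary a x"
      using height[OF a] r by (simp add: bary_def inner_add_left zero_le_divide_iff)
  qed
qed

lemma compact_K: "compact K"
  using finite_C by (simp add: finite_imp_compact_convex_hull)

lemma compact_facet: "compact (facet a)"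
  using finite_C by (simp add: finite_imp_compact_convex_hull)

lemma affine_hull_facet: "a \<in> C \<Longrightarrow> affine hull (facet a) = {y. y \<bullet> \<nu> a = c a}"
  using facet_plane by simp

text \<open>The shape in which \<open>cone_divergence\<close> takes its cone; every vertex can play
  the apex.\<close>

lemma K_cone:
  assumes a: "a \<in> C"
  shows "K = {a + r *\<^sub>R (y - a) | r y. r \<in> {0..1} \<and> y \<in> facet a}"
proof -
  have "card (C - {a}) \<noteq> 0"
    using a card_C finite_C by simp
  then have "C - {a} \<noteq> {}" by force
  from convex_hull_insert[OF this, of a] have "K = {x. \<exists>u\<ge>0. \<exists>v\<ge>0. \<exists>b. b \<in> facet a \<and> u + v = 1 \<and> x = u *\<^sub>R a + v *\<^sub>R b}"
    using a by (auto simp: insert_absorb)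
  also have "\<dots> = {a + r *\<^sub>R (y - a) | r y. r \<in> {0..1} \<and> y \<in> facet a}"
  proof (intro Collect_cong iffI)
    fix x assume "\<exists>u\<ge>0. \<exists>v\<ge>0. \<exists>b. b \<in> facet a \<and> u + v = 1 \<and> x = u *\<^sub>R a + v *\<^sub>R b"
    then obtain u v b where uvb: "0 \<le> u" "0 \<le> v" "b \<in> facet a" "u + v = 1" "x = u *\<^sub>R a + v *\<^sub>R b"
      by blast
    then have "u = 1 - v" by simp
    with uvb have "x = a + v *\<^sub>R (b - a)" "v \<in> {0..1}" "b \<in> facet a"
      by (auto simp: algebra_simps)
    then show "\<exists>r y. x = a + r *\<^sub>R (y - a) \<and> r \<in> {0..1} \<and> y \<in> facet a" by blast
  next
    fix x assume "\<exists>r y. x = a + r *\<^sub>R (y - a) \<and> r \<in> {0..1} \<and> y \<in> facet a"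
    then obtain r y where "x = a + r *\<^sub>R (y - a)" "r \<in> {0..1}" "y \<in> facet a" by blast
    then have "0 \<le> 1 - r" "0 \<le> r" "(1 - r) + r = 1" "x = (1 - r) *\<^sub>R a + r *\<^sub>R y"
      by (auto simp: algebra_simps)
    with \<open>y \<in> facet a\<close> show "\<exists>u\<ge>0. \<exists>v\<ge>0. \<exists>b. b \<in> facet a \<and> u + v = 1 \<and> x = u *\<^sub>R a + v *\<^sub>R b"
      by blast
  qed
  finally show ?thesis .
qed

text \<open>Barycentric coordinates add up to 1 at the origin and at \<open>d\<close>; in the
  difference of the two identities only the linear parts survive.\<close>

lemma sum_normals: "(\<Sum>a\<in>C. (d \<bullet> \<nu> a) / h a) = 0"
proof -
  have "(\<Sum>a\<in>C. bary a 0 - bary a d) = 0"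
    by (simp add: sum_subtractf sum_bary)
  then show ?thesis
    by (simp add: bary_def diff_divide_distrib)
qed

text \<open>The same subtraction in the representation of a point by the vertices. With
  \<open>sum_normals\<close>, it writes \<open>d\<close> as the sum of the vectors
  \<open>x - a\<close> weighted by \<open>(d \<bullet> \<nu> a) / h a\<close>, for any
  \<open>x\<close>.\<close>

lemma sum_normals_vertex: "(\<Sum>a\<in>C. ((d \<bullet> \<nu> a) / h a) *\<^sub>R a) = - d"
proof -
  have "(\<Sum>a\<in>C. (bary a 0 - bary a d) *\<^sub>R a) = - d"
    unfolding scaleR_diff_left sum_subtractf bary_combination by simp
  then show ?thesis
    by (simp add: bary_def diff_divide_distrib)
qed

theorem divergence_theorem:
  assumes w: "C1v w"
  shows "(LINT x|lborel. indicator K x * divg w x) = (\<Sum>a\<in>C. LINT x|face_measure (facet a). w x \<bullet> \<nu> a)"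
proof -
  define f where "f a x = (\<Sum>i\<in>UNIV. (\<nu> a $ i / h a) * w x $ i)" for a x
  have f_eq: "f a x = (w x \<bullet> \<nu> a) / h a" for a x
    unfolding f_def inner_vec_def sum_divide_distrib by (simp add: mult.commute)
  have wi: "C1 (\<lambda>x. w x $ i)" for i using w by (simp add: C1v_def)
  have f_C1: "C1 (f a)" for a
    unfolding f_def by (intro C1_sum C1_mult wi) auto
  have grad_f: "grad (f a) x = (\<Sum>i\<in>UNIV. (\<nu> a $ i / h a) *\<^sub>R grad (\<lambda>x. w x $ i) x)" for a x
  proof -
    have "grad (\<lambda>x. k * w x $ i) x = k *\<^sub>R grad (\<lambda>x. w x $ i) x" for k i
      by (simp add: grad_mult wi)
    then show ?thesis
      unfolding f_def by (subst grad_sum[OF C1_mult[OF C1_const wi]]) (simp only:)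
  qed
  \<comment> \<open>The divergence of the radial field \<open>x - a\<close> multiplied by
    \<open>f a x\<close>, in the form of \<open>cone_divergence\<close>. Its height factor cancels
    the division by \<open>h a\<close> in \<open>f a\<close>.\<close>
  define g where "g a x = real CARD('n) * f a x + grad (f a) x \<bullet> (x - a)" for a x
  have g_int: "integrable lborel (\<lambda>x. indicator K x * g a x)" for a
    unfolding g_def
    by (intro integrable_indicator_compact compact_K continuous_intros C1_continuous C1_grad_continuous f_C1)
  have cone: "(LINT x|lborel. indicator K x * g a x) = (LINT x|face_measure (facet a). w x \<bullet> \<nu> a)"
    if a: "a \<in> C" for a
  proof -
    have "(LINT x|lborel. indicator K x * g a x) = h a * (LINT x|face_measure (facet a). f a x)"
      unfolding g_def
      by (rule cone_divergence[OF dim norm_nu[OF a] compact_facet affine_hull_facet[OF a] apex[OF a] height[OF a] f_C1, folded K_cone[OF a]])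
    then show ?thesis
      using height[OF a] by (simp add: f_eq)
  qed
  have "(\<Sum>a\<in>C. g a x) = divg w x" for x
  proof -
    have normal: "axis i 1 \<bullet> \<nu> a = \<nu> a $ i" for i a
      by (metis cart_eq_inner_axis inner_commute)
    have frame: "(\<Sum>a\<in>C. (\<nu> a $ i / h a) *\<^sub>R (x - a)) = axis i 1" for i
      using sum_normals[of "axis i 1"] sum_normals_vertex[of "axis i 1"]
      unfolding scaleR_diff_right sum_subtractf scaleR_left.sum[symmetric] normal by simp
    \<comment> \<open>The undifferentiated terms cancel, since the normals weighted by inverse
      heights add up to zero.\<close>
    have "(\<Sum>a\<in>C. f a x) = 0"
      unfolding f_eq by (rule sum_normals)
    then have "(\<Sum>a\<in>C. g a x) = (\<Sum>a\<in>C. grad (f a) x \<bullet> (x - a))"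
      by (simp add: g_def sum.distrib sum_distrib_left[symmetric])
    also have "\<dots> = (\<Sum>i\<in>UNIV. grad (\<lambda>x. w x $ i) x \<bullet> (\<Sum>a\<in>C. (\<nu> a $ i / h a) *\<^sub>R (x - a)))"
      unfolding grad_f inner_sum_left inner_sum_right by (subst sum.swap) simp
    also have "\<dots> = (\<Sum>i\<in>UNIV. grad (\<lambda>x. w x $ i) x \<bullet> axis i 1)"
      unfolding frame ..
    finally show ?thesis
      by (simp add: divg_def cart_eq_inner_axis)
  qed
  then have "(LINT x|lborel. indicator K x * divg w x) = (LINT x|lborel. (\<Sum>a\<in>C. indicator K x * g a x))"
    by (simp add: sum_distrib_left[symmetric])
  also have "\<dots> = (\<Sum>a\<in>C. LINT x|lborel. indicator K x * g a x)"
    by (rule Bochner_Integration.integral_sum) (rule g_int)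
  finally show ?thesis by (simp add: cone)
qed

lemma C1v_scale: "C1 \<phi> \<Longrightarrow> C1v w \<Longrightarrow> C1v (\<lambda>x. \<phi> x *\<^sub>R w x)"
  unfolding C1v_def by (simp add: C1_mult)

lemma divg_scale: "C1 \<phi> \<Longrightarrow> C1v w \<Longrightarrow> divg (\<lambda>x. \<phi> x *\<^sub>R w x) x = w x \<bullet> grad \<phi> x + \<phi> x * divg w x"
  unfolding C1v_def divg_def
  by (simp add: grad_mult sum.distrib sum_distrib_left inner_vec_def add.commute)

corollary Green_formula:
  assumes "C1 \<phi>" "C1v w"
  shows "(LINT x|lborel. indicator K x * (w x \<bullet> grad \<phi> x + \<phi> x * divg w x))
    = (\<Sum>a\<in>C. LINT x|face_measure (facet a). \<phi> x * (w x \<bullet> \<nu> a))"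
  using divergence_theorem[OF C1v_scale[OF assms]] by (simp add: divg_scale[OF assms])

end

lemma simplex_frame_exists:
  fixes C :: "(real^'n::finite) set"
  assumes dim: "CARD('n) = 2 \<or> CARD('n) = 3"
    and C: "\<not> affine_dependent C" "card C = Suc CARD('n)"
  shows "\<exists>\<nu> c h. simplex_frame C \<nu> c h"
proof -
  have "\<exists>n c h. norm n = 1 \<and> affine hull (C - {a}) = {y. y \<bullet> n = c} \<and> a \<bullet> n = c - h \<and> h > 0"
    if a: "a \<in> C" for a
  proof -
    have "finite C" using C(2) card.infinite by fastforce
    have "\<not> affine_dependent (C - {a})"
      using C(1) affine_independent_Diff by blast
    from aff_dim_affine_independent[OF this] have "aff_dim (C - {a}) = int (DIM(real^'n)) - 1"
      using a C(2) \<open>finite C\<close> by simp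
    then obtain v b where vb: "v \<noteq> 0" "affine hull (C - {a}) = {x. v \<bullet> x = b}"
      using aff_dim_eq_hyperplane[of "C - {a}"] by auto
    have "a \<notin> affine hull (C - {a})"
      using C(1) a unfolding affine_dependent_def by blast
    then have ne: "v \<bullet> a \<noteq> b" using vb by auto
    \<comment> \<open>The sign turns the normal away from \<open>a\<close>, so that \<open>a\<close>
      lies strictly below the facet plane.\<close>
    define \<sigma> where "\<sigma> = (if v \<bullet> a < b then 1 else - 1 :: real)"
    define n where "n = (\<sigma> / norm v) *\<^sub>R v"
    define c where "c = (\<sigma> / norm v) * b"
    have "norm n = 1" using vb by (simp add: n_def \<sigma>_def)
    moreover have "affine hull (C - {a}) = {y. y \<bullet> n = c}"
      using vb by (auto simp: n_def c_def \<sigma>_def inner_commute)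
    moreover have "c - a \<bullet> n > 0"
    proof -
      have "c - a \<bullet> n = \<sigma> * (b - v \<bullet> a) / norm v"
        by (simp add: c_def n_def inner_commute right_diff_distrib diff_divide_distrib)
      also have "\<dots> > 0" using vb ne by (auto simp: \<sigma>_def)
      finally show ?thesis .
    qed
    ultimately show ?thesis
      by (intro exI[of _ n] exI[of _ c] exI[of _ "c - a \<bullet> n"]) simp
  qed
  then obtain \<nu> c h where "\<forall>a\<in>C. norm (\<nu> a) = 1 \<and> affine hull (C - {a}) = {y. y \<bullet> \<nu> a = c a} \<and> a \<bullet> \<nu> a = c a - h a \<and> h a > 0"
    by metis
  then have "simplex_frame C \<nu> c h"
    using dim C by unfold_locales auto
  then show ?thesis by blast
qed

section \<open>Integration over the elements and cut-off functions\<close>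

lemma lebesgue_on_cong_negligible:
  fixes f g :: "'a::euclidean_space \<Rightarrow> real"
  assumes S: "S \<in> sets lebesgue" and g: "integrable (lebesgue_on S) g"
    and N: "negligible N" and fg: "\<And>x. x \<in> S - N \<Longrightarrow> f x = g x"
  shows "integrable (lebesgue_on S) f" "(LINT x|lebesgue_on S. f x) = (LINT x|lebesgue_on S. g x)"
proof -
  have "g absolutely_integrable_on S"
    using g S by (simp add: set_integrable_def integrable_restrict_space)
  then have f: "f absolutely_integrable_on S"
    using N fg by (rule absolutely_integrable_spike)
  then show fi: "integrable (lebesgue_on S) f"
    using S by (simp add: set_integrable_def integrable_restrict_space)
  show "(LINT x|lebesgue_on S. f x) = (LINT x|lebesgue_on S. g x)"
    using integral_spike[OF N fg, of S]
    by (simp add: lebesgue_integral_eq_integral[OF fi S] lebesgue_integral_eq_integral[OF g S])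
qed

lemma lebesgue_on_lborel:
  fixes f :: "'a::euclidean_space \<Rightarrow> real"
  assumes S: "S \<in> sets borel" and f: "f \<in> borel_measurable borel"
  shows "integrable (lebesgue_on S) f \<longleftrightarrow> integrable lborel (\<lambda>x. indicator S x * f x)"
    "(LINT x|lebesgue_on S. f x) = (LINT x|lborel. indicator S x * f x)"
  using assms by (simp_all add: integrable_restrict_space integral_restrict_space integrable_completion integral_completion)

lemma lebesgue_on_support:
  fixes f :: "'a::euclidean_space \<Rightarrow> real"
  assumes "A \<in> sets lebesgue" "B \<in> sets lebesgue" "\<And>x. f x \<noteq> 0 \<Longrightarrow> x \<in> A \<longleftrightarrow> x \<in> B"
  shows "(LINT x|lebesgue_on A. f x) = (LINT x|lebesgue_on B. f x)"
proof -
  have "(\<lambda>x. indicator A x *\<^sub>R f x) = (\<lambda>x. indicator B x *\<^sub>R f x)"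
    using assms(3) by (auto simp: fun_eq_iff indicator_def)
  then show ?thesis
    using assms(1,2) by (simp add: integral_restrict_space)
qed

lemma integrable_mult_continuous:
  fixes f g :: "'a::euclidean_space \<Rightarrow> real"
  assumes K: "compact K" and f: "integrable (lebesgue_on K) f" and g: "continuous_on K g"
  shows "integrable (lebesgue_on K) (\<lambda>x. f x * g x)"
proof -
  obtain B where B: "\<And>x. x \<in> K \<Longrightarrow> \<bar>g x\<bar> \<le> B"
    using compact_imp_bounded[OF compact_continuous_image[OF g K]] by (auto simp: bounded_iff)
  have "g \<in> borel_measurable (lebesgue_on K)"
    using g K by (intro continuous_imp_measurable_on_sets_lebesgue) (auto simp: compact_imp_closed)
  then show ?thesis
  proof (intro Bochner_Integration.integrable_bound[OF integrable_mult_right[OF f, of B]] borel_measurable_times)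
    show "AE x in lebesgue_on K. norm (f x * g x) \<le> norm (B * f x)"
    proof (rule AE_I2)
      fix x assume "x \<in> space (lebesgue_on K)"
      then have "\<bar>g x\<bar> \<le> \<bar>B\<bar>" using B[of x] by (simp add: space_restrict_space)
      then show "norm (f x * g x) \<le> norm (B * f x)"
        by (simp add: abs_mult mult.commute[of "\<bar>f x\<bar>"] mult_right_mono)
    qed
  qed (use f in auto)
qed

lemma L2_integrable:
  fixes g :: "'a::euclidean_space \<Rightarrow> real"
  assumes "L2 \<Omega> g" "\<Omega> \<in> lmeasurable"
  shows "integrable (lebesgue_on \<Omega>) g"
proof (rule Bochner_Integration.integrable_bound)
  have "integrable (lebesgue_on \<Omega>) (\<lambda>x. 1 :: real)"
    using assms(2) by (simp add: integrable_restrict_space lmeasurable_iff_integrable fmeasurableD)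
  then show "integrable (lebesgue_on \<Omega>) (\<lambda>x. 1 + (norm (g x))\<^sup>2)"
    using assms(1) unfolding L2_def by simp
  show "AE x in lebesgue_on \<Omega>. norm (g x) \<le> norm (1 + (norm (g x))\<^sup>2)"
  proof (rule AE_I2)
    fix x
    \<comment> \<open>Completing the square bounds the absolute value by the square plus 1/4, which
      is integrable on a set of finite measure.\<close>
    have "0 \<le> (\<bar>g x\<bar> - 1/2)\<^sup>2" by simp
    then show "norm (g x) \<le> norm (1 + (norm (g x))\<^sup>2)"
      by (simp add: power2_eq_square algebra_simps)
  qed
qed (use assms in \<open>auto simp: L2_def\<close>)

text \<open>Squaring removes the kink of the positive part. The cut-off and bump functions below are
  built from this function.\<close>

lemma DERIV_pos_part_square: "((\<lambda>t::real. (max 0 t)\<^sup>2) has_real_derivative 2 * max 0 t) (at t)"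
proof -
  consider "t > 0" | "t < 0" | "t = 0" by linarith
  then show ?thesis
  proof cases
    case 1
    have "((\<lambda>t::real. t\<^sup>2) has_real_derivative 2 * t) (at t)"
      by (auto intro!: derivative_eq_intros)
    then show ?thesis
      using 1 by (subst DERIV_cong_ev[OF refl _ refl, of _ "\<lambda>t. t\<^sup>2"])
        (auto intro!: eventually_mono[OF eventually_nhds_in_open[of "{0<..}" t]])
  next
    case 2
    then show ?thesis
      by (subst DERIV_cong_ev[OF refl _ refl, of _ "\<lambda>t. 0"])
        (auto intro!: eventually_mono[OF eventually_nhds_in_open[of "{..<0}" t]])
  next
    case 3
    have "(\<lambda>h. max 0 h) \<midarrow>0\<rightarrow> max 0 (0::real)"
      by (intro tendsto_intros)
    moreover have "((max 0 (0 + h))\<^sup>2 - (max 0 0)\<^sup>2) / h = max 0 h" for h :: real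
      by (auto simp: max_def power2_eq_square)
    ultimately show ?thesis
      using 3 by (simp add: DERIV_def)
  qed
qed

lemma mem_frontierI: "x \<in> S \<Longrightarrow> x \<notin> interior S \<Longrightarrow> x \<in> frontier S"
  using closure_subset[of S] by (simp add: frontier_def subset_iff)

lemma C1_pos_part_square: "C1 f \<Longrightarrow> C1 (\<lambda>x. (max 0 (f x))\<^sup>2)"
  by (rule C1_compose[OF _ DERIV_pos_part_square]) (assumption, intro continuous_intros)

text \<open>Caps a function below 1 while keeping its zeros and its differentiability.\<close>

lemma C1_squash:
  assumes "C1 f"
  shows "C1 (\<lambda>x. (f x)\<^sup>2 / (1 + (f x)\<^sup>2))"
proof -
  have pos: "1 + t\<^sup>2 \<noteq> 0" for t :: real
    by (metis add_pos_nonneg less_irrefl zero_le_power2 zero_less_one)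
  have "((\<lambda>t::real. t\<^sup>2 / (1 + t\<^sup>2)) has_real_derivative (2 * t) / (1 + t\<^sup>2)\<^sup>2) (at t)" for t
    using pos[of t] by (auto intro!: derivative_eq_intros simp: power2_eq_square field_simps)
  then show ?thesis
    by (rule C1_compose[OF assms]) (intro continuous_intros, use pos in auto)
qed

lemma grad_zero_open:
  assumes f: "C1 f" and A: "open A" "x \<in> A" "\<And>y. y \<in> A \<Longrightarrow> f y = 0"
  shows "grad f x = 0"
proof -
  have "((\<lambda>y. 0) has_derivative (\<lambda>v. v \<bullet> grad f x)) (at x)"
    by (rule has_derivative_transform_within_open[OF C1_has_derivative[OF f] A])
  then have "(\<lambda>v. v \<bullet> grad f x) = (\<lambda>v. 0)"
    using has_derivative_const by (rule has_derivative_unique)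
  then show ?thesis
    by (metis inner_eq_zero_iff)
qed

lemma face_integral_zero:
  fixes f :: "real^'n::finite \<Rightarrow> real"
  assumes n: "norm n = 1" and e: "compact e" "affine hull e = {y. y \<bullet> n = c}" and f: "\<And>x. x \<in> e \<Longrightarrow> f x = 0"
  shows "(LINT x|face_measure e. f x) = (0::real)"
  using face_integral(2)[OF n e continuous_on_const f] by simp

context simplex_frame
begin

lemma C1_bary [simp]: "C1 (bary a)"
proof -
  have "bary a = (\<lambda>x. (1 / h a) * (c a - x \<bullet> \<nu> a))"
    by (simp add: bary_def fun_eq_iff)
  then show ?thesis
    by (simp only:) (intro C1_mult C1_diff C1_const C1_inner)
qed

text \<open>Makes any \<open>C1\<close> function on one element the limit of test functions that are
  admissible in \<open>has_weak_div\<close>.\<close>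

lemma cutoff_exists:
  obtains \<kappa> :: "nat \<Rightarrow> real^'n \<Rightarrow> real" and S :: "nat \<Rightarrow> (real^'n) set"
  where "\<And>j. C1 (\<kappa> j)" "\<And>j x. 0 \<le> \<kappa> j x \<and> \<kappa> j x \<le> 1"
    "\<And>j. compact (S j) \<and> S j \<subseteq> interior K" "\<And>j x. x \<notin> S j \<Longrightarrow> \<kappa> j x = 0"
    "\<And>x. x \<in> interior K \<Longrightarrow> (\<lambda>j. \<kappa> j x) \<longlonglongrightarrow> 1"
proof
  \<comment> \<open>Nonzero only in the interior, where all barycentric coordinates are
    positive.\<close>
  define \<theta> where "\<theta> x = (\<Prod>a\<in>C. (max 0 (bary a x))\<^sup>2)" for x
  \<comment> \<open>Subtracting 1 confines the support to the compact set where
    \<open>real j * \<theta> x\<close> is at least 1. In \<open>\<kappa>\<close> the inner square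
    makes \<open>m\<close> differentiable and the outer one belongs to
    \<open>C1_squash\<close>.\<close>
  define m where "m j x = max 0 (real j * \<theta> x - 1)" for j x
  define \<kappa> where "\<kappa> j x = (((m j x)\<^sup>2)\<^sup>2) / (1 + ((m j x)\<^sup>2)\<^sup>2)" for j x
  define S where "S j = {x. 1 \<le> real j * \<theta> x}" for j
  have C1_theta: "C1 \<theta>"
    unfolding \<theta>_def[abs_def] by (intro C1_prod C1_pos_part_square C1_bary)
  then show "C1 (\<kappa> j)" for j
    unfolding \<kappa>_def[abs_def] m_def by (intro C1_squash C1_pos_part_square C1_diff C1_mult C1_const)
  show "0 \<le> \<kappa> j x \<and> \<kappa> j x \<le> 1" for j x
    by (simp add: \<kappa>_def divide_le_eq_1 add_pos_nonneg)
  have theta_pos: "x \<in> interior K" if "\<theta> x \<noteq> 0" for x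
    using that finite_C unfolding \<theta>_def interior_K by (auto simp: not_le)
  show "compact (S j) \<and> S j \<subseteq> interior K" for j
  proof
    show sub: "S j \<subseteq> interior K"
      unfolding S_def using theta_pos by force
    have "closed (S j)"
      unfolding S_def by (intro closed_Collect_le continuous_intros C1_continuous C1_theta)
    moreover have "bounded (S j)"
      using sub compact_imp_bounded[OF compact_K] interior_subset bounded_subset by blast
    ultimately show "compact (S j)" by (simp add: compact_eq_bounded_closed)
  qed
  show "\<kappa> j x = 0" if "x \<notin> S j" for j x
    using that by (simp add: S_def \<kappa>_def m_def)
  show "(\<lambda>j. \<kappa> j x) \<longlonglongrightarrow> 1" if x: "x \<in> interior K" for x
  proof -
    have pos: "\<theta> x > 0"
      using x unfolding \<theta>_def interior_K by (intro prod_pos) auto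
    have "filterlim (\<lambda>j. \<theta> x * real j) at_top sequentially"
      by (rule filterlim_tendsto_pos_mult_at_top[OF tendsto_const pos filterlim_real_sequentially])
    then have "filterlim (\<lambda>j. -1 + \<theta> x * real j) at_top sequentially"
      by (rule filterlim_tendsto_add_at_top[OF tendsto_const])
    then have "filterlim (\<lambda>j. m j x) at_top sequentially"
      by (rule filterlim_at_top_mono) (auto simp: m_def mult.commute)
    then have "filterlim (\<lambda>j. ((m j x)\<^sup>2)\<^sup>2) at_top sequentially"
      by (intro filterlim_pow_at_top) auto
    then have "filterlim (\<lambda>j. 1 + ((m j x)\<^sup>2)\<^sup>2) at_top sequentially"
      by (rule filterlim_tendsto_add_at_top[OF tendsto_const])
    then have "(\<lambda>j. inverse (1 + ((m j x)\<^sup>2)\<^sup>2)) \<longlonglongrightarrow> 0"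
      by (rule tendsto_inverse_0_at_top)
    then have "(\<lambda>j. 1 - inverse (1 + ((m j x)\<^sup>2)\<^sup>2)) \<longlonglongrightarrow> 1 - 0"
      by (intro tendsto_diff tendsto_const)
    moreover have "1 - inverse (1 + t\<^sup>2) = t\<^sup>2 / (1 + t\<^sup>2)" for t :: real
    proof -
      have "1 + t\<^sup>2 > 0" by (simp add: add_pos_nonneg)
      then show ?thesis by (simp add: field_simps)
    qed
    ultimately show ?thesis by (simp only: \<kappa>_def diff_zero)
  qed
qed

end

section \<open>Elements of the mesh and integrals over them\<close>

locale mesh =
  fixes \<Omega> :: "(real^'n::finite) set" and \<T> :: "(real^'n) set set"
  assumes dim: "CARD('n) = 2 \<or> CARD('n) = 3"
    and open_Omega: "open \<Omega>" and bounded_Omega: "bounded \<Omega>"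
    and simplicial: "simplicial_mesh \<Omega> \<T>"
begin

lemma finite_T: "finite \<T>"
  using simplicial by (simp add: simplicial_mesh_def triangulation_def)

lemma closure_Omega: "closure \<Omega> = \<Union>\<T>"
  using simplicial by (simp add: simplicial_mesh_def)

lemma interior_subset_Omega: "K \<in> \<T> \<Longrightarrow> interior K \<subseteq> \<Omega>"
  using simplicial by (simp add: simplicial_mesh_def)

lemma simplex_obtain:
  assumes "K \<in> \<T>"
  obtains C \<nu> c h where "simplex_frame C \<nu> c h" "K = convex hull C"
proof -
  have "int CARD('n) simplex K"
    using assms simplicial by (simp add: simplicial_mesh_def)
  then obtain C where C: "\<not> affine_dependent C" "int (card C) = int CARD('n) + 1" "K = convex hull C"
    unfolding simplex_def by blast
  from C(2) have "card C = Suc CARD('n)" by linarith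
  from simplex_frame_exists[OF dim C(1) this] C(3) that show ?thesis by blast
qed

lemma compact_element: "K \<in> \<T> \<Longrightarrow> compact K"
  by (rule simplex_obtain) (auto simp: simplex_frame.compact_K)

lemma convex_element: "K \<in> \<T> \<Longrightarrow> convex K"
  by (rule simplex_obtain) auto

lemma aff_dim_element: "K \<in> \<T> \<Longrightarrow> aff_dim K = int CARD('n)"
  using simplicial by (simp add: simplicial_mesh_def aff_dim_simplex)

lemma interior_element_nonempty: "K \<in> \<T> \<Longrightarrow> interior K \<noteq> {}"
  using aff_dim_element[of K] convex_element[of K]
  by (auto simp: interior_rel_interior_gen rel_interior_eq_empty)

text \<open>If the interiors met, the common face would have full dimension; proper faces have
  smaller dimension, so both elements would equal their intersection.\<close>

lemma interior_disjoint:
  assumes "K \<in> \<T>" "K' \<in> \<T>" "K \<noteq> K'"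
  shows "interior K \<inter> interior K' = {}"
proof (rule ccontr)
  assume ne: "interior K \<inter> interior K' \<noteq> {}"
  have faces: "(K \<inter> K') face_of K" "(K' \<inter> K) face_of K'"
    using assms simplicial by (auto simp: simplicial_mesh_def triangulation_def)
  have "interior (K \<inter> K') \<noteq> {}"
    using ne by simp
  then have full: "aff_dim (K \<inter> K') = int CARD('n)"
    using aff_dim_nonempty_interior[of "K \<inter> K'"] by simp
  have "K \<inter> K' = K" "K' \<inter> K = K'"
    using face_of_aff_dim_lt[OF convex_element faces(1)] face_of_aff_dim_lt[OF convex_element faces(2)]
      full aff_dim_element assms by (auto simp: Int_commute)
  then show False using assms(3) by auto
qed

lemma negligible_frontier: "K \<in> \<T> \<Longrightarrow> negligible (frontier K)"
  by (simp add: convex_element negligible_convex_frontier)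

lemma Omega_lmeasurable: "\<Omega> \<in> lmeasurable"
  using open_Omega bounded_Omega by (simp add: lmeasurable_open)

lemma element_borel: "K \<in> \<T> \<Longrightarrow> K \<in> sets borel"
  by (simp add: borel_compact compact_element)

text \<open>Distinct elements overlap in null sets, and the union of the elements exceeds
  \<open>\<Omega>\<close> only within their boundaries.\<close>

lemma Omega_integral_split:
  fixes f :: "real^'n \<Rightarrow> real"
  assumes f: "\<And>K. K \<in> \<T> \<Longrightarrow> integrable (lebesgue_on K) f"
  shows "integrable (lebesgue_on \<Omega>) f" "(LINT x|lebesgue_on \<Omega>. f x) = (\<Sum>K\<in>\<T>. LINT x|lebesgue_on K. f x)"
proof -
  have Kleb: "K \<in> sets lebesgue" if "K \<in> \<T>" for K
    using element_borel[OF that] by simp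
  have abs: "f absolutely_integrable_on K" if "K \<in> \<T>" for K
    using f[OF that] Kleb[OF that] by (simp add: set_integrable_def integrable_restrict_space)
  have Union_abs: "f absolutely_integrable_on (\<Union>K\<in>\<T>. K)"
    by (rule set_integrable_UN[OF finite_T abs Kleb])
  have "(f has_integral (\<Sum>K\<in>\<T>. integral K f)) (\<Union>\<T>)"
  proof (rule has_integral_Union[OF finite_T])
    show "(f has_integral integral K f) K" if "K \<in> \<T>" for K
      using abs[OF that] by (simp add: absolutely_integrable_on_def integrable_integral)
    show "pairwise (\<lambda>K K'. negligible (K \<inter> K')) \<T>"
    proof (rule pairwiseI)
      fix K K' assume *: "K \<in> \<T>" "K' \<in> \<T>" "K \<noteq> K'"
      have "K \<inter> K' \<subseteq> frontier K \<union> frontier K'"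
        using interior_disjoint[OF *] by (blast intro: mem_frontierI)
      moreover have "negligible (frontier K \<union> frontier K')"
        using negligible_frontier * by (simp add: negligible_Un)
      ultimately show "negligible (K \<inter> K')"
        by (rule negligible_subset[rotated])
    qed
  qed
  then have int_Union: "integral (\<Union>\<T>) f = (\<Sum>K\<in>\<T>. integral K f)"
    by (rule integral_unique)
  have N: "negligible (\<Union>\<T> - \<Omega>)"
  proof (rule negligible_subset)
    show "negligible (\<Union>K\<in>\<T>. frontier K)"
      using finite_T negligible_frontier by (intro negligible_Union) auto
    show "\<Union>\<T> - \<Omega> \<subseteq> (\<Union>K\<in>\<T>. frontier K)"
      using interior_subset_Omega by (blast intro: mem_frontierI)
  qed
  have "\<Omega> \<subseteq> \<Union>\<T>"
    using closure_Omega closure_subset by blast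
  then have "{x \<in> \<Omega> - \<Union>\<T>. f x \<noteq> 0} = {}" by blast
  then have neg2: "negligible {x \<in> \<Omega> - \<Union>\<T>. f x \<noteq> 0}" by (simp only: negligible_empty)
  have neg1: "negligible {x \<in> \<Union>\<T> - \<Omega>. f x \<noteq> 0}"
    by (rule negligible_subset[OF N]) blast
  note neg = neg1 neg2
  have "f absolutely_integrable_on \<Omega>"
    using absolutely_integrable_spike_set[OF _ neg] Union_abs by simp
  then show fi: "integrable (lebesgue_on \<Omega>) f"
    using Omega_lmeasurable by (simp add: set_integrable_def integrable_restrict_space fmeasurableD)
  have "(LINT x|lebesgue_on \<Omega>. f x) = integral \<Omega> f"
    using Omega_lmeasurable by (intro lebesgue_integral_eq_integral fi) auto
  also have "\<dots> = (\<Sum>K\<in>\<T>. integral K f)"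
    using integral_spike_set[OF neg] int_Union by simp
  also have "\<dots> = (\<Sum>K\<in>\<T>. LINT x|lebesgue_on K. f x)"
    by (intro sum.cong refl lebesgue_integral_eq_integral[symmetric] f Kleb)
  finally show "(LINT x|lebesgue_on \<Omega>. f x) = (\<Sum>K\<in>\<T>. LINT x|lebesgue_on K. f x)" .
qed

lemma integrable_element:
  fixes f :: "real^'n \<Rightarrow> real"
  assumes f: "integrable (lebesgue_on \<Omega>) f" and K: "K \<in> \<T>"
  shows "integrable (lebesgue_on K) f"
proof -
  have "f absolutely_integrable_on \<Omega>"
    using f Omega_lmeasurable by (simp add: set_integrable_def integrable_restrict_space fmeasurableD)
  then have "f absolutely_integrable_on (interior K)"
    by (rule set_integrable_subset) (use interior_subset_Omega[OF K] in auto)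
  then have "f absolutely_integrable_on K"
  proof (rule absolutely_integrable_spike_set)
    have "K - interior K \<subseteq> frontier K"
      by (blast intro: mem_frontierI)
    then show "negligible {x \<in> K - interior K. f x \<noteq> 0}"
      by (intro negligible_subset[OF negligible_frontier[OF K]]) auto
    have "{x \<in> interior K - K. f x \<noteq> 0} = {}"
      using interior_subset[of K] by blast
    then show "negligible {x \<in> interior K - K. f x \<noteq> 0}" by (simp only: negligible_empty)
  qed
  then show ?thesis
    using element_borel[OF K] by (simp add: set_integrable_def integrable_restrict_space)
qed

text \<open>Finite element fields are prescribed only in the interior of each element; the boundary
  of a convex set is null.\<close>

lemma element_integral_cong:
  fixes f g :: "real^'n \<Rightarrow> real"
  assumes K: "K \<in> \<T>" and g: "integrable (lebesgue_on K) g" and fg: "\<And>x. x \<in> interior K \<Longrightarrow> f x = g x"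
  shows "integrable (lebesgue_on K) f" "(LINT x|lebesgue_on K. f x) = (LINT x|lebesgue_on K. g x)"
proof -
  have "x \<in> interior K" if "x \<in> K - frontier K" for x
    using that by (blast intro: mem_frontierI)
  then show "integrable (lebesgue_on K) f" "(LINT x|lebesgue_on K. f x) = (LINT x|lebesgue_on K. g x)"
    using lebesgue_on_cong_negligible[OF _ g negligible_frontier[OF K], of f] fg element_borel[OF K] by auto
qed

lemma element_integral_continuous:
  fixes f g :: "real^'n \<Rightarrow> real"
  assumes K: "K \<in> \<T>" and g: "continuous_on UNIV g" and fg: "\<And>x. x \<in> interior K \<Longrightarrow> f x = g x"
  shows "integrable (lebesgue_on K) f" "(LINT x|lebesgue_on K. f x) = (LINT x|lborel. indicator K x * g x)"
proof -
  have gm: "g \<in> borel_measurable borel"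
    using g by (rule borel_measurable_continuous_onI)
  have "integrable (lebesgue_on K) g"
    using integrable_indicator_compact[OF compact_element[OF K] continuous_on_subset[OF g]]
    by (simp add: lebesgue_on_lborel[OF element_borel[OF K] gm])
  from element_integral_cong[OF K this fg]
  show "integrable (lebesgue_on K) f" "(LINT x|lebesgue_on K. f x) = (LINT x|lborel. indicator K x * g x)"
    by (simp_all add: lebesgue_on_lborel[OF element_borel[OF K] gm])
qed

text \<open>The function \<open>g\<close> is known only through its pairing with compactly supported
  test functions. Testing with \<open>\<psi>\<close> times a cut-off inside \<open>K\<close>
  compares it with the classical divergence of the piece, and then the cut-off is sent to 1.\<close>

lemma weak_div_element:
  fixes u w :: "real^'n \<Rightarrow> real^'n"
  assumes div: "has_weak_div \<Omega> u g" and K: "K \<in> \<T>"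
    and w: "C1v w" "\<And>x. x \<in> interior K \<Longrightarrow> u x = w x" and \<psi>: "C1 \<psi>"
  shows "(LINT x|lebesgue_on K. g x * \<psi> x) = (LINT x|lebesgue_on K. divg w x * \<psi> x)"
proof -
  obtain C \<nu> c h where frame: "simplex_frame C \<nu> c h" and K_eq: "K = convex hull C"
    using K by (rule simplex_obtain)
  interpret simplex_frame C \<nu> c h by (rule frame)
  show ?thesis
  proof (rule cutoff_exists[folded K_eq])
    fix \<kappa> :: "nat \<Rightarrow> real^'n \<Rightarrow> real" and S :: "nat \<Rightarrow> (real^'n) set"
    assume \<kappa>: "\<And>j. C1 (\<kappa> j)" "\<And>j x. 0 \<le> \<kappa> j x \<and> \<kappa> j x \<le> 1"
    "\<And>j. compact (S j) \<and> S j \<subseteq> interior K" "\<And>j x. x \<notin> S j \<Longrightarrow> \<kappa> j x = 0"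
    "\<And>x. x \<in> interior K \<Longrightarrow> (\<lambda>j. \<kappa> j x) \<longlonglongrightarrow> 1"
    have K_leb: "K \<in> sets lebesgue"
      using element_borel[OF K] by simp
    have Omega_leb: "\<Omega> \<in> sets lebesgue"
      by (rule fmeasurableD[OF Omega_lmeasurable])
    have g_int: "integrable (lebesgue_on K) g"
      by (rule integrable_element[OF L2_integrable[OF _ Omega_lmeasurable] K])
         (use div in \<open>simp add: has_weak_div_def\<close>)
    have \<psi>_cont: "continuous_on A \<psi>" and \<kappa>_cont: "continuous_on A (\<kappa> j)" for A j
      by (simp_all add: C1_continuous \<psi> \<kappa>)
    have gw: "integrable (lebesgue_on K) (\<lambda>x. g x * \<psi> x)"
      by (rule integrable_mult_continuous[OF compact_element[OF K] g_int \<psi>_cont])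
    have dw: "integrable (lebesgue_on K) (\<lambda>x. divg w x * \<psi> x)"
      by (rule element_integral_continuous(1)[OF K _ refl]) (intro continuous_intros divg_continuous w \<psi>_cont)
    have step: "(LINT x|lebesgue_on K. g x * \<psi> x * \<kappa> j x) = (LINT x|lebesgue_on K. divg w x * \<psi> x * \<kappa> j x)" for j
    proof -
      \<comment> \<open>Compact support in \<open>interior K\<close> makes this admissible for the
        weak divergence and removes every facet term from the Green formula.\<close>
      define \<phi> where "\<phi> x = \<kappa> j x * \<psi> x" for x
      have \<phi>: "C1 \<phi>" unfolding \<phi>_def by (intro C1_mult \<kappa> \<psi>)
      have supp: "\<phi> x = 0" "grad \<phi> x = 0" if "x \<notin> S j" for x
      proof -
        show "\<phi> x = 0" using \<kappa>(4)[OF that] by (simp add: \<phi>_def)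
        show "grad \<phi> x = 0"
        proof (rule grad_zero_open[OF \<phi>])
          show "open (- S j)" using \<kappa>(3)[of j] compact_imp_closed by blast
        qed (use that \<kappa>(4) in \<open>auto simp: \<phi>_def\<close>)
      qed
      have S_sub: "S j \<subseteq> interior K" "S j \<subseteq> K" "S j \<subseteq> \<Omega>"
        using \<kappa>(3)[of j] interior_subset interior_subset_Omega[OF K] by auto
      have in_S: "x \<in> \<Omega> \<longleftrightarrow> x \<in> K" if "x \<in> S j" for x
        using that S_sub by blast
      have "C1_with_grad \<Omega> \<phi> (grad \<phi>)"
        using C1_grad[OF \<phi>] C1_grad_continuous[OF \<phi>] by (auto simp: C1_with_grad_def)
      moreover have "\<exists>C. compact C \<and> C \<subseteq> \<Omega> \<and> (\<forall>x. x \<notin> C \<longrightarrow> \<phi> x = 0 \<and> grad \<phi> x = 0)"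
        using supp \<kappa>(3)[of j] S_sub by blast
      ultimately have "l2_inner \<Omega> u (grad \<phi>) = - l2_inner \<Omega> g \<phi>"
        using div[unfolded has_weak_div_def, THEN conjunct2] by blast
      moreover have "l2_inner \<Omega> u (grad \<phi>) = (LINT x|lebesgue_on K. w x \<bullet> grad \<phi> x)"
      proof -
        have "l2_inner \<Omega> u (grad \<phi>) = (LINT x|lebesgue_on K. u x \<bullet> grad \<phi> x)"
          unfolding l2_inner_def
          by (rule lebesgue_on_support[OF Omega_leb K_leb], rule in_S, rule ccontr) (simp add: supp)
        also have "\<dots> = (LINT x|lebesgue_on K. w x \<bullet> grad \<phi> x)"
          by (rule element_integral_cong(2)[OF K element_integral_continuous(1)[OF K _ refl]])
             (intro continuous_intros C1v_continuous C1_grad_continuous \<phi> w, simp add: w)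
        finally show ?thesis .
      qed
      moreover have "l2_inner \<Omega> g \<phi> = (LINT x|lebesgue_on K. g x * \<psi> x * \<kappa> j x)"
      proof -
        have "l2_inner \<Omega> g \<phi> = (LINT x|lebesgue_on K. g x * \<phi> x)"
          unfolding l2_inner_def inner_real_def
          by (rule lebesgue_on_support[OF Omega_leb K_leb], rule in_S, rule ccontr) (simp add: supp)
        then show ?thesis by (simp add: \<phi>_def mult_ac)
      qed
      moreover have "(LINT x|lebesgue_on K. w x \<bullet> grad \<phi> x) + (LINT x|lebesgue_on K. divg w x * \<psi> x * \<kappa> j x) = 0"
      proof -
        have i1: "integrable (lebesgue_on K) (\<lambda>x. w x \<bullet> grad \<phi> x)"
          by (rule element_integral_continuous(1)[OF K _ refl])
             (intro continuous_intros C1v_continuous C1_grad_continuous \<phi> w)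
        have i2: "integrable (lebesgue_on K) (\<lambda>x. divg w x * \<psi> x * \<kappa> j x)"
          by (rule element_integral_continuous(1)[OF K _ refl])
             (intro continuous_intros divg_continuous w \<psi>_cont \<kappa>_cont)
        have "(LINT x|lebesgue_on K. w x \<bullet> grad \<phi> x) + (LINT x|lebesgue_on K. divg w x * \<psi> x * \<kappa> j x)
            = (LINT x|lebesgue_on K. w x \<bullet> grad \<phi> x + \<phi> x * divg w x)"
          using i1 i2 by (simp add: \<phi>_def mult_ac)
        also have "\<dots> = (LINT x|lborel. indicator (convex hull C) x * (w x \<bullet> grad \<phi> x + \<phi> x * divg w x))"
          unfolding K_eq[symmetric]
          by (rule element_integral_continuous(2)[OF K _ refl])
             (intro continuous_intros divg_continuous w C1v_continuous C1_grad_continuous C1_continuous \<phi>)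
        also have "\<dots> = (\<Sum>a\<in>C. LINT x|face_measure (facet a). \<phi> x * (w x \<bullet> \<nu> a))"
          by (rule Green_formula[OF \<phi> w(1)])
        also have "\<dots> = 0"
        proof (rule sum.neutral, rule ballI)
          fix a assume a: "a \<in> C"
          show "(LINT x|face_measure (facet a). \<phi> x * (w x \<bullet> \<nu> a)) = 0"
          proof (rule face_integral_zero[OF norm_nu[OF a] compact_facet affine_hull_facet[OF a]])
            fix x assume "x \<in> facet a"
            then have "x \<notin> interior K"
              using mem_facet[OF a] a unfolding K_eq interior_K by force
            then show "\<phi> x * (w x \<bullet> \<nu> a) = 0"
              using supp S_sub by auto
          qed
        qed
        finally show ?thesis .
      qed
      ultimately show ?thesis by linarith
    qed
    \<comment> \<open>Removal of the cut-off by dominated convergence, for any integrable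
      \<open>q\<close> because \<open>g\<close> need not be continuous.\<close>
    have lim: "(\<lambda>j. LINT x|lebesgue_on K. q x * \<kappa> j x) \<longlonglongrightarrow> (LINT x|lebesgue_on K. q x)"
      if q: "integrable (lebesgue_on K) q" for q
    proof (rule integral_dominated_convergence[where w = "\<lambda>x. norm (q x)"])
      show "q \<in> borel_measurable (lebesgue_on K)" using q by simp
      have "\<kappa> j \<in> borel_measurable (lebesgue_on K)" for j
        using \<kappa>_cont K_leb by (intro continuous_imp_measurable_on_sets_lebesgue)
      then show "(\<lambda>x. q x * \<kappa> j x) \<in> borel_measurable (lebesgue_on K)" for j
        using q by (intro borel_measurable_times) auto
      show "integrable (lebesgue_on K) (\<lambda>x. norm (q x))" using q by simp
      have "AE x in lebesgue. x \<notin> frontier K"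
        using negligible_frontier[OF K] by (intro AE_not_in) (simp add: negligible_iff_null_sets)
      then have "AE x in lebesgue_on K. x \<in> interior K"
        using K_leb by (subst AE_restrict_space_iff) (auto elim!: eventually_mono intro: mem_frontierI)
      then show "AE x in lebesgue_on K. (\<lambda>j. q x * \<kappa> j x) \<longlonglongrightarrow> q x"
      proof eventually_elim
        fix x assume "x \<in> interior K"
        from tendsto_mult_left[OF \<kappa>(5)[OF this], of "q x"] show "(\<lambda>j. q x * \<kappa> j x) \<longlonglongrightarrow> q x" by simp
      qed
      show "AE x in lebesgue_on K. norm (q x * \<kappa> j x) \<le> norm (q x)" for j
        using \<kappa>(2)[of j] by (auto simp: abs_mult intro!: mult_left_le)
    qed
    show ?thesis
      using lim[OF gw] lim[OF dw] step LIMSEQ_unique by simp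
  qed
qed

end

section \<open>Facets and their normals\<close>

text \<open>The component \<open>d\<close> of \<open>n'\<close> orthogonal to \<open>n\<close> can
  be added to a point of the first plane without leaving it. It is therefore orthogonal to
  \<open>n'\<close> as well, and so it vanishes.\<close>

lemma hyperplane_normal_unique:
  fixes n n' :: "'a::real_inner"
  assumes n: "norm n = 1" "norm n' = 1" and sub: "{y. y \<bullet> n = c} \<subseteq> {y. y \<bullet> n' = c'}"
  shows "(n' = n \<and> c' = c) \<or> (n' = - n \<and> c' = - c)"
proof -
  have nn: "n \<bullet> n = 1" "n' \<bullet> n' = 1" using n by (simp_all add: norm_eq_sqrt_inner)
  have p: "(c *\<^sub>R n) \<bullet> n' = c'"
  proof -
    have "c *\<^sub>R n \<in> {y. y \<bullet> n = c}" using nn by simp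
    then show ?thesis using sub by blast
  qed
  define k where "k = n' \<bullet> n"
  define d where "d = n' - k *\<^sub>R n"
  have dn: "d \<bullet> n = 0" by (simp add: d_def k_def inner_diff_left nn)
  then have "(c *\<^sub>R n + d) \<bullet> n = c" by (simp add: inner_add_left nn)
  then have "(c *\<^sub>R n + d) \<bullet> n' = c'" using sub by blast
  then have "d \<bullet> n' = 0" using p by (simp add: inner_add_left)
  then have "d \<bullet> d = 0" using dn by (simp add: d_def inner_diff_right)
  then have n': "n' = k *\<^sub>R n" by (simp add: d_def)
  then have "k * k = 1" using nn by simp
  then have "k = 1 \<or> k = -1" by (simp add: square_eq_1_iff)
  then show ?thesis using n' p nn by auto
qed

lemma AE_open_lborel:
  assumes "open A" "AE x in lborel. x \<notin> A"
  shows "A = {}"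
proof -
  have "A \<in> null_sets lborel"
    using assms by (simp add: AE_iff_null_sets borel_open)
  then have "negligible A"
    by (simp add: negligible_iff_null_sets null_sets_completionI)
  then show ?thesis
    using open_not_negligible[OF assms(1)] by blast
qed

text \<open>The norm enters only through its square, a polynomial in the coordinates, and the outer
  square smooths the positive part; both serve \<open>C1_bump\<close>.\<close>

definition bump :: "real^'n::finite \<Rightarrow> real \<Rightarrow> real^'n \<Rightarrow> real" where
  "bump x0 \<delta> x = (max 0 (\<delta>\<^sup>2 - (norm (x - x0))\<^sup>2))\<^sup>2"

lemma C1_bump [simp]: "C1 (bump x0 \<delta>)"
proof -
  have "(norm (x - x0))\<^sup>2 = (\<Sum>i\<in>UNIV. (x $ i - x0 $ i)\<^sup>2)" for x
    by (subst power2_norm_eq_inner) (simp add: inner_vec_def power2_eq_square)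
  then show ?thesis
    unfolding bump_def[abs_def]
    by (simp only:) (intro C1_pos_part_square C1_diff C1_sum C1_power C1_const C1_nth)
qed

lemma bump_nonneg: "0 \<le> bump x0 \<delta> x"
  by (simp add: bump_def)

lemma bump_center: "\<delta> > 0 \<Longrightarrow> 0 < bump x0 \<delta> x0"
  by (simp add: bump_def)

lemma bump_outside:
  assumes "x \<notin> ball x0 \<delta>" "\<delta> > 0"
  shows "bump x0 \<delta> x = 0"
proof -
  have "\<delta> \<le> norm (x - x0)" using assms(1) by (simp add: dist_norm norm_minus_commute)
  then have "\<delta>\<^sup>2 \<le> (norm (x - x0))\<^sup>2" using assms(2) by (intro power_mono) auto
  then show ?thesis by (simp add: bump_def)
qed

text \<open>Since \<open>e\<close> fills its plane near \<open>x0\<close>, a positive value at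
  \<open>x0\<close> would make the integrand positive on an open part of the prism.\<close>

lemma face_integral_pos:
  fixes f :: "real^'n::finite \<Rightarrow> real"
  assumes n: "norm n = 1" and e: "compact e" "affine hull e = {y. y \<bullet> n = c}"
    and f: "continuous_on UNIV f" "\<And>x. x \<in> e \<Longrightarrow> 0 \<le> f x"
    and zero: "(LINT x|face_measure e. f x) = 0"
    and x0: "x0 \<in> e" "\<delta> > 0" "\<And>x. x \<in> ball x0 \<delta> \<Longrightarrow> x \<bullet> n = c \<Longrightarrow> x \<in> e"
  shows "f x0 = 0"
proof (rule ccontr)
  assume "f x0 \<noteq> 0"
  then have pos: "f x0 > 0" using f(2)[OF x0(1)] by simp
  define q where "q x = x - (x \<bullet> n - c) *\<^sub>R n" for x
  define S where "S = {x. q x \<in> e \<and> -1/2 < x \<bullet> n - c \<and> x \<bullet> n - c \<le> 1/2}"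
  have nn: "n \<bullet> n = 1" using n by (simp add: norm_eq_sqrt_inner)
  have qn: "q x \<bullet> n = c" for x by (simp add: q_def inner_diff_left nn)
  have q0: "x0 \<bullet> n = c" "q x0 = x0"
    using x0(1) e(2) hull_subset[of e affine] by (auto simp: q_def)
  have contq: "continuous_on UNIV q" unfolding q_def by (intro continuous_intros)
  have [measurable]: "q \<in> borel_measurable borel" "f \<in> borel_measurable borel" "e \<in> sets borel"
    using contq f(1) e(1) by (auto intro: borel_measurable_continuous_onI borel_compact)
  have [measurable]: "S \<in> sets borel" unfolding S_def by measurable
  obtain B where B: "\<And>y. y \<in> e \<Longrightarrow> \<bar>f y\<bar> \<le> B"
    using compact_imp_bounded[OF compact_continuous_image[OF continuous_on_subset[OF f(1)] e(1)]]
    by (auto simp: bounded_iff)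
  have "bounded S"
    by (rule bounded_subset[OF bounded_prism[OF e(1), of n c]]) (auto simp: S_def q_def)
  then have "emeasure lborel S < \<infinity>" by (rule emeasure_bounded_finite)
  then have "integrable lborel (\<lambda>x. indicator S x * B)"
    by (intro integrable_mult_left integrable_real_indicator) auto
  then have int: "integrable lborel (\<lambda>x. indicator S x * f (q x))"
  proof (rule Bochner_Integration.integrable_bound)
    show "AE x in lborel. norm (indicator S x * f (q x)) \<le> norm (indicator S x * B)"
      using B by (intro AE_I2) (force simp: S_def indicator_def)
  qed measurable
  have "(LINT x|lborel. indicator S x * f (q x)) = 0"
    using zero face_integral(2)[OF n e f(1) refl] by (simp add: S_def q_def)
  then have ae: "AE x in lborel. indicator S x * f (q x) = 0"
    using int f(2) by (subst (asm) integral_nonneg_eq_0_iff_AE) (auto simp: S_def indicator_def)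
  \<comment> \<open>Open in the whole space, as it restricts the foot point to a ball around
    \<open>x0\<close> and the height to an open interval. The vanishing integral makes it null,
    although it contains \<open>x0\<close>.\<close>
  define A where "A = q -` (ball x0 \<delta>) \<inter> (\<lambda>x. f (q x)) -` {0<..} \<inter> {x. -1/2 < x \<bullet> n - c} \<inter> {x. x \<bullet> n - c < 1/2}"
  have "open A"
    unfolding A_def
    by (intro open_Int open_vimage open_ball open_greaterThan contq continuous_on_compose2[OF f(1) contq]
         open_Collect_less continuous_intros) auto
  moreover have "AE x in lborel. x \<notin> A"
    using ae
  proof eventually_elim
    fix x assume *: "indicator S x * f (q x) = 0"
    show "x \<notin> A"
    proof
      assume "x \<in> A"
      then have "x \<in> S" "f (q x) > 0" using x0(3)[of "q x"] qn by (auto simp: A_def S_def)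
      then show False using * by simp
    qed
  qed
  ultimately have "A = {}" by (rule AE_open_lborel)
  moreover have "x0 \<in> A" using pos x0(2) q0 by (simp add: A_def)
  ultimately show False by blast
qed

text \<open>The outward unit normal without reference to vertices, so that the normals of two
  elements at a common facet can be compared.\<close>

definition onormal :: "(real^'n::finite) set \<Rightarrow> (real^'n) set \<Rightarrow> real^'n \<Rightarrow> bool" where
  "onormal K e n \<longleftrightarrow> norm n = 1 \<and> (\<exists>c. affine hull e = {y. y \<bullet> n = c} \<and> (\<forall>x\<in>K. x \<bullet> n \<le> c))"

context simplex_frame
begin

lemma onormal_facet:
  assumes a: "a \<in> C"
  shows "onormal K (facet a) (\<nu> a)"
proof -
  have "x \<bullet> \<nu> a \<le> c a" if "x \<in> K" for x
    using that a height[OF a] by (auto simp: mem_K bary_def zero_le_divide_iff)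
  then show ?thesis
    using norm_nu[OF a] affine_hull_facet[OF a] unfolding onormal_def by blast
qed

text \<open>The facet plane leaves only the sign open, and the opposite vertex lies strictly on one
  side of it.\<close>

lemma onormal_unique:
  assumes a: "a \<in> C" and n: "onormal K (facet a) n"
  shows "n = \<nu> a"
proof -
  obtain d where d: "{y. y \<bullet> \<nu> a = c a} = {y. y \<bullet> n = d}" "\<And>x. x \<in> K \<Longrightarrow> x \<bullet> n \<le> d" and "norm n = 1"
    using n affine_hull_facet[OF a] unfolding onormal_def by auto
  have "a \<in> K" using a by (simp add: hull_inc)
  have "(n = \<nu> a \<and> d = c a) \<or> (n = - \<nu> a \<and> d = - c a)"
    using hyperplane_normal_unique[OF norm_nu[OF a] \<open>norm n = 1\<close>] d(1) by blast
  then show ?thesis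
    using d(2)[OF \<open>a \<in> K\<close>] apex[OF a] height[OF a] by auto
qed

lemma facet_of_iff: "e facet_of K \<longleftrightarrow> (\<exists>a\<in>C. e = facet a)"
proof -
  have "facet a \<noteq> {}" if "a \<in> C" for a
  proof -
    have "card (C - {a}) \<noteq> 0" using that card_C finite_C by simp
    then have "C - {a} \<noteq> {}" by force
    then show ?thesis by simp
  qed
  then show ?thesis
    unfolding facet_of_convex_hull_affine_independent[OF indep] by auto
qed

lemma inj_facet: "inj_on facet C"
proof (rule inj_onI, rule ccontr)
  fix a b assume *: "a \<in> C" "b \<in> C" "facet a = facet b" "a \<noteq> b"
  then have "b \<in> facet a" by (intro hull_inc) auto
  then show False
    using * mem_facet[of b b] bary_vertex[of b b] by simp
qed

lemma rel_interior_facet: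
  assumes a: "a \<in> C" and x: "x \<in> rel_interior (facet a)"
  shows "x \<bullet> \<nu> a = c a" "\<And>b. b \<in> C - {a} \<Longrightarrow> 0 < bary b x"
proof -
  show "x \<bullet> \<nu> a = c a"
    using x rel_interior_subset hull_subset[of "facet a" affine] affine_hull_facet[OF a] by blast
  have "\<not> affine_dependent (C - {a})" using indep affine_independent_Diff by blast
  then obtain u where u: "\<forall>b\<in>C - {a}. 0 < u b" "sum u (C - {a}) = 1" "(\<Sum>b\<in>C - {a}. u b *\<^sub>R b) = x"
    using x rel_interior_convex_hull_explicit by blast
  define w where "w b = (if b = a then 0 else u b)" for b
  have "(\<Sum>b\<in>C. w b) = 1" "(\<Sum>b\<in>C. w b *\<^sub>R b) = x"
    using u a finite_C by (simp_all add: sum.remove[OF finite_C a] w_def)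
  then show "0 < bary b x" if "b \<in> C - {a}" for b
    using bary_affine_combination[of w b] that u(1) by (auto simp: w_def)
qed

text \<open>The barycentric coordinates other than \<open>bary a\<close> stay positive near a
  relative interior point of the facet, so the simplex looks like a half-space there.\<close>

lemma facet_local:
  assumes a: "a \<in> C" and x0: "x0 \<in> rel_interior (facet a)"
  shows "\<exists>\<delta>>0. \<forall>x\<in>cball x0 \<delta>. (x \<in> interior K \<longleftrightarrow> x \<bullet> \<nu> a < c a) \<and>
    (x \<in> facet a \<longleftrightarrow> x \<bullet> \<nu> a = c a) \<and> (\<forall>b\<in>C - {a}. x \<notin> facet b)"
proof -
  define A where "A = (\<Inter>b\<in>C - {a}. {x. 0 < bary b x})"
  have "open {x. 0 < bary b x}" for b
    using open_Collect_less[OF continuous_on_const bary_continuous, of 0 b] by simp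
  then have "open A" unfolding A_def using finite_C by (intro open_INT) auto
  moreover have "x0 \<in> A" using rel_interior_facet(2)[OF a x0] by (simp add: A_def)
  ultimately obtain \<delta> where \<delta>: "\<delta> > 0" "cball x0 \<delta> \<subseteq> A"
    using open_contains_cball by blast
  have bary_a: "0 < bary a x \<longleftrightarrow> x \<bullet> \<nu> a < c a" "bary a x = 0 \<longleftrightarrow> x \<bullet> \<nu> a = c a" for x
    using height[OF a] by (auto simp: bary_def zero_less_divide_iff)
  have "(x \<in> interior K \<longleftrightarrow> x \<bullet> \<nu> a < c a) \<and> (x \<in> facet a \<longleftrightarrow> x \<bullet> \<nu> a = c a) \<and> (\<forall>b\<in>C - {a}. x \<notin> facet b)"
    if "x \<in> cball x0 \<delta>" for x
  proof -
    have pos: "0 < bary b x" if "b \<in> C" "b \<noteq> a" for b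
      using \<open>x \<in> cball x0 \<delta>\<close> \<delta>(2) that by (auto simp: A_def)
    have "x \<in> interior K \<longleftrightarrow> 0 < bary a x"
      unfolding interior_K using pos a by auto
    moreover have "x \<in> facet a \<longleftrightarrow> bary a x = 0"
    proof -
      have "x \<in> K" if "bary a x = 0"
        unfolding mem_K using pos that by (metis less_imp_le order_refl)
      then show ?thesis using mem_facet[OF a] by auto
    qed
    moreover have "x \<notin> facet b" if "b \<in> C - {a}" for b
      using pos[of b] mem_facet[of b x] that by auto
    ultimately show ?thesis by (simp add: bary_a)
  qed
  then show ?thesis using \<delta>(1) by blast
qed

lemma local_Green:
  assumes a: "a \<in> C" and \<phi>: "C1 \<phi>" "\<And>x. x \<notin> S \<Longrightarrow> \<phi> x = 0" and w: "C1v w"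
    and S: "\<And>x b. x \<in> S \<Longrightarrow> b \<in> C - {a} \<Longrightarrow> x \<notin> facet b"
  shows "(LINT x|lborel. indicator K x * (w x \<bullet> grad \<phi> x + \<phi> x * divg w x))
    = (LINT x|face_measure (facet a). \<phi> x * (w x \<bullet> \<nu> a))"
proof -
  have "(LINT x|face_measure (facet b). \<phi> x * (w x \<bullet> \<nu> b)) = 0" if b: "b \<in> C - {a}" for b
  proof (rule face_integral_zero[OF norm_nu compact_facet affine_hull_facet])
    show "b \<in> C" "b \<in> C" using b by auto
    show "\<phi> x * (w x \<bullet> \<nu> b) = 0" if "x \<in> facet b" for x
      using S[OF _ b] \<phi>(2)[of x] that by auto
  qed
  then show ?thesis
    unfolding Green_formula[OF \<phi>(1) w] by (simp add: sum.remove[OF finite_C a])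
qed

end

lemma L2_bounded:
  fixes f :: "'a::euclidean_space \<Rightarrow> 'b::euclidean_space"
  assumes \<Omega>: "\<Omega> \<in> lmeasurable" and f: "continuous_on \<Omega> f" and B: "\<And>x. x \<in> \<Omega> \<Longrightarrow> norm (f x) \<le> B"
  shows "L2 \<Omega> f"
proof -
  have m: "f \<in> borel_measurable (lebesgue_on \<Omega>)"
    using f \<Omega> by (intro continuous_imp_measurable_on_sets_lebesgue) (auto simp: fmeasurableD)
  have "(\<lambda>x. (norm (f x))\<^sup>2) absolutely_integrable_on \<Omega>"
  proof (rule bounded_measurable_imp_absolutely_integrable[OF \<Omega>])
    show "(\<lambda>x. (norm (f x))\<^sup>2) \<in> borel_measurable (lebesgue_on \<Omega>)" using m by measurable
    show "\<bar>(norm (f x))\<^sup>2\<bar> \<le> B\<^sup>2" if "x \<in> \<Omega>" for x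
      using B[OF that] by (simp add: power_mono)
  qed
  then show ?thesis
    using m \<Omega> by (simp add: L2_def set_integrable_def integrable_restrict_space fmeasurableD)
qed

text \<open>The two open half-spaces and the complement of \<open>S\<close> cover
  \<open>\<Omega>\<close>, and the truncated function is \<open>C1\<close> on each. This yields the
  one-sided test functions at boundary facets.\<close>

lemma C1_with_grad_piece:
  assumes \<phi>: "C1 \<phi>" and zero: "\<And>x. x \<notin> S \<Longrightarrow> \<phi> x = 0" and S: "closed S"
    and plane: "\<And>x. x \<in> \<Omega> \<Longrightarrow> x \<in> S \<Longrightarrow> x \<bullet> n \<noteq> c" and \<Omega>: "open \<Omega>"
  shows "C1_with_grad \<Omega> (\<lambda>x. if x \<bullet> n < c then \<phi> x else 0) (\<lambda>x. if x \<bullet> n < c then grad \<phi> x else 0)"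
proof -
  define f where "f = (\<lambda>x. if x \<bullet> n < c then \<phi> x else 0)"
  define G where "G = (\<lambda>x. if x \<bullet> n < c then grad \<phi> x else 0)"
  have oS: "open (- S)" using S by (simp add: open_Compl)
  have gz: "grad \<phi> x = 0" if "x \<notin> S" for x
    by (rule grad_zero_open[OF \<phi> oS]) (use that zero in auto)
  have op1: "open {x. x \<bullet> n < c}" and op2: "open {x. c < x \<bullet> n}"
    by (intro open_Collect_less continuous_intros)+
  have "(f has_derivative (\<lambda>v. v \<bullet> G x)) (at x) \<and> isCont G x" if x: "x \<in> \<Omega>" for x
  proof -
    consider "x \<bullet> n < c" | "c < x \<bullet> n" | "x \<notin> S"
      using plane[OF x] by fastforce
    then show ?thesis
    proof cases
      case 1
      have "(f has_derivative (\<lambda>v. v \<bullet> grad \<phi> x)) (at x)"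
        by (rule has_derivative_transform_within_open[OF C1_has_derivative[OF \<phi>] op1]) (use 1 in \<open>auto simp: f_def\<close>)
      moreover have "isCont (grad \<phi>) x"
        using C1_grad_continuous[OF \<phi>, of UNIV] by (simp add: continuous_on_eq_continuous_at)
      then have "isCont G x"
        by (subst isCont_cong[of _ "grad \<phi>"]) (use 1 eventually_nhds_in_open[OF op1, of x] in \<open>auto simp: G_def elim!: eventually_mono\<close>)
      ultimately show ?thesis using 1 by (simp add: G_def)
    next
      case 2
      have "(f has_derivative (\<lambda>v. 0)) (at x)"
        by (rule has_derivative_transform_within_open[OF has_derivative_const op2]) (use 2 in \<open>auto simp: f_def\<close>)
      moreover have "isCont G x"
        by (subst isCont_cong[of _ "\<lambda>_. 0"]) (use 2 eventually_nhds_in_open[OF op2, of x] in \<open>auto simp: G_def elim!: eventually_mono\<close>)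
      ultimately show ?thesis using 2 by (simp add: G_def)
    next
      case 3
      have "(f has_derivative (\<lambda>v. 0)) (at x)"
        by (rule has_derivative_transform_within_open[OF has_derivative_const oS]) (use 3 zero in \<open>auto simp: f_def\<close>)
      moreover have "isCont G x"
        by (subst isCont_cong[of _ "\<lambda>_. 0"]) (use 3 gz eventually_nhds_in_open[OF oS, of x] in \<open>auto simp: G_def elim!: eventually_mono\<close>)
      ultimately show ?thesis using 3 gz by (simp add: G_def)
    qed
  qed
  then have "C1_with_grad \<Omega> f G"
    unfolding C1_with_grad_def gderiv_def by (auto intro: continuous_at_imp_continuous_on)
  then show ?thesis by (simp add: f_def G_def)
qed

section \<open>Normals and neighbouring elements in the mesh\<close>

context mesh
begin

lemma facet_frame:
  assumes K: "K \<in> \<T>" and e: "e facet_of K"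
  obtains C \<nu> c h a where "simplex_frame C \<nu> c h" "K = convex hull C" "a \<in> C" "e = convex hull (C - {a})"
proof -
  obtain C \<nu> c h where *: "simplex_frame C \<nu> c h" "K = convex hull C"
    using K by (rule simplex_obtain)
  moreover obtain a where "a \<in> C" "e = convex hull (C - {a})"
    using e simplex_frame.facet_of_iff[OF *(1)] *(2) by blast
  ultimately show ?thesis by (rule that)
qed

lemma onormal_exists: "K \<in> \<T> \<Longrightarrow> e facet_of K \<Longrightarrow> \<exists>n. onormal K e n"
  by (metis facet_frame simplex_frame.onormal_facet)

lemma facet_local_structure:
  assumes K: "K \<in> \<T>" and e: "e facet_of K" and n: "onormal K e n" and c: "affine hull e = {y. y \<bullet> n = c}"
    and x0: "x0 \<in> rel_interior e"
  shows "\<exists>\<delta>>0. \<forall>x\<in>cball x0 \<delta>. (x \<in> interior K \<longleftrightarrow> x \<bullet> n < c) \<and> (x \<in> e \<longleftrightarrow> x \<bullet> n = c) \<and>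
    (\<forall>e'. e' facet_of K \<longrightarrow> e' \<noteq> e \<longrightarrow> x \<notin> e')"
proof -
  obtain C \<nu> c' h a where *: "simplex_frame C \<nu> c' h" "K = convex hull C" "a \<in> C" "e = convex hull (C - {a})"
    using facet_frame[OF K e] .
  interpret simplex_frame C \<nu> c' h by (rule *(1))
  have n': "n = \<nu> a"
    using onormal_unique[OF *(3)] n *(2,4) by simp
  have "(c *\<^sub>R n) \<bullet> n = c"
    using n by (simp add: onormal_def norm_eq_sqrt_inner)
  then have "c *\<^sub>R n \<in> affine hull e" by (simp add: c)
  then have "c' a = c"
    using affine_hull_facet[OF *(3)] \<open>(c *\<^sub>R n) \<bullet> n = c\<close> unfolding *(4)[symmetric] n' by simp
  have other: "\<exists>b\<in>C - {a}. e' = facet b" if "e' facet_of K" "e' \<noteq> e" for e'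
  proof -
    have "e' facet_of convex hull C" using that(1) *(2) by simp
    then have "\<exists>b\<in>C. e' = facet b" by (simp only: facet_of_iff)
    then obtain b where b: "b \<in> C" "e' = facet b" by (elim bexE)
    then have "b \<noteq> a" using that(2) *(4) by metis
    with b show ?thesis by (intro bexI[of _ b]) auto
  qed
  obtain \<delta> where \<delta>: "\<delta> > 0" "\<forall>x\<in>cball x0 \<delta>. (x \<in> interior (convex hull C) \<longleftrightarrow> x \<bullet> \<nu> a < c' a) \<and>
    (x \<in> facet a \<longleftrightarrow> x \<bullet> \<nu> a = c' a) \<and> (\<forall>b\<in>C - {a}. x \<notin> facet b)"
    using facet_local[OF *(3) x0[unfolded *(4)]] by (elim exE conjE)
  show ?thesis
  proof (intro exI[of _ \<delta>] conjI ballI allI impI)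
    fix x assume x: "x \<in> cball x0 \<delta>"
    note loc = bspec[OF \<delta>(2) x]
    show "(x \<in> interior K) = (x \<bullet> n < c)" "(x \<in> e) = (x \<bullet> n = c)"
      using loc \<open>c' a = c\<close> *(2,4) n' by simp_all
    show "x \<notin> e'" if "e' facet_of K" "e' \<noteq> e" for e'
      using other[OF that] loc by blast
  qed (rule \<delta>(1))
qed

lemma facet_Green_local:
  assumes K: "K \<in> \<T>" and e: "e facet_of K" and n: "onormal K e n"
    and \<phi>: "C1 \<phi>" "\<And>x. x \<notin> S \<Longrightarrow> \<phi> x = 0" and w: "C1v w"
    and S: "\<And>x e'. x \<in> S \<Longrightarrow> e' facet_of K \<Longrightarrow> e' \<noteq> e \<Longrightarrow> x \<notin> e'"
  shows "(LINT x|lebesgue_on K. w x \<bullet> grad \<phi> x + \<phi> x * divg w x) = (LINT x|face_measure e. \<phi> x * (w x \<bullet> n))"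
proof -
  obtain C \<nu> c' h a where *: "simplex_frame C \<nu> c' h" "K = convex hull C" "a \<in> C" "e = convex hull (C - {a})"
    using facet_frame[OF K e] .
  interpret simplex_frame C \<nu> c' h by (rule *(1))
  have n': "n = \<nu> a"
    using onormal_unique[OF *(3)] n *(2,4) by simp
  have other: "x \<notin> facet b" if "x \<in> S" "b \<in> C - {a}" for x b
  proof (rule S[OF that(1)])
    show "facet b facet_of K" using facet_of_iff that unfolding *(2) by blast
    show "facet b \<noteq> e" using inj_facet that *(3) unfolding *(4) by (auto dest: inj_onD)
  qed
  have "(LINT x|lebesgue_on K. w x \<bullet> grad \<phi> x + \<phi> x * divg w x)
      = (LINT x|lborel. indicator K x * (w x \<bullet> grad \<phi> x + \<phi> x * divg w x))"
    by (rule element_integral_continuous(2)[OF K _ refl])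
       (intro continuous_intros divg_continuous w C1v_continuous C1_grad_continuous C1_continuous \<phi>)
  also have "\<dots> = (LINT x|face_measure (facet a). \<phi> x * (w x \<bullet> \<nu> a))"
    unfolding *(2) by (rule local_Green[OF *(3) \<phi> w other])
  finally show ?thesis by (simp add: n' *(4))
qed

lemma facet_compact: "K \<in> \<T> \<Longrightarrow> e facet_of K \<Longrightarrow> compact e"
  by (rule facet_frame) (auto simp: simplex_frame.compact_facet)

lemma facet_rel_interior:
  assumes "K \<in> \<T>" "e facet_of K"
  shows "convex e" "rel_interior e \<noteq> {}" "closure (rel_interior e) = e"
proof -
  show conv: "convex e"
    using assms(2) by (auto simp: facet_of_def face_of_def)
  show "rel_interior e \<noteq> {}"
    using assms(2) conv by (auto simp: facet_of_def rel_interior_eq_empty)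
  show "closure (rel_interior e) = e"
    using convex_closure_rel_interior[OF conv] facet_compact[OF assms] by (simp add: compact_imp_closed)
qed

text \<open>Both elements would contain the same small half-ball at a relative interior point of
  \<open>e\<close>, contrary to the disjointness of interiors.\<close>

lemma same_side_unique:
  assumes K: "K \<in> \<T>" "e facet_of K" "onormal K e n" and K': "K' \<in> \<T>" "e facet_of K'" "onormal K' e n"
  shows "K = K'"
proof (rule ccontr)
  assume "K \<noteq> K'"
  obtain x0 where x0: "x0 \<in> rel_interior e" using facet_rel_interior(2)[OF K(1,2)] by blast
  obtain c where c: "affine hull e = {y. y \<bullet> n = c}" using K(3) by (auto simp: onormal_def)
  have nn: "norm n = 1" "n \<bullet> n = 1" using K(3) by (auto simp: onormal_def norm_eq_sqrt_inner)
  obtain \<delta> where \<delta>: "\<delta> > 0" "\<And>x. x \<in> cball x0 \<delta> \<Longrightarrow> x \<in> interior K \<longleftrightarrow> x \<bullet> n < c"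
    using facet_local_structure[OF K c x0] by blast
  obtain \<delta>' where \<delta>': "\<delta>' > 0" "\<And>x. x \<in> cball x0 \<delta>' \<Longrightarrow> x \<in> interior K' \<longleftrightarrow> x \<bullet> n < c"
    using facet_local_structure[OF K' c x0] by blast
  define x where "x = x0 - min \<delta> \<delta>' *\<^sub>R n"
  have "x0 \<bullet> n = c"
    using x0 rel_interior_subset hull_subset[of e affine] c by blast
  then have "x \<bullet> n < c" using \<delta> \<delta>' nn by (simp add: x_def inner_diff_left)
  moreover have "x \<in> cball x0 \<delta>" "x \<in> cball x0 \<delta>'" using \<delta> \<delta>' nn by (auto simp: x_def dist_norm)
  ultimately have "x \<in> interior K \<inter> interior K'" using \<delta> \<delta>' by blast
  then show False using interior_disjoint[OF K(1) K'(1) \<open>K \<noteq> K'\<close>] by blast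
qed

lemma onormal_unique:
  assumes "K \<in> \<T>" "e facet_of K" "onormal K e n" "onormal K e n'"
  shows "n' = n"
proof -
  obtain C \<nu> c' h a where *: "simplex_frame C \<nu> c' h" "K = convex hull C" "a \<in> C" "e = convex hull (C - {a})"
    using facet_frame[OF assms(1,2)] .
  have "n = \<nu> a" "n' = \<nu> a"
    by (rule simplex_frame.onormal_unique[OF *(1,3)]; use assms(3,4) *(2,4) in simp)+
  then show ?thesis by simp
qed

text \<open>Unit normals of one plane agree up to sign, and equal signs are excluded by
  \<open>same_side_unique\<close>.\<close>

lemma opposite_side:
  assumes K: "K \<in> \<T>" "e facet_of K" "onormal K e n" and K': "K' \<in> \<T>" "e facet_of K'" and ne: "K \<noteq> K'"
  shows "onormal K' e (- n)"
proof -
  obtain n' where n': "onormal K' e n'" using onormal_exists[OF K'] by blast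
  obtain c where c: "affine hull e = {y. y \<bullet> n = c}" "norm n = 1"
    using K(3) by (auto simp: onormal_def)
  obtain c' where c': "affine hull e = {y. y \<bullet> n' = c'}" "norm n' = 1"
    using n' by (auto simp: onormal_def)
  have "n' = n \<or> n' = - n"
    using hyperplane_normal_unique[OF c(2) c'(2), of c c'] c(1) c'(1) by auto
  then show ?thesis
    using n' same_side_unique[OF K K'] ne by auto
qed

lemma unit_normal_inner:
  assumes "unit_normal e n" "x \<in> e" "y \<in> e"
  shows "x \<bullet> n = y \<bullet> n"
proof -
  have "(x - y) \<bullet> n = 0"
    using assms unfolding unit_normal_def by blast
  then show ?thesis by (simp add: inner_diff_left)
qed

text \<open>Links the sign conditions in \<open>elem1\<close> and \<open>elem2\<close> to
  \<open>onormal\<close>: a unit vector normal to \<open>e\<close> describes the hyperplane spanned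
  by \<open>e\<close>.\<close>

lemma onormal_iff:
  assumes K: "K \<in> \<T>" "e facet_of K" and n: "unit_normal e n"
  shows "onormal K e n \<longleftrightarrow> (\<forall>x\<in>K. \<forall>y\<in>e. (x - y) \<bullet> n \<le> 0)"
proof -
  obtain n' where n': "onormal K e n'" using onormal_exists[OF K] by blast
  obtain c where c: "affine hull e = {y. y \<bullet> n' = c}" "norm n' = 1" using n' by (auto simp: onormal_def)
  obtain y0 where y0: "y0 \<in> e" using K(2) by (auto simp: facet_of_def)
  have "norm n = 1" using n by (simp add: unit_normal_def)
  have "e \<subseteq> {y. y \<bullet> n = y0 \<bullet> n}"
    using unit_normal_inner[OF n _ y0] by blast
  moreover have "affine {y. y \<bullet> n = y0 \<bullet> n}"
    using affine_hyperplane[of n "y0 \<bullet> n"] by (simp add: inner_commute)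
  ultimately have sub: "affine hull e \<subseteq> {y. y \<bullet> n = y0 \<bullet> n}"
    by (rule hull_minimal)
  then have hull: "affine hull e = {y. y \<bullet> n = y0 \<bullet> n}"
    using hyperplane_normal_unique[OF c(2) \<open>norm n = 1\<close>, of c "y0 \<bullet> n"] c(1) by auto
  show ?thesis
  proof
    assume "onormal K e n"
    then obtain d where d: "affine hull e = {y. y \<bullet> n = d}" "\<forall>x\<in>K. x \<bullet> n \<le> d" by (auto simp: onormal_def)
    then have "\<forall>y\<in>e. y \<bullet> n = d" using hull_subset[of e affine] by blast
    then show "\<forall>x\<in>K. \<forall>y\<in>e. (x - y) \<bullet> n \<le> 0" using d(2) by (simp add: inner_diff_left)
  next
    assume "\<forall>x\<in>K. \<forall>y\<in>e. (x - y) \<bullet> n \<le> 0"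
    then have "\<forall>x\<in>K. x \<bullet> n \<le> y0 \<bullet> n" using y0 by (auto simp: inner_diff_left)
    then show "onormal K e n" using hull \<open>norm n = 1\<close> by (auto simp: onormal_def)
  qed
qed

text \<open>Justifies the definite descriptions in \<open>elem1\<close> and \<open>elem2\<close>:
  the chosen normal is outward for one of the two elements that witness the interior face and inward
  for the other, and a third element would have to share a side with one of them.\<close>

lemma interior_face_elements:
  assumes e: "e \<in> interior_faces \<Omega> \<T>" and n: "unit_normal e (\<nu> e)"
  shows "elem1 \<T> \<nu> e \<in> \<T>" "elem2 \<T> \<nu> e \<in> \<T>" "elem1 \<T> \<nu> e \<noteq> elem2 \<T> \<nu> e"
    "{K \<in> \<T>. e facet_of K} = {elem1 \<T> \<nu> e, elem2 \<T> \<nu> e}"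
    "onormal (elem1 \<T> \<nu> e) e (\<nu> e)" "onormal (elem2 \<T> \<nu> e) e (- \<nu> e)"
proof -
  obtain K K' where K: "K \<in> \<T>" "e facet_of K" and K': "K' \<in> \<T>" "e facet_of K'" and ne: "K \<noteq> K'"
    using e unfolding interior_faces_def by blast
  have n': "unit_normal e (- \<nu> e)" using n by (simp add: unit_normal_def)
  obtain m where m: "onormal K e m" using onormal_exists[OF K] by blast
  have "m = \<nu> e \<or> m = - \<nu> e"
  proof -
    obtain c where c: "affine hull e = {y. y \<bullet> m = c}" "norm m = 1" using m by (auto simp: onormal_def)
    obtain y0 where y0: "y0 \<in> e" using K(2) by (auto simp: facet_of_def)
    have "e \<subseteq> {y. y \<bullet> \<nu> e = y0 \<bullet> \<nu> e}"
      using unit_normal_inner[OF n _ y0] by blast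
    moreover have "affine {y. y \<bullet> \<nu> e = y0 \<bullet> \<nu> e}"
      using affine_hyperplane[of "\<nu> e" "y0 \<bullet> \<nu> e"] by (simp add: inner_commute)
    ultimately have "affine hull e \<subseteq> {y. y \<bullet> \<nu> e = y0 \<bullet> \<nu> e}"
      by (rule hull_minimal)
    then show ?thesis
      using hyperplane_normal_unique[OF c(2), of "\<nu> e" c "y0 \<bullet> \<nu> e"] c(1) n by (auto simp: unit_normal_def)
  qed
  then have "\<exists>K1 K2. K1 \<in> \<T> \<and> K2 \<in> \<T> \<and> e facet_of K1 \<and> e facet_of K2 \<and> K1 \<noteq> K2 \<and> onormal K1 e (\<nu> e) \<and> onormal K2 e (- \<nu> e)"
    using opposite_side[OF K m K' ne] m K K' ne by (metis minus_minus)
  then obtain K1 K2 where K1: "K1 \<in> \<T>" "e facet_of K1" "onormal K1 e (\<nu> e)"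
    and K2: "K2 \<in> \<T>" "e facet_of K2" "onormal K2 e (- \<nu> e)" and ne12: "K1 \<noteq> K2" by blast
  have 1: "elem1 \<T> \<nu> e = K1"
    unfolding elem1_def
  proof (rule the_equality)
    show "K1 \<in> \<T> \<and> e facet_of K1 \<and> (\<forall>x\<in>K1. \<forall>y\<in>e. (x - y) \<bullet> \<nu> e \<le> 0)"
      using K1 onormal_iff[OF K1(1,2) n] by blast
    show "L = K1" if "L \<in> \<T> \<and> e facet_of L \<and> (\<forall>x\<in>L. \<forall>y\<in>e. (x - y) \<bullet> \<nu> e \<le> 0)" for L
      using same_side_unique[OF _ _ _ K1] onormal_iff[OF _ _ n] that by blast
  qed
  have 2: "elem2 \<T> \<nu> e = K2"
    unfolding elem2_def
  proof (rule the_equality)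
    show "K2 \<in> \<T> \<and> e facet_of K2 \<and> (\<forall>x\<in>K2. \<forall>y\<in>e. 0 \<le> (x - y) \<bullet> \<nu> e)"
      using K2 onormal_iff[OF K2(1,2) n'] by auto
    show "L = K2" if "L \<in> \<T> \<and> e facet_of L \<and> (\<forall>x\<in>L. \<forall>y\<in>e. 0 \<le> (x - y) \<bullet> \<nu> e)" for L
      using same_side_unique[OF _ _ _ K2] onormal_iff[OF _ _ n'] that by auto
  qed
  show "elem1 \<T> \<nu> e \<in> \<T>" "elem2 \<T> \<nu> e \<in> \<T>" "elem1 \<T> \<nu> e \<noteq> elem2 \<T> \<nu> e"
    "onormal (elem1 \<T> \<nu> e) e (\<nu> e)" "onormal (elem2 \<T> \<nu> e) e (- \<nu> e)"
    using 1 2 K1 K2 ne12 by auto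
  have "L = K1 \<or> L = K2" if "L \<in> \<T>" "e facet_of L" for L
    using opposite_side[OF K1 that] same_side_unique[OF that _ K2] by blast
  then show "{K \<in> \<T>. e facet_of K} = {elem1 \<T> \<nu> e, elem2 \<T> \<nu> e}"
    using 1 2 K1 K2 by auto
qed

end

section \<open>Normal traces\<close>

context mesh
begin

text \<open>The representatives are \<open>C1\<close> on the whole space rather than on their
  element only, so that traces on faces are plain values and the Green formula applies
  directly.\<close>

definition pieces :: "(real^'n \<Rightarrow> real^'n) \<Rightarrow> ((real^'n) set \<Rightarrow> real^'n \<Rightarrow> real^'n) \<Rightarrow> bool" where
  "pieces u w \<longleftrightarrow> (\<forall>K\<in>\<T>. C1v (w K) \<and> (\<forall>x\<in>interior K. u x = w K x))"

definition spieces :: "(real^'n \<Rightarrow> real) \<Rightarrow> ((real^'n) set \<Rightarrow> real^'n \<Rightarrow> real) \<Rightarrow> bool" where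
  "spieces f p \<longleftrightarrow> (\<forall>K\<in>\<T>. C1 (p K) \<and> (\<forall>x\<in>interior K. f x = p K x))"

text \<open>A relative interior point of \<open>e\<close> inside \<open>\<Omega>\<close> can be left
  across \<open>e\<close> without leaving the union of the elements, so it lies in a second element.
  The common face then contains \<open>e\<close> and has its dimension, which makes \<open>e\<close>
  an interior face.\<close>

lemma boundary_facet:
  assumes K: "K \<in> \<T>" "e facet_of K" and e: "e \<notin> interior_faces \<Omega> \<T>"
  shows "e \<inter> \<Omega> = {}"
proof (rule ccontr)
  assume ne: "e \<inter> \<Omega> \<noteq> {}"
  have "\<Omega> \<inter> closure (rel_interior e) \<noteq> {}"
    using ne facet_rel_interior(3)[OF K] by auto
  then have "\<Omega> \<inter> rel_interior e \<noteq> {}"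
    using open_Int_closure_eq_empty[OF open_Omega] by blast
  then obtain y where y: "y \<in> \<Omega>" "y \<in> rel_interior e" by blast
  obtain n where n: "onormal K e n" using onormal_exists[OF K] by blast
  obtain c where c: "affine hull e = {z. z \<bullet> n = c}" "norm n = 1" "\<And>x. x \<in> K \<Longrightarrow> x \<bullet> n \<le> c"
    using n unfolding onormal_def by blast
  have ye: "y \<in> e" using y(2) rel_interior_subset by blast
  then have yn: "y \<bullet> n = c" using c(1) hull_subset[of e affine] by blast
  \<comment> \<open>Points outside \<open>K\<close> that approach \<open>y\<close> from the far side
    of \<open>e\<close>.\<close>
  define z where "z j = y + (1 / real (Suc j)) *\<^sub>R n" for j
  have nn: "n \<bullet> n = 1" using c(2) by (simp add: norm_eq_sqrt_inner)
  have z_lim: "z \<longlonglongrightarrow> y"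
  proof -
    have "(\<lambda>j. 1 / real (Suc j)) \<longlonglongrightarrow> 0"
      using LIMSEQ_inverse_real_of_nat by (simp add: inverse_eq_divide)
    then have "(\<lambda>j. y + (1 / real (Suc j)) *\<^sub>R n) \<longlonglongrightarrow> y + 0 *\<^sub>R n"
      by (intro tendsto_intros)
    then show ?thesis by (simp add: z_def[abs_def])
  qed
  have z_K: "z j \<notin> K" for j
  proof
    assume "z j \<in> K"
    from c(3)[OF this] show False using yn nn by (simp add: z_def inner_add_left)
  qed
  \<comment> \<open>The other elements form a closed set. If it missed \<open>y\<close>, some
    \<open>z j\<close> would lie in \<open>\<Omega>\<close> but in no element.\<close>
  have "\<exists>K'\<in>\<T> - {K}. y \<in> K'"
  proof (rule ccontr)
    assume "\<not> ?thesis"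
    then have "y \<in> \<Omega> \<inter> (- \<Union>(\<T> - {K}))" using y by blast
    moreover have "open (\<Omega> \<inter> (- \<Union>(\<T> - {K})))"
      using finite_T compact_element by (intro open_Int open_Omega open_Compl closed_Union) (auto simp: compact_imp_closed)
    ultimately have "\<forall>\<^sub>F j in sequentially. z j \<in> \<Omega> \<inter> (- \<Union>(\<T> - {K}))"
      using z_lim topological_tendstoD by blast
    then obtain j where "z j \<in> \<Omega>" "z j \<notin> \<Union>(\<T> - {K})"
      using eventually_sequentially by force
    moreover have "\<Omega> \<subseteq> \<Union>\<T>" using closure_Omega closure_subset by blast
    ultimately show False using z_K[of j] by blast
  qed
  then obtain K' where K': "K' \<in> \<T>" "K' \<noteq> K" "y \<in> K'" by blast
  have f1: "(K \<inter> K') face_of K" and f2: "(K \<inter> K') face_of K'"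
    using K(1) K'(1) simplicial unfolding simplicial_mesh_def triangulation_def by (blast, metis Int_commute)
  have eK: "e \<subseteq> K" using K(2) by (rule facet_of_imp_subset)
  \<comment> \<open>A face of \<open>K\<close> that contains a relative interior point of
    \<open>e\<close> contains all of \<open>e\<close>.\<close>
  have sub: "e \<subseteq> K \<inter> K'"
    by (rule subset_of_face_of[OF f1 eK]) (use y ye eK K' in blast)
  have ef: "e face_of K" and edim: "aff_dim e = int CARD('n) - 1" and ene: "e \<noteq> {}"
    using K(2) aff_dim_element[OF K(1)] by (auto simp: facet_of_def)
  have "K \<inter> K' \<noteq> K"
  proof
    assume eq: "K \<inter> K' = K"
    then have "K \<noteq> K'" "K face_of K'" using K'(2) f2 by auto
    then show False
      using face_of_aff_dim_lt[OF convex_element[OF K'(1)], of K] aff_dim_element[OF K(1)] aff_dim_element[OF K'(1)] by auto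
  qed
  then have lt: "aff_dim (K \<inter> K') < int CARD('n)"
    using face_of_aff_dim_lt[OF convex_element[OF K(1)] f1] aff_dim_element[OF K(1)] by auto
  have "e face_of (K \<inter> K')"
    using ef sub by (rule face_of_subset) blast
  moreover have "convex (K \<inter> K')" by (intro convex_Int convex_element K(1) K'(1))
  ultimately have e_eq: "e = K \<inter> K'"
    using face_of_aff_dim_lt[of "K \<inter> K'" e] lt edim by linarith
  then have "e facet_of K'"
    using f2 edim ene aff_dim_element[OF K'(1)] by (auto simp: facet_of_def)
  moreover have "\<not> e \<subseteq> frontier \<Omega>"
    using ye y(1) open_Omega by (auto simp: frontier_def interior_open)
  ultimately have "e \<in> interior_faces \<Omega> \<T>"
    using K K' e_eq unfolding interior_faces_def by blast
  then show False using e by blast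
qed

lemma element_integral_nested:
  fixes f :: "real^'n \<Rightarrow> real"
  assumes "K \<in> \<T>" "\<And>x. x \<in> interior K \<Longrightarrow> f x = 0"
  shows "(LINT x|lebesgue_on K. f x) = 0"
  using element_integral_cong(2)[OF assms(1), of "\<lambda>_. 0" f] assms(2) by simp

text \<open>Extends the pairing to functions that jump across faces, about which
  \<open>has_weak_div\<close> itself says nothing. The value is the same for every weak divergence
  of \<open>u\<close>.\<close>

lemma weak_div_inner:
  assumes div: "has_weak_div \<Omega> u g" and w: "pieces u w" and f: "spieces f p"
  shows "l2_inner \<Omega> g f = (\<Sum>K\<in>\<T>. LINT x|lebesgue_on K. divg (w K) x * p K x)"
proof -
  have g_int: "integrable (lebesgue_on K) g" if "K \<in> \<T>" for K
    by (rule integrable_element[OF L2_integrable[OF _ Omega_lmeasurable] that])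
       (use div in \<open>simp add: has_weak_div_def\<close>)
  have pC: "C1 (p K)" and fp: "\<And>x. x \<in> interior K \<Longrightarrow> f x = p K x" if "K \<in> \<T>" for K
    using f that by (auto simp: spieces_def)
  have wC: "C1v (w K)" and uw: "\<And>x. x \<in> interior K \<Longrightarrow> u x = w K x" if "K \<in> \<T>" for K
    using w that by (auto simp: pieces_def)
  have gp: "integrable (lebesgue_on K) (\<lambda>x. g x * p K x)" if "K \<in> \<T>" for K
    by (rule integrable_mult_continuous[OF compact_element[OF that] g_int[OF that] C1_continuous[OF pC[OF that]]])
  have b: "integrable (lebesgue_on K) (\<lambda>x. g x * f x)"
    "(LINT x|lebesgue_on K. g x * f x) = (LINT x|lebesgue_on K. divg (w K) x * p K x)" if "K \<in> \<T>" for K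
    using element_integral_cong[OF that gp[OF that], of "\<lambda>x. g x * f x"] fp[OF that]
      weak_div_element[OF div that wC[OF that] uw[OF that] pC[OF that]] by simp_all
  show ?thesis
    unfolding l2_inner_def inner_real_def by (subst Omega_integral_split(2)) (simp_all add: b)
qed

text \<open>The vanishing normal trace in elementwise form. Separate representatives
  \<open>\<psi> K\<close> admit test functions that are \<open>C1\<close> on \<open>\<Omega>\<close>
  but not across a slit.\<close>

lemma Green_test:
  assumes div: "has_weak_div \<Omega> u g" and tr: "normal_trace_zero \<Omega> u g" and w: "pieces u w"
    and \<phi>: "C1_with_grad \<Omega> \<phi> G" "L2 \<Omega> \<phi>" "L2 \<Omega> G"
    and \<psi>: "\<And>K. K \<in> \<T> \<Longrightarrow> C1 (\<psi> K)" "\<And>K x. K \<in> \<T> \<Longrightarrow> x \<in> interior K \<Longrightarrow> \<phi> x = \<psi> K x"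
      "\<And>K x. K \<in> \<T> \<Longrightarrow> x \<in> interior K \<Longrightarrow> G x = grad (\<psi> K) x"
  shows "(\<Sum>K\<in>\<T>. LINT x|lebesgue_on K. w K x \<bullet> grad (\<psi> K) x + \<psi> K x * divg (w K) x) = 0"
proof -
  have wC: "C1v (w K)" and uw: "\<And>x. x \<in> interior K \<Longrightarrow> u x = w K x" if "K \<in> \<T>" for K
    using w that by (auto simp: pieces_def)
  have c1: "continuous_on UNIV (\<lambda>x. w K x \<bullet> grad (\<psi> K) x)" if "K \<in> \<T>" for K
    by (intro continuous_intros C1v_continuous C1_grad_continuous wC \<psi> that)
  have c2: "continuous_on UNIV (\<lambda>x. divg (w K) x * \<psi> K x)" if "K \<in> \<T>" for K
    by (intro continuous_intros divg_continuous C1_continuous wC \<psi> that)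
  have a: "integrable (lebesgue_on K) (\<lambda>x. u x \<bullet> G x)"
    "(LINT x|lebesgue_on K. u x \<bullet> G x) = (LINT x|lebesgue_on K. w K x \<bullet> grad (\<psi> K) x)" if "K \<in> \<T>" for K
    using element_integral_cong[OF that element_integral_continuous(1)[OF that c1[OF that] refl], of "\<lambda>x. u x \<bullet> G x"]
      uw[OF that] \<psi>(3)[OF that] by simp_all
  have "0 = l2_inner \<Omega> u G + l2_inner \<Omega> g \<phi>"
    using tr \<phi> unfolding normal_trace_zero_def by simp
  also have "l2_inner \<Omega> u G = (\<Sum>K\<in>\<T>. LINT x|lebesgue_on K. w K x \<bullet> grad (\<psi> K) x)"
    unfolding l2_inner_def by (subst Omega_integral_split(2)) (simp_all add: a)
  also have "l2_inner \<Omega> g \<phi> = (\<Sum>K\<in>\<T>. LINT x|lebesgue_on K. divg (w K) x * \<psi> K x)"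
    using \<psi> by (intro weak_div_inner[OF div w]) (simp add: spieces_def)
  also have "(\<Sum>K\<in>\<T>. LINT x|lebesgue_on K. w K x \<bullet> grad (\<psi> K) x) + (\<Sum>K\<in>\<T>. LINT x|lebesgue_on K. divg (w K) x * \<psi> K x)
      = (\<Sum>K\<in>\<T>. LINT x|lebesgue_on K. w K x \<bullet> grad (\<psi> K) x + \<psi> K x * divg (w K) x)"
    unfolding sum.distrib[symmetric]
  proof (rule sum.cong[OF refl])
    fix K assume K: "K \<in> \<T>"
    show "(LINT x|lebesgue_on K. w K x \<bullet> grad (\<psi> K) x) + (LINT x|lebesgue_on K. divg (w K) x * \<psi> K x)
      = (LINT x|lebesgue_on K. w K x \<bullet> grad (\<psi> K) x + \<psi> K x * divg (w K) x)"
      using Bochner_Integration.integral_add[OF element_integral_continuous(1)[OF K c1[OF K] refl] element_integral_continuous(1)[OF K c2[OF K] refl]]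
      by (simp add: mult.commute)
  qed
  finally show ?thesis by simp
qed

lemma bounded_on_Omega:
  fixes f :: "real^'n \<Rightarrow> 'b::euclidean_space"
  assumes "continuous_on UNIV f"
  obtains B where "\<And>x. x \<in> \<Omega> \<Longrightarrow> norm (f x) \<le> B"
proof -
  have "compact (f ` closure \<Omega>)"
    using assms bounded_Omega by (intro compact_continuous_image continuous_on_subset[OF assms]) auto
  then have "bounded (f ` closure \<Omega>)" by (rule compact_imp_bounded)
  then show ?thesis
    using that closure_subset[of \<Omega>] unfolding bounded_iff by blast
qed

lemma facet_continuous_eq:
  assumes K: "K \<in> \<T>" "e facet_of K" and q: "continuous_on UNIV (q :: real^'n \<Rightarrow> real)"
    and zero: "\<And>x. x \<in> rel_interior e \<Longrightarrow> q x = 0" and x: "x \<in> e"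
  shows "q x = 0"
proof -
  have "closed {x. q x = 0}"
    using q by (intro closed_Collect_eq continuous_on_const)
  then have "closure (rel_interior e) \<subseteq> {x. q x = 0}"
    using zero by (intro closure_minimal) auto
  then show ?thesis
    using facet_rel_interior(3)[OF K] x by auto
qed

text \<open>The test function is the jump itself, localised by a bump. The two facet terms then
  combine to the integral of a weighted square, which forces the jump to vanish at the centre;
  continuity extends this from the relative interior to all of \<open>e\<close>.\<close>

lemma normal_jump_zero:
  assumes div: "has_weak_div \<Omega> u g" and tr: "normal_trace_zero \<Omega> u g" and w: "pieces u w"
    and e: "e \<in> interior_faces \<Omega> \<T>" and n: "unit_normal e (\<nu> e)" and x: "x \<in> e"
  shows "w (elem1 \<T> \<nu> e) x \<bullet> \<nu> e = w (elem2 \<T> \<nu> e) x \<bullet> \<nu> e"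
proof -
  define K1 K2 where "K1 = elem1 \<T> \<nu> e" and "K2 = elem2 \<T> \<nu> e"
  note elems = interior_face_elements[where \<nu> = \<nu>, OF e n, folded K1_def K2_def]
  have K1: "K1 \<in> \<T>" "e facet_of K1" and K2: "K2 \<in> \<T>" "e facet_of K2"
    using elems by auto
  define m where "m = \<nu> e"
  have m: "onormal K1 e m" "onormal K2 e (- m)" using elems by (auto simp: m_def)
  obtain c where c: "affine hull e = {y. y \<bullet> m = c}" "norm m = 1" using m(1) by (auto simp: onormal_def)
  have c': "affine hull e = {y. y \<bullet> (- m) = - c}" using c by simp
  have C1w: "C1v (w K1)" "C1v (w K2)" using w K1 K2 by (auto simp: pieces_def)
  define q where "q x = w K1 x \<bullet> m - w K2 x \<bullet> m" for x
  have C1q: "C1 q"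
    unfolding q_def inner_vec_def inner_real_def
    using C1w by (intro C1_diff C1_sum C1_mult C1_const) (auto simp: C1v_def)
  have "q x = 0" if x0: "x \<in> rel_interior e" for x
  proof -
    obtain \<delta>1 where \<delta>1: "\<delta>1 > 0" "\<forall>y\<in>cball x \<delta>1. (y \<in> interior K1 \<longleftrightarrow> y \<bullet> m < c) \<and> (y \<in> e \<longleftrightarrow> y \<bullet> m = c) \<and>
        (\<forall>e'. e' facet_of K1 \<longrightarrow> e' \<noteq> e \<longrightarrow> y \<notin> e')"
      using facet_local_structure[OF K1 m(1) c(1) x0] by (elim exE conjE)
    obtain \<delta>2 where \<delta>2: "\<delta>2 > 0" "\<forall>y\<in>cball x \<delta>2. (y \<in> interior K2 \<longleftrightarrow> y \<bullet> (- m) < - c) \<and> (y \<in> e \<longleftrightarrow> y \<bullet> (- m) = - c) \<and>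
        (\<forall>e'. e' facet_of K2 \<longrightarrow> e' \<noteq> e \<longrightarrow> y \<notin> e')"
      using facet_local_structure[OF K2 m(2) c' x0] by (elim exE conjE)
    define \<delta> where "\<delta> = min \<delta>1 \<delta>2"
    have \<delta>: "\<delta> > 0" using \<delta>1 \<delta>2 by (simp add: \<delta>_def)
    define S where "S = ball x \<delta>"
    have S1: "y \<in> cball x \<delta>1" and S2: "y \<in> cball x \<delta>2" if "y \<in> S" for y
      using that by (auto simp: S_def \<delta>_def)
    have far1: "y \<notin> e'" if "y \<in> S" "e' facet_of K1" "e' \<noteq> e" for y e'
      using bspec[OF \<delta>1(2) S1[OF that(1)]] that(2,3) by blast
    have far2: "y \<notin> e'" if "y \<in> S" "e' facet_of K2" "e' \<noteq> e" for y e'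
      using bspec[OF \<delta>2(2) S2[OF that(1)]] that(2,3) by blast
    define \<phi> where "\<phi> y = bump x \<delta> y * q y" for y
    have \<phi>: "C1 \<phi>" unfolding \<phi>_def by (intro C1_mult C1_bump C1q)
    have supp: "\<phi> y = 0" if "y \<notin> S" for y
      using bump_outside[of y x \<delta>] that \<delta> by (simp add: \<phi>_def S_def)
    \<comment> \<open>Off the plane of \<open>e\<close> the ball is filled by the interiors of
      \<open>K1\<close> and \<open>K2\<close>. The interior of a third element could meet the ball
      only within that plane, impossible for a nonempty open set.\<close>
    have other: "interior K \<inter> S = {}" if K: "K \<in> \<T>" "K \<noteq> K1" "K \<noteq> K2" for K
    proof (rule ccontr)
      assume ne: "interior K \<inter> S \<noteq> {}"
      have "open (interior K \<inter> S)" by (simp add: S_def open_Int)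
      then have "\<not> negligible (interior K \<inter> S)" using ne open_not_negligible by blast
      moreover have "negligible {y. m \<bullet> y = c}" using c(2) by (intro negligible_hyperplane) auto
      ultimately obtain y where y: "y \<in> interior K" "y \<in> S" "y \<bullet> m \<noteq> c"
        using negligible_subset[of "{y. m \<bullet> y = c}" "interior K \<inter> S"] by (auto simp: inner_commute)
      then have "y \<in> interior K1 \<or> y \<in> interior K2"
        using bspec[OF \<delta>1(2) S1[OF y(2)]] bspec[OF \<delta>2(2) S2[OF y(2)]] by (auto simp: neq_iff)
      then show False
        using y(1) interior_disjoint[OF K(1) K1(1) K(2)] interior_disjoint[OF K(1) K2(1) K(3)] by blast
    qed
    define I where "I K = (LINT y|lebesgue_on K. w K y \<bullet> grad \<phi> y + \<phi> y * divg (w K) y)" for K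
    have "(\<Sum>K\<in>\<T>. I K) = 0"
      unfolding I_def
    proof (rule Green_test[OF div tr w, of \<phi> "grad \<phi>" "\<lambda>_. \<phi>"])
      show "C1_with_grad \<Omega> \<phi> (grad \<phi>)"
        using C1_grad[OF \<phi>] C1_grad_continuous[OF \<phi>] by (auto simp: C1_with_grad_def)
      show "L2 \<Omega> \<phi>"
        by (rule bounded_on_Omega[OF C1_continuous[OF \<phi>]]) (rule L2_bounded[OF Omega_lmeasurable C1_continuous[OF \<phi>]])
      show "L2 \<Omega> (grad \<phi>)"
        by (rule bounded_on_Omega[OF C1_grad_continuous[OF \<phi>]]) (rule L2_bounded[OF Omega_lmeasurable C1_grad_continuous[OF \<phi>]])
    qed (simp_all add: \<phi>)
    moreover have "I K = 0" if "K \<in> \<T> - {K1, K2}" for K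
      unfolding I_def
    proof (rule element_integral_nested)
      show "K \<in> \<T>" using that by blast
      fix y assume y: "y \<in> interior K"
      have ns: "interior K \<inter> S = {}" using other that by blast
      have "grad \<phi> y = 0"
        by (rule grad_zero_open[OF \<phi> open_interior y]) (use ns supp in blast)
      moreover have "\<phi> y = 0" using ns y supp by blast
      ultimately show "w K y \<bullet> grad \<phi> y + \<phi> y * divg (w K) y = 0" by simp
    qed
    then have "(\<Sum>K\<in>\<T>. I K) = (\<Sum>K\<in>{K1, K2}. I K)"
      using finite_T K1 K2 by (intro sum.mono_neutral_right) auto
    moreover have "K1 \<noteq> K2" using elems by simp
    ultimately have "I K1 + I K2 = 0" by simp
    moreover have "I K1 = (LINT y|face_measure e. \<phi> y * (w K1 y \<bullet> m))"
      unfolding I_def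
      by (rule facet_Green_local[OF K1 m(1) \<phi> supp C1w(1) far1])
    moreover have "I K2 = (LINT y|face_measure e. \<phi> y * (w K2 y \<bullet> (- m)))"
      unfolding I_def
      by (rule facet_Green_local[OF K2 m(2) \<phi> supp C1w(2) far2])
    moreover have i1: "integrable (face_measure e) (\<lambda>y. \<phi> y * (w K1 y \<bullet> m))"
      by (rule face_integral(1)[OF c(2) facet_compact[OF K1] c(1) _ refl])
         (intro continuous_intros C1_continuous[OF \<phi>] C1v_continuous C1w)
    moreover have i2: "integrable (face_measure e) (\<lambda>y. \<phi> y * (w K2 y \<bullet> (- m)))"
      by (rule face_integral(1)[OF c(2) facet_compact[OF K1] c(1) _ refl])
         (intro continuous_intros C1_continuous[OF \<phi>] C1v_continuous C1w)
    ultimately have "(LINT y|face_measure e. \<phi> y * (w K1 y \<bullet> m) + \<phi> y * (w K2 y \<bullet> (- m))) = 0"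
      by simp
    moreover have "\<phi> y * (w K1 y \<bullet> m) + \<phi> y * (w K2 y \<bullet> (- m)) = bump x \<delta> y * (q y)\<^sup>2" for y
      by (simp add: \<phi>_def q_def power2_eq_square algebra_simps)
    ultimately have zero: "(LINT y|face_measure e. bump x \<delta> y * (q y)\<^sup>2) = 0" by simp
    have "bump x \<delta> x * (q x)\<^sup>2 = 0"
    proof (rule face_integral_pos[OF c(2) facet_compact[OF K1] c(1) _ _ zero _ \<delta>])
      show "continuous_on UNIV (\<lambda>y. bump x \<delta> y * (q y)\<^sup>2)"
        by (intro continuous_intros C1_continuous C1_bump C1q)
      show "x \<in> e" using x0 rel_interior_subset by blast
      show "y \<in> e" if "y \<in> ball x \<delta>" "y \<bullet> m = c" for y
        using bspec[OF \<delta>1(2) S1[of y]] that by (simp add: S_def)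
    qed (simp add: bump_nonneg)
    then show "q x = 0" using bump_center[OF \<delta>, of x] by simp
  qed
  from facet_continuous_eq[OF K1 C1_continuous[OF C1q] this x]
  show ?thesis by (simp add: q_def K1_def K2_def m_def)
qed

text \<open>Again a localised square, with the normal component in place of the jump. As
  \<open>e\<close> misses \<open>\<Omega>\<close>, the test function can be cut off across
  \<open>e\<close>, and only the side of \<open>K\<close> contributes.\<close>

lemma boundary_normal_zero:
  assumes div: "has_weak_div \<Omega> u g" and tr: "normal_trace_zero \<Omega> u g" and w: "pieces u w"
    and K: "K \<in> \<T>" "e facet_of K" and e: "e \<notin> interior_faces \<Omega> \<T>" and m: "onormal K e m" and x: "x \<in> e"
  shows "w K x \<bullet> m = 0"
proof -
  obtain c where c: "affine hull e = {y. y \<bullet> m = c}" "norm m = 1" using m by (auto simp: onormal_def)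
  have C1w: "C1v (w K)" using w K by (auto simp: pieces_def)
  define q where "q x = w K x \<bullet> m" for x
  have C1q: "C1 q"
    unfolding q_def inner_vec_def inner_real_def
    using C1w by (intro C1_sum C1_mult C1_const) (auto simp: C1v_def)
  have "q x = 0" if x0: "x \<in> rel_interior e" for x
  proof -
    obtain \<delta> where \<delta>: "\<delta> > 0" "\<forall>y\<in>cball x \<delta>. (y \<in> interior K \<longleftrightarrow> y \<bullet> m < c) \<and> (y \<in> e \<longleftrightarrow> y \<bullet> m = c) \<and>
        (\<forall>e'. e' facet_of K \<longrightarrow> e' \<noteq> e \<longrightarrow> y \<notin> e')"
      using facet_local_structure[OF K m c(1) x0] by (elim exE conjE)
    \<comment> \<open>A closed ball, since \<open>C1_with_grad_piece\<close> asks for a closed set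
      containing the support.\<close>
    define S where "S = cball x \<delta>"
    have far: "y \<notin> e'" if "y \<in> S" "e' facet_of K" "e' \<noteq> e" for y e'
      using bspec[OF \<delta>(2) that(1)[unfolded S_def]] that(2,3) by blast
    define \<phi> where "\<phi> y = bump x \<delta> y * q y" for y
    have \<phi>: "C1 \<phi>" unfolding \<phi>_def by (intro C1_mult C1_bump C1q)
    have supp: "\<phi> y = 0" if "y \<notin> S" for y
      using bump_outside[of y x \<delta>] that \<delta>(1) by (auto simp: \<phi>_def S_def)
    have closed_S: "closed S" by (simp add: S_def)
    have gsupp: "grad \<phi> y = 0" if "y \<notin> S" for y
      by (rule grad_zero_open[OF \<phi>, of "- S"]) (use that supp closed_S in auto)
    have plane: "y \<bullet> m \<noteq> c" if "y \<in> \<Omega>" "y \<in> S" for y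
      using bspec[OF \<delta>(2), of y] that boundary_facet[OF K e] by (auto simp: S_def)
    note test = C1_with_grad_piece[OF \<phi> supp closed_S plane open_Omega]
    \<comment> \<open>Within the ball, the side kept by the truncation is the interior of
      \<open>K\<close>; on every other element the truncated function vanishes.\<close>
    define \<psi> where "\<psi> L = (if L = K then \<phi> else (\<lambda>_. 0))" for L :: "(real^'n) set"
    define I where "I L = (LINT y|lebesgue_on L. w L y \<bullet> grad (\<psi> L) y + \<psi> L y * divg (w L) y)" for L
    have cases: "(y \<notin> S) \<or> (y \<in> S \<and> (y \<bullet> m < c \<longleftrightarrow> L = K))" if "L \<in> \<T>" "y \<in> interior L" for L y
      using bspec[OF \<delta>(2), of y] that interior_disjoint[OF that(1) K(1)] by (auto simp: S_def)
    have "(\<Sum>L\<in>\<T>. I L) = 0"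
      unfolding I_def
    proof (rule Green_test[OF div tr w test])
      obtain B where B: "\<And>y. y \<in> \<Omega> \<Longrightarrow> norm (\<phi> y) \<le> B" using bounded_on_Omega[OF C1_continuous[OF \<phi>]] by blast
      show "L2 \<Omega> (\<lambda>y. if y \<bullet> m < c then \<phi> y else 0)"
        by (rule L2_bounded[OF Omega_lmeasurable C1_with_grad_imp_continuous[OF test], of "\<bar>B\<bar>"])
           (use B in \<open>auto intro: order_trans[OF _ abs_ge_self]\<close>)
      obtain B' where B': "\<And>y. y \<in> \<Omega> \<Longrightarrow> norm (grad \<phi> y) \<le> B'" using bounded_on_Omega[OF C1_grad_continuous[OF \<phi>]] by blast
      show "L2 \<Omega> (\<lambda>y. if y \<bullet> m < c then grad \<phi> y else 0)"
        by (rule L2_bounded[OF Omega_lmeasurable, of _ "\<bar>B'\<bar>"])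
           (use B' test in \<open>auto intro: order_trans[OF _ abs_ge_self] simp: C1_with_grad_def\<close>)
      show "C1 (\<psi> L)" for L by (simp add: \<psi>_def \<phi>)
      show "(if y \<bullet> m < c then \<phi> y else 0) = \<psi> L y" if "L \<in> \<T>" "y \<in> interior L" for L y
        using cases[OF that] supp[of y] by (auto simp: \<psi>_def)
      show "(if y \<bullet> m < c then grad \<phi> y else 0) = grad (\<psi> L) y" if "L \<in> \<T>" "y \<in> interior L" for L y
        using cases[OF that] gsupp[of y] by (auto simp: \<psi>_def)
    qed
    moreover have "I L = 0" if "L \<in> \<T> - {K}" for L
      using that by (simp add: I_def \<psi>_def)
    then have "(\<Sum>L\<in>\<T>. I L) = (\<Sum>L\<in>{K}. I L)"
      using finite_T K by (intro sum.mono_neutral_right) auto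
    ultimately have "I K = 0" by simp
    moreover have "I K = (LINT y|face_measure e. \<phi> y * (w K y \<bullet> m))"
      unfolding I_def \<psi>_def if_P[OF refl]
      by (rule facet_Green_local[OF K m \<phi> supp C1w far])
    moreover have "\<phi> y * (w K y \<bullet> m) = bump x \<delta> y * (q y)\<^sup>2" for y
      by (simp add: \<phi>_def q_def power2_eq_square)
    ultimately have zero: "(LINT y|face_measure e. bump x \<delta> y * (q y)\<^sup>2) = 0" by simp
    have "bump x \<delta> x * (q x)\<^sup>2 = 0"
    proof (rule face_integral_pos[OF c(2) facet_compact[OF K] c(1) _ _ zero _ \<delta>(1)])
      show "continuous_on UNIV (\<lambda>y. bump x \<delta> y * (q y)\<^sup>2)"
        by (intro continuous_intros C1_continuous C1_bump C1q)
      show "x \<in> e" using x0 rel_interior_subset by blast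
      show "y \<in> e" if "y \<in> ball x \<delta>" "y \<bullet> m = c" for y
        using bspec[OF \<delta>(2), of y] that by simp
    qed (simp add: bump_nonneg)
    then show "q x = 0" using bump_center[OF \<delta>(1), of x] by simp
  qed
  from facet_continuous_eq[OF K C1_continuous[OF C1q] this x]
  show ?thesis by (simp add: q_def)
qed

end

lemma face_integral_cong:
  fixes f g :: "real^'n::finite \<Rightarrow> real"
  assumes n: "norm n = 1" and e: "compact e" "affine hull e = {y. y \<bullet> n = c}"
    and g: "continuous_on UNIV g" and fg: "\<And>x. x \<in> e \<Longrightarrow> f x = g x"
  shows "(LINT x|face_measure e. f x) = (LINT x|face_measure e. g x)"
  using face_integral(2)[OF n e g fg] face_integral(2)[OF n e g refl] by simp

section \<open>The elementwise Green formula and the transport form\<close>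

context mesh
begin

definition outer :: "(real^'n) set \<Rightarrow> (real^'n) set \<Rightarrow> real^'n" where
  "outer K e = (SOME n. onormal K e n)"

lemma outer: "K \<in> \<T> \<Longrightarrow> e facet_of K \<Longrightarrow> onormal K e (outer K e)"
  unfolding outer_def using onormal_exists by (rule someI_ex)

lemma outer_eq: "K \<in> \<T> \<Longrightarrow> e facet_of K \<Longrightarrow> onormal K e n \<Longrightarrow> outer K e = n"
  using onormal_unique outer by blast

text \<open>Indexing by facets instead of vertices allows the contributions of neighbouring elements
  to be collected at their common facet.\<close>

lemma element_Green:
  assumes K: "K \<in> \<T>" and \<phi>: "C1 \<phi>" and w: "C1v w"
  shows "finite {e. e facet_of K}"
    "(LINT x|lebesgue_on K. w x \<bullet> grad \<phi> x + \<phi> x * divg w x)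
     = (\<Sum>e\<in>{e. e facet_of K}. LINT x|face_measure e. \<phi> x * (w x \<bullet> outer K e))"
proof -
  obtain C \<nu> c h where frame: "simplex_frame C \<nu> c h" and K_eq: "K = convex hull C"
    using K by (rule simplex_obtain)
  interpret simplex_frame C \<nu> c h by (rule frame)
  have facets: "{e. e facet_of K} = facet ` C"
    using facet_of_iff unfolding K_eq by blast
  then show "finite {e. e facet_of K}" using finite_C by simp
  have outer_facet: "outer K (facet a) = \<nu> a" if "a \<in> C" for a
  proof (rule outer_eq[OF K])
    show "facet a facet_of K" using facets that by blast
    show "onormal K (facet a) (\<nu> a)" using onormal_facet[OF that] by (simp add: K_eq)
  qed
  have "(LINT x|lebesgue_on K. w x \<bullet> grad \<phi> x + \<phi> x * divg w x)
      = (LINT x|lborel. indicator K x * (w x \<bullet> grad \<phi> x + \<phi> x * divg w x))"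
    by (rule element_integral_continuous(2)[OF K _ refl])
       (intro continuous_intros divg_continuous w C1v_continuous C1_grad_continuous C1_continuous \<phi>)
  also have "\<dots> = (\<Sum>a\<in>C. LINT x|face_measure (facet a). \<phi> x * (w x \<bullet> \<nu> a))"
    unfolding K_eq by (rule Green_formula[OF \<phi> w])
  also have "\<dots> = (\<Sum>e\<in>{e. e facet_of K}. LINT x|face_measure e. \<phi> x * (w x \<bullet> outer K e))"
    unfolding facets by (subst sum.reindex[OF inj_facet]) (simp add: outer_facet)
  finally show "(LINT x|lebesgue_on K. w x \<bullet> grad \<phi> x + \<phi> x * divg w x)
     = (\<Sum>e\<in>{e. e facet_of K}. LINT x|face_measure e. \<phi> x * (w x \<bullet> outer K e))" .
qed

text \<open>The boundary terms of all elements are sorted by facet. The normal component vanishes on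
  boundary facets, and at an interior face its common value can be factored out of the two
  contributions.\<close>

lemma piecewise_Green:
  assumes div: "has_weak_div \<Omega> u g" and tr: "normal_trace_zero \<Omega> u g" and w: "pieces u w"
    and normals: "\<forall>e\<in>interior_faces \<Omega> \<T>. unit_normal e (\<nu> e)"
    and \<psi>: "\<And>K. K \<in> \<T> \<Longrightarrow> C1 (\<psi> K)"
  shows "(\<Sum>K\<in>\<T>. LINT x|lebesgue_on K. w K x \<bullet> grad (\<psi> K) x + \<psi> K x * divg (w K) x)
    = (\<Sum>e\<in>interior_faces \<Omega> \<T>. LINT x|face_measure e.
        (w (elem1 \<T> \<nu> e) x \<bullet> \<nu> e) * (\<psi> (elem1 \<T> \<nu> e) x - \<psi> (elem2 \<T> \<nu> e) x))"
proof -
  define F where "F = (\<Union>K\<in>\<T>. {e. e facet_of K})"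
  define f where "f K e = (LINT x|face_measure e. \<psi> K x * (w K x \<bullet> outer K e))" for K e
  have wC: "C1v (w K)" if "K \<in> \<T>" for K using w that by (auto simp: pieces_def)
  have finF: "finite F"
    unfolding F_def using finite_T element_Green(1)[OF _ \<psi> wC] by blast
  have EF: "interior_faces \<Omega> \<T> \<subseteq> F"
    unfolding F_def interior_faces_def by blast
  have "(\<Sum>K\<in>\<T>. LINT x|lebesgue_on K. w K x \<bullet> grad (\<psi> K) x + \<psi> K x * divg (w K) x)
      = (\<Sum>K\<in>\<T>. \<Sum>e\<in>{e \<in> F. e facet_of K}. f K e)"
  proof (rule sum.cong[OF refl])
    fix K assume K: "K \<in> \<T>"
    have "{e \<in> F. e facet_of K} = {e. e facet_of K}" using K by (auto simp: F_def)
    then show "(LINT x|lebesgue_on K. w K x \<bullet> grad (\<psi> K) x + \<psi> K x * divg (w K) x) = (\<Sum>e\<in>{e \<in> F. e facet_of K}. f K e)"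
      unfolding f_def by (simp add: element_Green(2)[OF K \<psi>[OF K] wC[OF K]])
  qed
  also have "\<dots> = (\<Sum>e\<in>F. \<Sum>K\<in>{K \<in> \<T>. e facet_of K}. f K e)"
    by (rule sum.swap_restrict[OF finite_T finF])
  also have "\<dots> = (\<Sum>e\<in>interior_faces \<Omega> \<T>. \<Sum>K\<in>{K \<in> \<T>. e facet_of K}. f K e)"
  proof (rule sum.mono_neutral_right[OF finF EF], rule ballI, rule sum.neutral, rule ballI)
    fix e K assume e: "e \<in> F - interior_faces \<Omega> \<T>" and "K \<in> {K \<in> \<T>. e facet_of K}"
    then have K: "K \<in> \<T>" "e facet_of K" by auto
    obtain c where c: "affine hull e = {y. y \<bullet> outer K e = c}" "norm (outer K e) = 1"
      using outer[OF K] by (auto simp: onormal_def)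
    show "f K e = 0"
      unfolding f_def
      by (rule face_integral_zero[OF c(2) facet_compact[OF K] c(1)])
         (use boundary_normal_zero[OF div tr w K _ outer[OF K]] e in simp)
  qed
  also have "\<dots> = (\<Sum>e\<in>interior_faces \<Omega> \<T>. LINT x|face_measure e.
        (w (elem1 \<T> \<nu> e) x \<bullet> \<nu> e) * (\<psi> (elem1 \<T> \<nu> e) x - \<psi> (elem2 \<T> \<nu> e) x))"
  proof (rule sum.cong[OF refl])
    fix e assume e: "e \<in> interior_faces \<Omega> \<T>"
    have n: "unit_normal e (\<nu> e)" using normals e by blast
    define K1 K2 where "K1 = elem1 \<T> \<nu> e" and "K2 = elem2 \<T> \<nu> e"
    note elems = interior_face_elements[where \<nu> = \<nu>, OF e n, folded K1_def K2_def]
    have K1: "K1 \<in> \<T>" "e facet_of K1" and K2: "K2 \<in> \<T>" "e facet_of K2"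
      using elems by auto
    obtain c where c: "affine hull e = {y. y \<bullet> \<nu> e = c}" "norm (\<nu> e) = 1"
      using elems by (auto simp: onormal_def)
    have o: "outer K1 e = \<nu> e" "outer K2 e = - \<nu> e"
      using outer_eq K1 K2 elems by auto
    have i: "integrable (face_measure e) (\<lambda>x. \<psi> K x * (w K x \<bullet> \<nu> e))" if "K \<in> \<T>" for K
      by (rule face_integral(1)[OF c(2) facet_compact[OF K1] c(1) _ refl])
         (intro continuous_intros C1_continuous C1v_continuous \<psi> wC that)
    have "(\<Sum>K\<in>{K \<in> \<T>. e facet_of K}. f K e) = f K1 e + f K2 e"
      using elems by simp
    also have "\<dots> = (LINT x|face_measure e. \<psi> K1 x * (w K1 x \<bullet> \<nu> e) - \<psi> K2 x * (w K2 x \<bullet> \<nu> e))"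
      using i[OF K1(1)] i[OF K2(1)] by (simp add: f_def o)
    also have "\<dots> = (LINT x|face_measure e. (w K1 x \<bullet> \<nu> e) * (\<psi> K1 x - \<psi> K2 x))"
    proof (rule face_integral_cong[OF c(2) facet_compact[OF K1] c(1)])
      show "continuous_on UNIV (\<lambda>x. (w K1 x \<bullet> \<nu> e) * (\<psi> K1 x - \<psi> K2 x))"
        by (intro continuous_intros C1_continuous C1v_continuous \<psi> wC K1 K2)
      show "\<psi> K1 x * (w K1 x \<bullet> \<nu> e) - \<psi> K2 x * (w K2 x \<bullet> \<nu> e) = (w K1 x \<bullet> \<nu> e) * (\<psi> K1 x - \<psi> K2 x)" if "x \<in> e" for x
        using normal_jump_zero[where \<nu> = \<nu>, OF div tr w e n that, folded K1_def K2_def] by (simp add: algebra_simps)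
    qed
    finally show "(\<Sum>K\<in>{K \<in> \<T>. e facet_of K}. f K e) = (LINT x|face_measure e.
        (w (elem1 \<T> \<nu> e) x \<bullet> \<nu> e) * (\<psi> (elem1 \<T> \<nu> e) x - \<psi> (elem2 \<T> \<nu> e) x))"
      by (simp add: K1_def K2_def)
  qed
  finally show ?thesis .
qed

text \<open>Each point of \<open>K\<close> is a limit point of the interior of \<open>K\<close>, by
  convexity, so the limit that defines the trace is unique.\<close>

lemma face_trace_eq:
  fixes f g :: "real^'n \<Rightarrow> 'b::t2_space"
  assumes K: "K \<in> \<T>" and fg: "\<And>x. x \<in> interior K \<Longrightarrow> f x = g x" and g: "continuous_on UNIV g" and x: "x \<in> K"
  shows "face_trace K f x = g x"
proof -
  have "closure (interior K) = closure K"
    using convex_closure_interior[OF convex_element[OF K] interior_element_nonempty[OF K]] .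
  then have "x \<in> closure (interior K)" using x closure_subset by auto
  then have "x islimpt interior K"
    using interior_limit_point[of x "interior K"] by (auto simp: closure_def)
  then have nontriv: "\<not> trivial_limit (at x within interior K)"
    by (simp add: trivial_limit_within)
  have "(g \<longlongrightarrow> g x) (at x)"
    using g by (simp add: continuous_on_def)
  then have "(g \<longlongrightarrow> g x) (at x within interior K)"
    by (rule tendsto_within_subset) simp
  then have "(f \<longlongrightarrow> g x) (at x within interior K)"
    by (rule Lim_transform_eventually) (auto simp: eventually_at_filter fg)
  then show ?thesis
    unfolding face_trace_def using nontriv by (intro tendsto_Lim)
qed

lemma frechet_derivative_interior:
  assumes "C1 p" "\<And>y. y \<in> interior K \<Longrightarrow> f y = p y" "x \<in> interior K"
  shows "frechet_derivative f (at x) v = v \<bullet> grad p x"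
proof -
  have "(f has_derivative (\<lambda>v. v \<bullet> grad p x)) (at x)"
    by (rule has_derivative_transform_within_open[OF C1_has_derivative[OF assms(1)] open_interior[of K]])
       (use assms in auto)
  from frechet_derivative_at[OF this] show ?thesis by metis
qed

lemma jump_scalar_const:
  assumes "e \<in> interior_faces \<Omega> \<T>" "unit_normal e (\<nu> e)" "x \<in> e"
  shows "jump_scalar \<T> \<nu> e (\<lambda>x. k) x = 0"
proof -
  note elems = interior_face_elements[where \<nu> = \<nu>, OF assms(1,2)]
  have K1: "elem1 \<T> \<nu> e \<in> \<T>" "e facet_of elem1 \<T> \<nu> e" and K2: "elem2 \<T> \<nu> e \<in> \<T>" "e facet_of elem2 \<T> \<nu> e"
    using elems by auto
  have x: "x \<in> elem1 \<T> \<nu> e" "x \<in> elem2 \<T> \<nu> e"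
    using assms(3) facet_of_imp_subset[OF K1(2)] facet_of_imp_subset[OF K2(2)] by blast+
  show ?thesis
    using face_trace_eq[OF K1(1) refl continuous_on_const x(1), of k] face_trace_eq[OF K2(1) refl continuous_on_const x(2), of k]
    by (simp add: jump_scalar_def)
qed

lemma interior_face_plane:
  assumes "e \<in> interior_faces \<Omega> \<T>" "unit_normal e (\<nu> e)"
  obtains c where "norm (\<nu> e) = 1" "compact e" "affine hull e = {y. y \<bullet> \<nu> e = c}"
proof -
  note elems = interior_face_elements[where \<nu> = \<nu>, OF assms]
  have "elem1 \<T> \<nu> e \<in> \<T>" "e facet_of elem1 \<T> \<nu> e" using elems by auto
  then have "compact e" by (rule facet_compact)
  then show ?thesis using elems(5) that by (auto simp: onormal_def)
qed

lemma b_form_const: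
  assumes normals: "\<forall>e\<in>interior_faces \<Omega> \<T>. unit_normal e (\<nu> e)"
  shows "b_form \<Omega> \<T> \<nu> u (\<lambda>x. k) f = 0"
proof -
  have "(LINT x|face_measure e. (face_trace (elem1 \<T> \<nu> e) u x \<bullet> jump_scalar \<T> \<nu> e (\<lambda>x. k) x) * avg \<T> \<nu> e f x) = 0"
    if e: "e \<in> interior_faces \<Omega> \<T>" for e
  proof -
    have n: "unit_normal e (\<nu> e)" using normals e by blast
    obtain c where c: "norm (\<nu> e) = 1" "compact e" "affine hull e = {y. y \<bullet> \<nu> e = c}"
      using interior_face_plane[where \<nu> = \<nu>, OF e n] by blast
    show ?thesis
      by (rule face_integral_zero[OF c]) (simp add: jump_scalar_const[where \<nu> = \<nu>, OF e n])
  qed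
  then show ?thesis
    by (simp add: b_form_def)
qed

text \<open>With \<open>\<psi>\<close> half the square of \<open>f\<close>, the form becomes the two
  sides of \<open>piecewise_Green\<close> subtracted from each other; the divergence term in the
  volume integrals is zero.\<close>

lemma b_form_self:
  assumes div: "has_weak_div \<Omega> u g" and tr: "normal_trace_zero \<Omega> u g" and w: "pieces u w"
    and normals: "\<forall>e\<in>interior_faces \<Omega> \<T>. unit_normal e (\<nu> e)"
    and div_free: "\<And>K x. K \<in> \<T> \<Longrightarrow> x \<in> interior K \<Longrightarrow> divg (w K) x = 0" and f: "spieces f p"
  shows "b_form \<Omega> \<T> \<nu> u f f = 0"
proof -
  have wC: "C1v (w K)" and uw: "\<And>x. x \<in> interior K \<Longrightarrow> u x = w K x" if "K \<in> \<T>" for K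
    using w that by (auto simp: pieces_def)
  have pC: "C1 (p K)" and fp: "\<And>x. x \<in> interior K \<Longrightarrow> f x = p K x" if "K \<in> \<T>" for K
    using f that by (auto simp: spieces_def)
  define \<psi> where "\<psi> K x = (1/2) * (p K x * p K x)" for K x
  have \<psi>C: "C1 (\<psi> K)" if "K \<in> \<T>" for K
    unfolding \<psi>_def by (intro C1_mult C1_const pC that)
  have grad_\<psi>: "grad (\<psi> K) x = p K x *\<^sub>R grad (p K) x" if "K \<in> \<T>" for K x
    unfolding \<psi>_def grad_mult[OF C1_const C1_mult[OF pC[OF that] pC[OF that]]] grad_mult[OF pC[OF that] pC[OF that]]
    by (simp add: scaleR_add_left[symmetric] scaleR_add_right)
  have vol: "(LINT x|lebesgue_on K. frechet_derivative f (at x) (u x) * f x)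
      = (LINT x|lebesgue_on K. w K x \<bullet> grad (\<psi> K) x + \<psi> K x * divg (w K) x)" if K: "K \<in> \<T>" for K
  proof (rule element_integral_cong(2)[OF K])
    show "integrable (lebesgue_on K) (\<lambda>x. w K x \<bullet> grad (\<psi> K) x + \<psi> K x * divg (w K) x)"
      by (rule element_integral_continuous(1)[OF K _ refl])
         (intro continuous_intros divg_continuous wC K C1v_continuous C1_grad_continuous C1_continuous \<psi>C)
    show "frechet_derivative f (at x) (u x) * f x = w K x \<bullet> grad (\<psi> K) x + \<psi> K x * divg (w K) x" if x: "x \<in> interior K" for x
      by (simp add: frechet_derivative_interior[OF pC[OF K] fp[OF K] x] uw[OF K x] fp[OF K x] grad_\<psi>[OF K] div_free[OF K x])
  qed
  have face: "(LINT x|face_measure e. (face_trace (elem1 \<T> \<nu> e) u x \<bullet> jump_scalar \<T> \<nu> e f x) * avg \<T> \<nu> e f x)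
    = (LINT x|face_measure e. (w (elem1 \<T> \<nu> e) x \<bullet> \<nu> e) * (\<psi> (elem1 \<T> \<nu> e) x - \<psi> (elem2 \<T> \<nu> e) x))"
    if e: "e \<in> interior_faces \<Omega> \<T>" for e
  proof -
    have n: "unit_normal e (\<nu> e)" using normals e by blast
    note elems = interior_face_elements[where \<nu> = \<nu>, OF e n]
    have K1: "elem1 \<T> \<nu> e \<in> \<T>" "e facet_of elem1 \<T> \<nu> e" and K2: "elem2 \<T> \<nu> e \<in> \<T>" "e facet_of elem2 \<T> \<nu> e"
      using elems by auto
    obtain c where c: "affine hull e = {y. y \<bullet> \<nu> e = c}" "norm (\<nu> e) = 1"
      using elems by (auto simp: onormal_def)
    show ?thesis
    proof (rule face_integral_cong[OF c(2) facet_compact[OF K1] c(1)])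
      show "continuous_on UNIV (\<lambda>x. (w (elem1 \<T> \<nu> e) x \<bullet> \<nu> e) * (\<psi> (elem1 \<T> \<nu> e) x - \<psi> (elem2 \<T> \<nu> e) x))"
        by (intro continuous_intros C1_continuous C1v_continuous \<psi>C wC K1 K2)
      fix x assume "x \<in> e"
      then have x: "x \<in> elem1 \<T> \<nu> e" "x \<in> elem2 \<T> \<nu> e"
        using K1 K2 facet_of_imp_subset by blast+
      have "face_trace (elem1 \<T> \<nu> e) u x = w (elem1 \<T> \<nu> e) x"
        by (rule face_trace_eq[OF K1(1) uw[OF K1(1)] C1v_continuous[OF wC[OF K1(1)]] x(1)])
      moreover have "face_trace (elem1 \<T> \<nu> e) f x = p (elem1 \<T> \<nu> e) x"
        by (rule face_trace_eq[OF K1(1) fp[OF K1(1)] C1_continuous[OF pC[OF K1(1)]] x(1)])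
      moreover have "face_trace (elem2 \<T> \<nu> e) f x = p (elem2 \<T> \<nu> e) x"
        by (rule face_trace_eq[OF K2(1) fp[OF K2(1)] C1_continuous[OF pC[OF K2(1)]] x(2)])
      ultimately show "(face_trace (elem1 \<T> \<nu> e) u x \<bullet> jump_scalar \<T> \<nu> e f x) * avg \<T> \<nu> e f x
        = (w (elem1 \<T> \<nu> e) x \<bullet> \<nu> e) * (\<psi> (elem1 \<T> \<nu> e) x - \<psi> (elem2 \<T> \<nu> e) x)"
        by (simp add: jump_scalar_def avg_def \<psi>_def inner_diff_right algebra_simps)
    qed
  qed
  show ?thesis
    using piecewise_Green[OF div tr w normals \<psi>C] vol face by (simp add: b_form_def)
qed

end

section \<open>Piecewise polynomials\<close>

definition monomial :: "('n::finite \<Rightarrow> nat) \<Rightarrow> real^'n \<Rightarrow> real" where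
  "monomial a x = (\<Prod>i\<in>UNIV. (x $ i) ^ a i)"

lemma finite_exponents: "finite {a :: 'n::finite \<Rightarrow> nat. (\<Sum>i\<in>UNIV. a i) \<le> r}"
proof (rule finite_subset)
  show "finite (PiE UNIV (\<lambda>_::'n. {..r}))" by (intro finite_PiE) auto
  show "{a :: 'n \<Rightarrow> nat. (\<Sum>i\<in>UNIV. a i) \<le> r} \<subseteq> PiE UNIV (\<lambda>_::'n. {..r})"
  proof
    fix a :: "'n \<Rightarrow> nat" assume a: "a \<in> {a. (\<Sum>i\<in>UNIV. a i) \<le> r}"
    have "a i \<le> (\<Sum>i\<in>UNIV. a i)" for i by (rule member_le_sum) auto
    then show "a \<in> PiE UNIV (\<lambda>_::'n. {..r})" using a by (auto intro: order_trans)
  qed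
qed

lemma Poly_iff: "p \<in> Poly r \<longleftrightarrow> (\<exists>c. p = (\<lambda>x. \<Sum>a\<in>{a. (\<Sum>i\<in>UNIV. a i) \<le> r}. c a * monomial a x))"
  by (simp add: Poly_def monomial_def)

lemma Poly_add: "p \<in> Poly r \<Longrightarrow> q \<in> Poly r \<Longrightarrow> (\<lambda>x. p x + q x) \<in> Poly r"
proof -
  assume "p \<in> Poly r" "q \<in> Poly r"
  then obtain c d where "p = (\<lambda>x. \<Sum>a\<in>{a. (\<Sum>i\<in>UNIV. a i) \<le> r}. c a * monomial a x)"
    "q = (\<lambda>x. \<Sum>a\<in>{a. (\<Sum>i\<in>UNIV. a i) \<le> r}. d a * monomial a x)"
    by (auto simp: Poly_iff)
  then have "(\<lambda>x. p x + q x) = (\<lambda>x. \<Sum>a\<in>{a. (\<Sum>i\<in>UNIV. a i) \<le> r}. (c a + d a) * monomial a x)"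
    by (simp add: sum.distrib distrib_right)
  then show ?thesis by (auto simp: Poly_iff)
qed

lemma Poly_scale: "p \<in> Poly r \<Longrightarrow> (\<lambda>x. k * p x) \<in> Poly r"
proof -
  assume "p \<in> Poly r"
  then obtain c where "p = (\<lambda>x. \<Sum>a\<in>{a. (\<Sum>i\<in>UNIV. a i) \<le> r}. c a * monomial a x)"
    by (auto simp: Poly_iff)
  then have "(\<lambda>x. k * p x) = (\<lambda>x. \<Sum>a\<in>{a. (\<Sum>i\<in>UNIV. a i) \<le> r}. (k * c a) * monomial a x)"
    by (simp add: sum_distrib_left mult.assoc)
  then show ?thesis by (auto simp: Poly_iff)
qed

lemma Poly_monomial:
  assumes "(\<Sum>i\<in>UNIV. a i) \<le> r"
  shows "monomial a \<in> Poly r"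
proof -
  have "monomial a = (\<lambda>x. \<Sum>b\<in>{b. (\<Sum>i\<in>UNIV. b i) \<le> r}. (if b = a then 1 else 0) * monomial b x)"
    using assms by (simp add: if_distrib if_distribR sum.delta finite_exponents cong: if_cong)
  then show ?thesis unfolding Poly_iff by (intro exI[of _ "\<lambda>b. if b = a then 1 else 0"])
qed

lemma Poly_zero: "(\<lambda>x. 0) \<in> Poly r"
  unfolding Poly_iff by (rule exI[of _ "\<lambda>_. 0"]) simp

lemma Poly_sum: "(\<And>i. i \<in> I \<Longrightarrow> p i \<in> Poly r) \<Longrightarrow> (\<lambda>x. \<Sum>i\<in>I. p i x) \<in> Poly r"
  by (induction I rule: infinite_finite_induct) (auto intro: Poly_zero Poly_add)

lemma Poly_const: "(\<lambda>x. k) \<in> Poly r"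
  using Poly_scale[OF Poly_monomial[of "\<lambda>i. 0" r], of k] by (simp add: monomial_def)

lemma Poly_le: "p \<in> Poly r \<Longrightarrow> r \<le> r' \<Longrightarrow> p \<in> Poly r'"
proof -
  assume "p \<in> Poly r" "r \<le> r'"
  then obtain c where "p = (\<lambda>x. \<Sum>a\<in>{a. (\<Sum>i\<in>UNIV. a i) \<le> r}. c a * monomial a x)"
    by (auto simp: Poly_iff)
  moreover have "(\<lambda>x. \<Sum>a\<in>{a. (\<Sum>i\<in>UNIV. a i) \<le> r}. c a * monomial a x) \<in> Poly r'"
    using \<open>r \<le> r'\<close> by (intro Poly_sum Poly_scale Poly_monomial) auto
  ultimately show ?thesis by simp
qed

lemma C1_monomial [simp]: "C1 (monomial a)"
  unfolding monomial_def[abs_def] by (intro C1_prod C1_power C1_nth)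

lemma C1_Poly: "p \<in> Poly r \<Longrightarrow> C1 p"
  by (auto simp: Poly_iff intro!: C1_sum C1_mult)

text \<open>Differentiation along a coordinate line. For \<open>a i = 0\<close> truncated
  subtraction leaves the exponent 0, but then the factor \<open>real (a i)\<close> is zero.\<close>

lemma partial_monomial: "grad (monomial a) x $ i = real (a i) * monomial (a(i := a i - 1)) x"
proof -
  define P where "P = (\<Prod>j\<in>UNIV - {i}. (x $ j) ^ a j)"
  have split: "monomial b y = (y $ i) ^ b i * (\<Prod>j\<in>UNIV - {i}. (y $ j) ^ b j)" for b y
    unfolding monomial_def by (rule prod.remove) auto
  have line: "monomial a (x + t *\<^sub>R axis i 1) = (x $ i + t) ^ a i * P" for t
    unfolding split P_def by (auto simp: axis_def intro!: prod.cong)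
  have "((\<lambda>t. x + t *\<^sub>R axis i 1) has_derivative (\<lambda>t. t *\<^sub>R axis i 1)) (at 0)"
    by (auto intro!: derivative_eq_intros)
  from has_derivative_compose[OF this C1_has_derivative[OF C1_monomial]]
  have "((\<lambda>t. monomial a (x + t *\<^sub>R axis i 1)) has_real_derivative grad (monomial a) x $ i) (at 0)"
    by (simp add: has_field_derivative_def inner_axis' mult_commute_abs)
  moreover have "((\<lambda>t. monomial a (x + t *\<^sub>R axis i 1)) has_real_derivative real (a i) * (x $ i) ^ (a i - 1) * P) (at 0)"
    unfolding line by (auto intro!: derivative_eq_intros)
  ultimately have "grad (monomial a) x $ i = real (a i) * (x $ i) ^ (a i - 1) * P"
    by (rule DERIV_unique)
  also have "\<dots> = real (a i) * monomial (a(i := a i - 1)) x"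
    unfolding split P_def by (auto intro!: prod.cong)
  finally show ?thesis .
qed

lemma partial_Poly_sum:
  "grad (\<lambda>x. \<Sum>a\<in>A. c a * monomial a x) x $ i = (\<Sum>a\<in>A. c a * (real (a i) * monomial (a(i := a i - 1)) x))"
  by (simp add: grad_sum C1_mult grad_mult partial_monomial)

lemma Poly_partial:
  assumes "p \<in> Poly (Suc r)"
  shows "(\<lambda>x. grad p x $ i) \<in> Poly r"
proof -
  obtain c where p: "p = (\<lambda>x. \<Sum>a\<in>{a. (\<Sum>i\<in>UNIV. a i) \<le> Suc r}. c a * monomial a x)"
    using assms by (auto simp: Poly_iff)
  have key: "(\<lambda>x. real (a i) * monomial (a(i := a i - 1)) x) \<in> Poly r" if "(\<Sum>i\<in>UNIV. a i) \<le> Suc r" for a :: "'a \<Rightarrow> nat"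
  \<comment> \<open>For \<open>a i = 0\<close> the exponents do not decrease, but the whole term is
    zero.\<close>
  proof (cases "a i = 0")
    case True
    then show ?thesis by (simp add: Poly_zero)
  next
    case False
    have "(\<Sum>j\<in>UNIV. (a(i := a i - 1)) j) = (a i - 1) + (\<Sum>j\<in>UNIV - {i}. a j)"
      by (subst sum.remove[of _ i]) (auto intro!: sum.cong)
    moreover have "(\<Sum>j\<in>UNIV. a j) = a i + (\<Sum>j\<in>UNIV - {i}. a j)"
      by (rule sum.remove) auto
    ultimately show ?thesis using False that by (intro Poly_scale Poly_monomial) auto
  qed
  show ?thesis
    unfolding p partial_Poly_sum by (rule Poly_sum, rule Poly_scale, rule key) simp
qed

text \<open>Multiplication by the variable restores the exponent lost in differentiation: each
  monomial is only multiplied by \<open>a i\<close>. This controls the radial part of a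
  Raviart-Thomas field.\<close>

lemma Poly_euler:
  assumes "p \<in> Poly r"
  shows "(\<lambda>x. x $ i * grad p x $ i) \<in> Poly r"
proof -
  obtain c where p: "p = (\<lambda>x. \<Sum>a\<in>{a. (\<Sum>i\<in>UNIV. a i) \<le> r}. c a * monomial a x)"
    using assms by (auto simp: Poly_iff)
  have eq: "x $ i * (real (a i) * monomial (a(i := a i - 1)) x) = real (a i) * monomial a x" for a :: "'a \<Rightarrow> nat" and x
  proof (cases "a i")
    case (Suc k)
    have split: "monomial b x = (x $ i) ^ b i * (\<Prod>j\<in>UNIV - {i}. (x $ j) ^ b j)" for b
      unfolding monomial_def by (rule prod.remove) auto
    have "(\<Prod>j\<in>UNIV - {i}. (x $ j) ^ (a(i := a i - 1)) j) = (\<Prod>j\<in>UNIV - {i}. (x $ j) ^ a j)"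
      by (rule prod.cong) auto
    then show ?thesis unfolding split using Suc by simp
  qed simp
  have eq': "x $ i * (c a * (real (a i) * monomial (a(i := a i - 1)) x)) = c a * (real (a i) * monomial a x)" for a :: "'a \<Rightarrow> nat" and x
    using eq[of x a] by (metis mult.left_commute)
  have "(\<lambda>x. x $ i * grad p x $ i) = (\<lambda>x. \<Sum>a\<in>{a. (\<Sum>i\<in>UNIV. a i) \<le> r}. c a * (real (a i) * monomial a x))"
    unfolding p partial_Poly_sum sum_distrib_left eq' ..
  then show ?thesis by (auto intro!: Poly_sum Poly_scale Poly_monomial)
qed

lemma VPoly_C1v: "a \<in> VPoly r \<Longrightarrow> C1v a"
  by (auto simp: VPoly_def C1v_def intro: C1_Poly)

lemma divg_VPoly: "a \<in> VPoly (Suc r) \<Longrightarrow> divg a \<in> Poly r"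
  unfolding divg_def[abs_def] VPoly_def by (auto intro!: Poly_sum Poly_partial)

lemma C1v_add: "C1v v \<Longrightarrow> C1v w \<Longrightarrow> C1v (\<lambda>x. v x + w x)"
  by (simp add: C1v_def C1_add)

lemma divg_add: "C1v v \<Longrightarrow> C1v w \<Longrightarrow> divg (\<lambda>x. v x + w x) x = divg v x + divg w x"
  by (simp add: C1v_def divg_def grad_add sum.distrib)

lemma C1v_scaleR: "C1v v \<Longrightarrow> C1v (\<lambda>x. k *\<^sub>R v x)"
  by (simp add: C1v_def C1_mult)

lemma divg_scaleR: "C1v v \<Longrightarrow> divg (\<lambda>x. k *\<^sub>R v x) x = k * divg v x"
  by (simp add: C1v_def divg_def grad_mult sum_distrib_left)

lemma grad_nth: "grad (\<lambda>x::real^'n. x $ i) x = axis i 1"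
  using grad_eq[OF C1_with_grad_inner[of "axis i 1 :: real^'n"]] by (simp add: cart_eq_inner_axis)

text \<open>The divergence of the radial part is the dimension times \<open>b\<close> plus the Euler
  derivative of \<open>b\<close>, of the same degree as \<open>b\<close>. Hence the divergence lies
  in the pressure space.\<close>

lemma RT_shape:
  assumes a: "a \<in> VPoly r" and b: "b \<in> Poly r"
  shows "C1v (\<lambda>x. a x + b x *\<^sub>R x)" "divg (\<lambda>x. a x + b x *\<^sub>R x) \<in> Poly r"
proof -
  have bC: "C1 b" using b by (rule C1_Poly)
  have bx: "C1v (\<lambda>x. b x *\<^sub>R x)" by (simp add: C1v_def C1_mult bC)
  show "C1v (\<lambda>x. a x + b x *\<^sub>R x)" by (intro C1v_add bx VPoly_C1v[OF a])
  have "a \<in> VPoly (Suc r)" using a by (auto simp: VPoly_def intro: Poly_le)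
  then have da: "divg a \<in> Poly r" by (rule divg_VPoly)
  have "divg (\<lambda>x. a x + b x *\<^sub>R x) = (\<lambda>x. divg a x + (\<Sum>i\<in>UNIV. b x + x $ i * grad b x $ i))"
    by (simp add: fun_eq_iff divg_add[OF VPoly_C1v[OF a] bx]) (simp add: divg_def grad_mult bC grad_nth)
  then show "divg (\<lambda>x. a x + b x *\<^sub>R x) \<in> Poly r"
    using da b by (auto intro!: Poly_add Poly_sum Poly_euler)
qed

section \<open>Square-integrable fields\<close>

lemma L2_inner_integrable:
  assumes "L2 \<Omega> f" "L2 \<Omega> g"
  shows "integrable (lebesgue_on \<Omega>) (\<lambda>x. f x \<bullet> g x)"
proof (rule Bochner_Integration.integrable_bound)
  show "integrable (lebesgue_on \<Omega>) (\<lambda>x. (norm (f x))\<^sup>2 + (norm (g x))\<^sup>2)"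
    using assms by (simp add: L2_def)
  show "(\<lambda>x. f x \<bullet> g x) \<in> borel_measurable (lebesgue_on \<Omega>)"
    using assms by (intro borel_measurable_inner) (auto simp: L2_def)
  show "AE x in lebesgue_on \<Omega>. norm (f x \<bullet> g x) \<le> norm ((norm (f x))\<^sup>2 + (norm (g x))\<^sup>2)"
  proof (rule AE_I2)
    fix x
    have "\<bar>f x \<bullet> g x\<bar> \<le> norm (f x) * norm (g x)" by (rule Cauchy_Schwarz_ineq2)
    moreover have "2 * (norm (f x) * norm (g x)) \<le> (norm (f x))\<^sup>2 + (norm (g x))\<^sup>2"
      using sum_squares_bound[of "norm (f x)" "norm (g x)"] by simp
    moreover have "0 \<le> norm (f x) * norm (g x)" by simp
    ultimately show "norm (f x \<bullet> g x) \<le> norm ((norm (f x))\<^sup>2 + (norm (g x))\<^sup>2)"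
      unfolding real_norm_def by linarith
  qed
qed

lemma L2_average:
  fixes f g :: "'a::euclidean_space \<Rightarrow> 'b::euclidean_space"
  assumes "L2 \<Omega> f" "L2 \<Omega> g"
  shows "L2 \<Omega> (\<lambda>x. (1/2) *\<^sub>R (f x + g x))"
proof -
  have m: "f \<in> borel_measurable (lebesgue_on \<Omega>)" "g \<in> borel_measurable (lebesgue_on \<Omega>)"
    using assms by (auto simp: L2_def)
  then have m': "(\<lambda>x. (1/2) *\<^sub>R (f x + g x)) \<in> borel_measurable (lebesgue_on \<Omega>)"
    by measurable
  have "(norm ((1/2) *\<^sub>R (f x + g x)))\<^sup>2 = (1/4) * ((norm (f x))\<^sup>2 + 2 * (f x \<bullet> g x) + (norm (g x))\<^sup>2)" for x
  proof -
    have "(norm ((1/2) *\<^sub>R (f x + g x)))\<^sup>2 = (1/4) * (norm (f x + g x))\<^sup>2"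
      by (simp add: power2_eq_square)
    also have "(norm (f x + g x))\<^sup>2 = (norm (f x))\<^sup>2 + 2 * (f x \<bullet> g x) + (norm (g x))\<^sup>2"
      by (simp add: power2_norm_eq_inner inner_add_left inner_add_right inner_commute)
    finally show ?thesis .
  qed
  moreover have "integrable (lebesgue_on \<Omega>) (\<lambda>x. (1/4) * ((norm (f x))\<^sup>2 + 2 * (f x \<bullet> g x) + (norm (g x))\<^sup>2))"
    using assms L2_inner_integrable[OF assms] by (simp add: L2_def)
  ultimately have "integrable (lebesgue_on \<Omega>) (\<lambda>x. (norm ((1/2) *\<^sub>R (f x + g x)))\<^sup>2)"
    by (simp only:)
  with m' show ?thesis unfolding L2_def by (rule conjI)
qed

lemma l2_inner_average:
  assumes "L2 \<Omega> f" "L2 \<Omega> g" "L2 \<Omega> h"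
  shows "l2_inner \<Omega> (\<lambda>x. (1/2) *\<^sub>R (f x + g x)) h = (l2_inner \<Omega> f h + l2_inner \<Omega> g h) / 2"
  using L2_inner_integrable[OF assms(1,3)] L2_inner_integrable[OF assms(2,3)]
  by (simp add: l2_inner_def inner_add_left)

section \<open>Projection onto the discontinuous space\<close>

text \<open>Linear combinations are built one summand at a time, which supplies the induction for
  \<open>lspan_combine\<close> and \<open>lspan_insert_decompose\<close>.\<close>

inductive_set lspan :: "('a \<Rightarrow> real) set \<Rightarrow> ('a \<Rightarrow> real) set" for E where
  zero: "(\<lambda>x. 0) \<in> lspan E"
| step: "e \<in> E \<Longrightarrow> f \<in> lspan E \<Longrightarrow> (\<lambda>x. c * e x + f x) \<in> lspan E"

lemma lspan_combine: "f \<in> lspan E \<Longrightarrow> g \<in> lspan E \<Longrightarrow> (\<lambda>x. c * f x + g x) \<in> lspan E"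
proof (induction rule: lspan.induct)
  case zero
  then show ?case by simp
next
  case (step e f d)
  have "(\<lambda>x. (c * d) * e x + (c * f x + g x)) \<in> lspan E"
    by (rule lspan.step[OF step.hyps(1) step.IH[OF step.prems], of "c * d"])
  then show ?case by (simp add: algebra_simps)
qed

lemma lspan_base: "e \<in> E \<Longrightarrow> e \<in> lspan E"
  using lspan.step[OF _ lspan.zero, of e E 1] by simp

lemma lspan_insert: "f \<in> lspan E \<Longrightarrow> f \<in> lspan (insert k E)"
proof (induction rule: lspan.induct)
  case zero
  show ?case by (rule lspan.zero)
next
  case (step e f c)
  show ?case by (rule lspan.step[OF insertI2[OF step.hyps(1)] step.IH])
qed

lemma lspan_sum: "finite I \<Longrightarrow> (\<And>i. i \<in> I \<Longrightarrow> f i \<in> lspan E) \<Longrightarrow> (\<lambda>x. \<Sum>i\<in>I. c i * f i x) \<in> lspan E"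
proof (induction I rule: finite_induct)
  case empty
  show ?case by (simp add: lspan.zero)
next
  case (insert i I)
  have "(\<lambda>x. c i * f i x + (\<Sum>j\<in>I. c j * f j x)) \<in> lspan E"
    by (rule lspan_combine) (use insert in auto)
  then show ?case using insert.hyps by simp
qed

text \<open>Exchanges the new generator \<open>k\<close> for \<open>k - s\<close>. With
  \<open>s\<close> the projection of \<open>k\<close>, this is the Gram-Schmidt step of
  \<open>projection_exists\<close>.\<close>

lemma lspan_insert_decompose:
  assumes "h \<in> lspan (insert k E)" and s: "s \<in> lspan E"
  shows "\<exists>c h0. h0 \<in> lspan E \<and> h = (\<lambda>x. c * (- 1 * s x + k x) + h0 x)"
  using assms(1)
proof (induction rule: lspan.induct)
  case zero
  show ?case by (rule exI[of _ 0], rule exI[of _ "\<lambda>x. 0"]) (simp add: lspan.zero)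
next
  case (step e f d)
  then obtain c h0 where f: "h0 \<in> lspan E" "f = (\<lambda>x. c * (- 1 * s x + k x) + h0 x)" by blast
  show ?case
  proof (cases "e \<in> E")
    case True
    then have "(\<lambda>x. d * e x + h0 x) \<in> lspan E" using f(1) by (rule lspan.step)
    then show ?thesis
      by (intro exI[of _ c] exI[of _ "\<lambda>x. d * e x + h0 x"]) (simp add: f(2) algebra_simps)
  next
    case False
    then have e: "e = k" using step by blast
    have "(\<lambda>x. d * s x + h0 x) \<in> lspan E" using s f(1) by (rule lspan_combine)
    then show ?thesis
      by (intro exI[of _ "c + d"] exI[of _ "\<lambda>x. d * s x + h0 x"]) (simp add: f(2) e algebra_simps)
  qed
qed

text \<open>Gram-Schmidt, one generator at a time. The form may be degenerate, as the
  \<open>L2\<close> product is on functions that are not identified almost everywhere;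
  \<open>null\<close> makes isotropic elements orthogonal to all of \<open>A\<close>.\<close>

lemma projection_exists:
  fixes ip :: "('a \<Rightarrow> real) \<Rightarrow> ('a \<Rightarrow> real) \<Rightarrow> real"
  assumes zero: "(\<lambda>x. 0) \<in> A" and closed: "\<And>c f g. f \<in> A \<Longrightarrow> g \<in> A \<Longrightarrow> (\<lambda>x. c * f x + g x) \<in> A"
    and linear: "\<And>c f g h. f \<in> A \<Longrightarrow> g \<in> A \<Longrightarrow> h \<in> A \<Longrightarrow> ip (\<lambda>x. c * f x + g x) h = c * ip f h + ip g h"
    and sym: "\<And>f g. ip f g = ip g f"
    and null: "\<And>f g. f \<in> A \<Longrightarrow> g \<in> A \<Longrightarrow> ip f f = 0 \<Longrightarrow> ip f g = 0"
    and E: "finite E" "E \<subseteq> A"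
  shows "f \<in> A \<Longrightarrow> \<exists>g\<in>lspan E. \<forall>h\<in>lspan E. ip g h = ip f h"
  using E
proof (induction E arbitrary: f rule: finite_induct)
  case empty
  have "ip (\<lambda>x. 0) h = 0" if "h \<in> A" for h
    using linear[OF zero zero that, of "-1"] by simp
  then have "ip f (\<lambda>x. 0) = 0" "ip (\<lambda>x. 0) (\<lambda>x. 0) = 0"
    using sym[of f] zero empty by auto
  moreover have "h = (\<lambda>x. 0)" if "h \<in> lspan {}" for h :: "'a \<Rightarrow> real"
    using that by (induction rule: lspan.induct) auto
  ultimately show ?case by (metis lspan.zero)
next
  case (insert k E)
  have span_A: "h \<in> A" if "h \<in> lspan E" for h
    using that by (induction rule: lspan.induct) (use insert.prems zero closed in auto)
  have kA: "k \<in> A" and EA: "E \<subseteq> A" using insert.prems by auto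
  obtain g where g: "g \<in> lspan E" "\<And>h. h \<in> lspan E \<Longrightarrow> ip g h = ip f h"
    using insert.IH[OF insert.prems(1) EA] by blast
  obtain s where s: "s \<in> lspan E" "\<And>h. h \<in> lspan E \<Longrightarrow> ip s h = ip k h"
    using insert.IH[OF kA EA] by blast
  define r where "r x = - 1 * s x + k x" for x
  have rA: "r \<in> A" unfolding r_def by (rule closed[OF span_A[OF s(1)] kA])
  have r0: "ip r h = 0" if "h \<in> lspan E" for h
    unfolding r_def using linear[OF span_A[OF s(1)] kA span_A[OF that], of "-1"] s(2)[OF that] by simp
  have gA: "g \<in> A" using g(1) by (rule span_A)
  \<comment> \<open>If \<open>ip r r = 0\<close>, division by zero gives \<open>t = 0\<close>, the
    right coefficient because \<open>ip f r\<close> vanishes as well by \<open>null\<close>.\<close>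
  define t where "t = ip f r / ip r r"
  define g' where "g' x = t * r x + g x" for x
  have g'A: "g' \<in> A" unfolding g'_def by (rule closed[OF rA gA])
  have r_span: "r \<in> lspan (insert k E)"
    unfolding r_def by (intro lspan_combine lspan_insert s lspan_base) auto
  have g'r: "ip g' r = ip f r"
  proof -
    have "ip g' r = t * ip r r + ip g r"
      unfolding g'_def by (rule linear[OF rA gA rA])
    moreover have "ip g r = 0" using r0[OF g(1)] sym by metis
    moreover have "ip f r = 0" if "ip r r = 0" using null[OF rA insert.prems(1) that] sym by metis
    ultimately show ?thesis by (cases "ip r r = 0") (auto simp: t_def)
  qed
  have "ip g' h = ip f h" if h: "h \<in> lspan (insert k E)" for h
  proof -
    obtain c h0 where h0: "h0 \<in> lspan E" "h = (\<lambda>x. c * r x + h0 x)"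
      using lspan_insert_decompose[OF h s(1)] unfolding r_def by blast
    have split: "ip q h = c * ip q r + ip q h0" if "q \<in> A" for q
      using linear[OF rA span_A[OF h0(1)] that, of c] unfolding h0(2) by (metis sym)
    have "ip g' h0 = t * ip r h0 + ip g h0"
      unfolding g'_def by (rule linear[OF rA gA span_A[OF h0(1)]])
    then show ?thesis
      using split[OF g'A] split[OF insert.prems(1)] g'r r0[OF h0(1)] g(2)[OF h0(1)] by simp
  qed
  moreover have "g' \<in> lspan (insert k E)"
    unfolding g'_def by (intro lspan_combine r_span lspan_insert g)
  ultimately show ?case by blast
qed

section \<open>Discontinuous spaces, their projection and the divergence constraint\<close>

context mesh
begin

lemma spieces_combine:
  assumes "spieces f p" "spieces g q"
  shows "spieces (\<lambda>x. c * f x + g x) (\<lambda>K x. c * p K x + q K x)"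
  using assms by (auto simp: spieces_def intro!: C1_add C1_mult)

lemma spieces_mult:
  assumes "spieces f p" "spieces g q"
  shows "spieces (\<lambda>x. f x * g x) (\<lambda>K x. p K x * q K x)"
  using assms by (auto simp: spieces_def intro!: C1_mult)

lemma spieces_inner:
  assumes "pieces u w" "pieces v z"
  shows "spieces (\<lambda>x. u x \<bullet> v x) (\<lambda>K x. w K x \<bullet> z K x)"
  using assms by (auto simp: spieces_def pieces_def inner_vec_def C1v_def intro!: C1_sum C1_mult)

lemma spieces_integral:
  assumes "spieces f p"
  shows "integrable (lebesgue_on \<Omega>) f" "(LINT x|lebesgue_on \<Omega>. f x) = (\<Sum>K\<in>\<T>. LINT x|lebesgue_on K. p K x)"
proof -
  have p: "C1 (p K)" and fp: "\<And>x. x \<in> interior K \<Longrightarrow> f x = p K x" if "K \<in> \<T>" for K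
    using assms that by (auto simp: spieces_def)
  have i: "integrable (lebesgue_on K) f" if K: "K \<in> \<T>" for K
    by (rule element_integral_continuous(1)[OF K C1_continuous[OF p[OF K]] fp[OF K]])
  have "(LINT x|lebesgue_on K. f x) = (LINT x|lebesgue_on K. p K x)" if K: "K \<in> \<T>" for K
    by (rule element_integral_cong(2)[OF K element_integral_continuous(1)[OF K C1_continuous[OF p[OF K]] refl] fp[OF K]])
  then show "integrable (lebesgue_on \<Omega>) f" "(LINT x|lebesgue_on \<Omega>. f x) = (\<Sum>K\<in>\<T>. LINT x|lebesgue_on K. p K x)"
    using Omega_integral_split[OF i] by simp_all
qed

lemma spieces_L2:
  assumes "spieces f p"
  shows "L2 \<Omega> f"
  using spieces_integral(1)[OF spieces_mult[OF assms assms]] spieces_integral(1)[OF assms]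
  by (auto simp: L2_def power2_eq_square)

lemma DG_pieces:
  assumes "f \<in> DG \<Omega> \<T> r"
  obtains p where "spieces f p" "\<And>K. K \<in> \<T> \<Longrightarrow> p K \<in> Poly r"
proof -
  have "\<forall>K\<in>\<T>. \<exists>p. p \<in> Poly r \<and> (\<forall>x\<in>interior K. f x = p x)"
    using assms unfolding DG_def by blast
  then obtain p where p: "\<forall>K\<in>\<T>. p K \<in> Poly r \<and> (\<forall>x\<in>interior K. f x = p K x)"
    using bchoice by metis
  then have "spieces f p" by (auto simp: spieces_def intro: C1_Poly)
  then show ?thesis using p that by blast
qed

lemma DG_intro:
  assumes "\<And>K. K \<in> \<T> \<Longrightarrow> p K \<in> Poly r" "\<And>K x. K \<in> \<T> \<Longrightarrow> x \<in> interior K \<Longrightarrow> f x = p K x"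
  shows "f \<in> DG \<Omega> \<T> r"
proof -
  have "spieces f p" using assms by (auto simp: spieces_def intro: C1_Poly)
  then show ?thesis using assms spieces_L2 unfolding DG_def by blast
qed

lemma DG_combine:
  assumes "f \<in> DG \<Omega> \<T> r" "g \<in> DG \<Omega> \<T> r"
  shows "(\<lambda>x. c * f x + g x) \<in> DG \<Omega> \<T> r"
proof -
  obtain p where p: "spieces f p" "\<And>K. K \<in> \<T> \<Longrightarrow> p K \<in> Poly r" using DG_pieces[OF assms(1)] by blast
  obtain q where q: "spieces g q" "\<And>K. K \<in> \<T> \<Longrightarrow> q K \<in> Poly r" using DG_pieces[OF assms(2)] by blast
  show ?thesis
    by (rule DG_intro[of "\<lambda>K x. c * p K x + q K x"])
       (use p q in \<open>auto simp: spieces_def intro!: Poly_add Poly_scale\<close>)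
qed

lemma DG_const: "(\<lambda>x. k) \<in> DG \<Omega> \<T> r"
  by (rule DG_intro[of "\<lambda>K x. k"]) (auto intro: Poly_const)

lemma glue:
  assumes "K \<in> \<T>" "x \<in> interior K"
  shows "(\<Sum>L\<in>\<T>. indicator (interior L) x * p L x) = (p K x :: real)"
proof -
  have "indicator (interior L) x * p L x = (if L = K then p K x else 0)" if "L \<in> \<T>" for L
    using that assms interior_disjoint[OF that assms(1)] by (auto simp: indicator_def)
  then have "(\<Sum>L\<in>\<T>. indicator (interior L) x * p L x) = (\<Sum>L\<in>\<T>. if L = K then p K x else 0)"
    by (rule sum.cong[OF refl])
  then show ?thesis using assms finite_T by simp
qed

lemma l2_inner_pieces:
  assumes "spieces f p" "spieces h q"
  shows "l2_inner \<Omega> f h = (\<Sum>K\<in>\<T>. LINT x|lebesgue_on K. p K x * q K x)"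
  unfolding l2_inner_def inner_real_def by (rule spieces_integral(2)[OF spieces_mult[OF assms]])

text \<open>Shows that the choice in \<open>L2_proj\<close> succeeds. As a set of functions the
  space leaves values on the skeleton free, so the projection is taken onto the span of monomials
  restricted to element interiors, which represents every member up to those values.\<close>

lemma L2_proj:
  assumes f: "spieces f p"
  shows "L2_proj \<Omega> (DG \<Omega> \<T> r) f \<in> DG \<Omega> \<T> r"
    "\<And>h. h \<in> DG \<Omega> \<T> r \<Longrightarrow> l2_inner \<Omega> (L2_proj \<Omega> (DG \<Omega> \<T> r) f) h = l2_inner \<Omega> f h"
proof -
  define A where "A = {f. \<exists>p. spieces f p}"
  define I where "I = {a :: 'n \<Rightarrow> nat. (\<Sum>i\<in>UNIV. a i) \<le> r}"
  define b where "b K a x = indicator (interior K) x * monomial a x" for K a and x :: "real^'n"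
  define E where "E = (\<lambda>(K, a). b K a) ` (\<T> \<times> I)"
  have finE: "finite E"
    unfolding E_def I_def using finite_T finite_exponents by (intro finite_imageI finite_cartesian_product)
  have b_DG: "b K a \<in> DG \<Omega> \<T> r" if K: "K \<in> \<T>" and a: "a \<in> I" for K a
  proof (rule DG_intro[of "\<lambda>L. if L = K then monomial a else (\<lambda>x. 0)"])
    show "(if L = K then monomial a else (\<lambda>x. 0)) \<in> Poly r" for L
      using a by (auto simp: I_def intro: Poly_monomial Poly_zero)
    show "b K a x = (if L = K then monomial a else (\<lambda>x. 0)) x" if "L \<in> \<T>" "x \<in> interior L" for L x
      using that interior_disjoint[OF that(1) K] by (auto simp: b_def indicator_def)
  qed
  have DG_A: "DG \<Omega> \<T> r \<subseteq> A"
    unfolding A_def using DG_pieces by blast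
  have E_DG: "E \<subseteq> DG \<Omega> \<T> r" using b_DG by (auto simp: E_def)
  have span_DG: "h \<in> DG \<Omega> \<T> r" if "h \<in> lspan E" for h
    using that by (induction rule: lspan.induct) (use E_DG DG_const DG_combine in auto)
  have "\<exists>g\<in>lspan E. \<forall>h\<in>lspan E. l2_inner \<Omega> g h = l2_inner \<Omega> f h"
  proof (rule projection_exists[where A = A])
    show "(\<lambda>x. 0) \<in> A" using DG_const DG_A by blast
    show "(\<lambda>x. c * f x + g x) \<in> A" if "f \<in> A" "g \<in> A" for c f g
      using that spieces_combine unfolding A_def by blast
    show "l2_inner \<Omega> (\<lambda>x. c * f x + g x) h = c * l2_inner \<Omega> f h + l2_inner \<Omega> g h"
      if fgh: "f \<in> A" "g \<in> A" "h \<in> A" for c f g h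
    proof -
      have "integrable (lebesgue_on \<Omega>) (\<lambda>x. f x * h x)" "integrable (lebesgue_on \<Omega>) (\<lambda>x. g x * h x)"
        using fgh spieces_integral(1) spieces_mult unfolding A_def by blast+
      then show ?thesis by (simp add: l2_inner_def distrib_right mult.assoc)
    qed
    show "l2_inner \<Omega> f g = l2_inner \<Omega> g f" for f g :: "real^'n \<Rightarrow> real"
      by (simp add: l2_inner_def mult.commute)
    show "l2_inner \<Omega> f g = 0" if fg: "f \<in> A" "g \<in> A" and zero: "l2_inner \<Omega> f f = 0" for f g
    proof -
      have ff: "integrable (lebesgue_on \<Omega>) (\<lambda>x. f x * f x)" "integrable (lebesgue_on \<Omega>) (\<lambda>x. f x * g x)"
        using fg spieces_integral(1) spieces_mult unfolding A_def by blast+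
      have "AE x in lebesgue_on \<Omega>. f x * f x = 0"
        using zero integral_nonneg_eq_0_iff_AE[OF ff(1)] by (simp add: l2_inner_def)
      then have "AE x in lebesgue_on \<Omega>. f x * g x = 0"
        by eventually_elim simp
      then show ?thesis
        unfolding l2_inner_def inner_real_def by (rule integral_eq_zero_AE)
    qed
    show "finite E" "E \<subseteq> A" "f \<in> A" using finE E_DG DG_A f by (auto simp: A_def)
  qed
  then obtain g where g: "g \<in> lspan E" "\<And>h. h \<in> lspan E \<Longrightarrow> l2_inner \<Omega> g h = l2_inner \<Omega> f h" by blast
  have "l2_inner \<Omega> g h = l2_inner \<Omega> f h" if h: "h \<in> DG \<Omega> \<T> r" for h
  proof -
    obtain q where q: "spieces h q" "\<And>K. K \<in> \<T> \<Longrightarrow> q K \<in> Poly r" using DG_pieces[OF h] by blast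
    have "\<forall>K\<in>\<T>. \<exists>c. q K = (\<lambda>x. \<Sum>a\<in>I. c a * monomial a x)"
      using q(2) unfolding Poly_iff I_def by blast
    then obtain c where c: "\<And>K. K \<in> \<T> \<Longrightarrow> q K = (\<lambda>x. \<Sum>a\<in>I. c K a * monomial a x)"
      using bchoice by metis
    \<comment> \<open>A member of the span that agrees with \<open>h\<close> in the interior of
      every element; the factor 1 fits the shape of \<open>lspan_sum\<close>.\<close>
    define h' where "h' x = (\<Sum>K\<in>\<T>. 1 * (\<Sum>a\<in>I. c K a * b K a x))" for x
    have "finite I" unfolding I_def by (rule finite_exponents)
    then have h'_span: "h' \<in> lspan E"
      unfolding h'_def by (intro lspan_sum finite_T lspan_base) (auto simp: E_def)
    have "h' x = (\<Sum>K\<in>\<T>. indicator (interior K) x * q K x)" for x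
      unfolding h'_def by (rule sum.cong[OF refl]) (simp add: c b_def sum_distrib_left mult_ac)
    then have "h' x = q K x" if "K \<in> \<T>" "x \<in> interior K" for K x
      using glue[OF that, of q] by simp
    then have h': "spieces h' q" using q(1) by (auto simp: spieces_def)
    have "l2_inner \<Omega> k h = l2_inner \<Omega> k h'" if "k \<in> A" for k
      using that l2_inner_pieces[OF _ q(1)] l2_inner_pieces[OF _ h'] by (auto simp: A_def)
    moreover have "g \<in> A" "f \<in> A" using g(1) span_DG DG_A f by (auto simp: A_def)
    ultimately show ?thesis using g(2)[OF h'_span] by simp
  qed
  then have ex: "\<exists>g. g \<in> DG \<Omega> \<T> r \<and> (\<forall>h\<in>DG \<Omega> \<T> r. l2_inner \<Omega> g h = l2_inner \<Omega> f h)"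
    using span_DG[OF g(1)] by blast
  show "L2_proj \<Omega> (DG \<Omega> \<T> r) f \<in> DG \<Omega> \<T> r"
    "\<And>h. h \<in> DG \<Omega> \<T> r \<Longrightarrow> l2_inner \<Omega> (L2_proj \<Omega> (DG \<Omega> \<T> r) f) h = l2_inner \<Omega> f h"
    using someI_ex[OF ex] unfolding L2_proj_def by blast+
qed

text \<open>The elementwise divergence is itself an admissible \<open>q\<close>, so its square
  integrates to zero; continuity turns this into a pointwise statement.\<close>

lemma divergence_free:
  assumes div: "has_weak_div \<Omega> u g" and w: "pieces u w" and poly: "\<And>K. K \<in> \<T> \<Longrightarrow> divg (w K) \<in> Poly r"
    and orth: "\<And>q. q \<in> DG \<Omega> \<T> r \<Longrightarrow> l2_inner \<Omega> g q = 0" and K: "K \<in> \<T>" and x: "x \<in> interior K"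
  shows "divg (w K) x = 0"
proof -
  define q where "q x = (\<Sum>L\<in>\<T>. indicator (interior L) x * divg (w L) x)" for x
  have qd: "q x = divg (w L) x" if "L \<in> \<T>" "x \<in> interior L" for L x
    unfolding q_def by (rule glue[OF that])
  have "q \<in> DG \<Omega> \<T> r" by (rule DG_intro[OF poly qd])
  moreover have "spieces q (\<lambda>L. divg (w L))"
    using poly qd by (auto simp: spieces_def intro: C1_Poly)
  ultimately have "(\<Sum>L\<in>\<T>. LINT x|lebesgue_on L. divg (w L) x * divg (w L) x) = 0"
    using weak_div_inner[OF div w, of q "\<lambda>L. divg (w L)"] orth[of q] by simp
  then have zero: "(LINT x|lebesgue_on K. divg (w K) x * divg (w K) x) = 0"
    using K finite_T by (subst (asm) sum_nonneg_eq_0_iff) auto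
  have cont: "continuous_on UNIV (divg (w K))"
    using w K by (auto simp: pieces_def intro: divg_continuous)
  have cont2: "continuous_on UNIV (\<lambda>x. divg (w K) x * divg (w K) x)"
    by (intro continuous_intros cont)
  have int: "integrable lborel (\<lambda>x. indicator K x * (divg (w K) x * divg (w K) x))"
    by (rule integrable_indicator_compact[OF compact_element[OF K] continuous_on_subset[OF cont2]]) simp
  have "(LINT x|lborel. indicator K x * (divg (w K) x * divg (w K) x)) = 0"
    using element_integral_continuous(2)[OF K cont2 refl] zero by simp
  then have ae: "AE x in lborel. indicator K x * (divg (w K) x * divg (w K) x) = 0"
    using integral_nonneg_eq_0_iff_AE[OF int] by simp
  define A where "A = interior K \<inter> {x. divg (w K) x \<noteq> 0}"
  have "open A"
    unfolding A_def by (intro open_Int open_interior open_Collect_neq cont continuous_on_const)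
  moreover have "AE x in lborel. x \<notin> A"
    using ae
  proof eventually_elim
    fix x assume "indicator K x * (divg (w K) x * divg (w K) x) = 0"
    then show "x \<notin> A"
      using interior_subset[of K] by (auto simp: A_def indicator_def split: if_splits)
  qed
  ultimately have "A = {}" by (rule AE_open_lborel)
  then show ?thesis using x by (auto simp: A_def)
qed

section \<open>Averages of velocities and their pieces\<close>

lemma compact_support_L2:
  fixes G :: "real^'n \<Rightarrow> 'b::euclidean_space"
  assumes "continuous_on \<Omega> G" "compact S" "S \<subseteq> \<Omega>" "\<And>x. x \<notin> S \<Longrightarrow> G x = 0"
  shows "L2 \<Omega> G"
proof -
  have "bounded (G ` S)"
    by (intro compact_imp_bounded compact_continuous_image continuous_on_subset[OF assms(1)] assms)
  then obtain B where B: "\<And>x. x \<in> S \<Longrightarrow> norm (G x) \<le> B" by (auto simp: bounded_iff)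
  show ?thesis
  proof (rule L2_bounded[OF Omega_lmeasurable assms(1), of "\<bar>B\<bar>"])
    show "norm (G x) \<le> \<bar>B\<bar>" for x
      using B[of x] assms(4)[of x] by (cases "x \<in> S") auto
  qed
qed

text \<open>Admits the half-step velocity as a test function. Linearity of the pairings needs
  square-integrable test functions; for those in \<open>has_weak_div\<close> compact support ensures
  it.\<close>

lemma H0div_average:
  assumes "u \<in> H0div \<Omega>" "v \<in> H0div \<Omega>"
  shows "(\<lambda>x. (1/2) *\<^sub>R (u x + v x)) \<in> H0div \<Omega>"
proof -
  obtain g where g: "L2 \<Omega> u" "has_weak_div \<Omega> u g" "normal_trace_zero \<Omega> u g"
    using assms(1) by (auto simp: H0div_def)
  obtain h where h: "L2 \<Omega> v" "has_weak_div \<Omega> v h" "normal_trace_zero \<Omega> v h"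
    using assms(2) by (auto simp: H0div_def)
  have gh: "L2 \<Omega> g" "L2 \<Omega> h" using g h by (auto simp: has_weak_div_def)
  have "has_weak_div \<Omega> (\<lambda>x. (1/2) *\<^sub>R (u x + v x)) (\<lambda>x. (1/2) *\<^sub>R (g x + h x))"
    unfolding has_weak_div_def
  proof (intro conjI allI impI)
    show "L2 \<Omega> (\<lambda>x. (1/2) *\<^sub>R (g x + h x))" by (rule L2_average[OF gh])
    fix \<phi> G assume *: "C1_with_grad \<Omega> \<phi> G \<and> (\<exists>C. compact C \<and> C \<subseteq> \<Omega> \<and> (\<forall>x. x \<notin> C \<longrightarrow> \<phi> x = 0 \<and> G x = 0))"
    then obtain C where C: "compact C" "C \<subseteq> \<Omega>" "\<And>x. x \<notin> C \<Longrightarrow> \<phi> x = 0" "\<And>x. x \<notin> C \<Longrightarrow> G x = 0" by blast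
    have "L2 \<Omega> \<phi>"
      using * by (intro compact_support_L2[OF C1_with_grad_imp_continuous C(1,2,3)]) auto
    moreover have "L2 \<Omega> G"
      using * by (intro compact_support_L2[OF _ C(1,2,4)]) (auto simp: C1_with_grad_def)
    moreover have "l2_inner \<Omega> u G = - l2_inner \<Omega> g \<phi>" "l2_inner \<Omega> v G = - l2_inner \<Omega> h \<phi>"
      using * g(2) h(2) unfolding has_weak_div_def by blast+
    ultimately show "l2_inner \<Omega> (\<lambda>x. (1/2) *\<^sub>R (u x + v x)) G = - l2_inner \<Omega> (\<lambda>x. (1/2) *\<^sub>R (g x + h x)) \<phi>"
      using l2_inner_average[OF g(1) h(1), of G] l2_inner_average[OF gh, of \<phi>] by simp
  qed
  moreover have "normal_trace_zero \<Omega> (\<lambda>x. (1/2) *\<^sub>R (u x + v x)) (\<lambda>x. (1/2) *\<^sub>R (g x + h x))"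
    unfolding normal_trace_zero_def
  proof (intro allI impI)
    fix \<phi> G assume *: "C1_with_grad \<Omega> \<phi> G \<and> L2 \<Omega> \<phi> \<and> L2 \<Omega> G"
    then have "l2_inner \<Omega> u G + l2_inner \<Omega> g \<phi> = 0" "l2_inner \<Omega> v G + l2_inner \<Omega> h \<phi> = 0"
      using g(3) h(3) unfolding normal_trace_zero_def by blast+
    then show "l2_inner \<Omega> (\<lambda>x. (1/2) *\<^sub>R (u x + v x)) G + l2_inner \<Omega> (\<lambda>x. (1/2) *\<^sub>R (g x + h x)) \<phi> = 0"
      using l2_inner_average[OF g(1) h(1), of G] l2_inner_average[OF gh, of \<phi>] * by simp
  qed
  ultimately show ?thesis
    using L2_average[OF g(1) h(1)] unfolding H0div_def by blast
qed

lemma VPoly_average: "a \<in> VPoly r \<Longrightarrow> b \<in> VPoly r \<Longrightarrow> (\<lambda>x. (1/2) *\<^sub>R (a x + b x)) \<in> VPoly r"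
  unfolding VPoly_def
proof (intro CollectI allI)
  fix i
  assume "a \<in> {p. \<forall>i. (\<lambda>x. p x $ i) \<in> Poly r}" "b \<in> {p. \<forall>i. (\<lambda>x. p x $ i) \<in> Poly r}"
  then have "(\<lambda>x. (1/2) * (a x $ i + b x $ i)) \<in> Poly r"
    by (intro Poly_scale Poly_add) auto
  then show "(\<lambda>x. ((1/2) *\<^sub>R (a x + b x)) $ i) \<in> Poly r" by simp
qed

lemma RT_average:
  assumes "u \<in> RT \<Omega> \<T> s" "v \<in> RT \<Omega> \<T> s"
  shows "(\<lambda>x. (1/2) *\<^sub>R (u x + v x)) \<in> RT \<Omega> \<T> s"
  unfolding RT_def
proof (intro CollectI conjI ballI)
  show "(\<lambda>x. (1/2) *\<^sub>R (u x + v x)) \<in> H0div \<Omega>"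
    using assms by (intro H0div_average) (auto simp: RT_def)
  fix K assume K: "K \<in> \<T>"
  obtain a b where ab: "a \<in> VPoly s" "b \<in> Poly s" "\<forall>x\<in>interior K. u x = a x + b x *\<^sub>R x"
    using assms(1) K unfolding RT_def by blast
  obtain a' b' where ab': "a' \<in> VPoly s" "b' \<in> Poly s" "\<forall>x\<in>interior K. v x = a' x + b' x *\<^sub>R x"
    using assms(2) K unfolding RT_def by blast
  show "\<exists>a\<in>VPoly s. \<exists>b\<in>Poly s. \<forall>x\<in>interior K. (1/2) *\<^sub>R (u x + v x) = a x + b x *\<^sub>R x"
  proof (intro bexI ballI)
    show "(\<lambda>x. (1/2) *\<^sub>R (a x + a' x)) \<in> VPoly s" by (rule VPoly_average[OF ab(1) ab'(1)])
    show "(\<lambda>x. (1/2) * (b x + b' x)) \<in> Poly s" by (intro Poly_scale Poly_add ab ab')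
    show "(1/2) *\<^sub>R (u x + v x) = (1/2) *\<^sub>R (a x + a' x) + ((1/2) * (b x + b' x)) *\<^sub>R x" if "x \<in> interior K" for x
      using ab(3) ab'(3) that by (simp add: scaleR_add_right scaleR_add_left add_divide_distrib)
  qed
qed

lemma BDM_average:
  assumes "u \<in> BDM \<Omega> \<T> s" "v \<in> BDM \<Omega> \<T> s"
  shows "(\<lambda>x. (1/2) *\<^sub>R (u x + v x)) \<in> BDM \<Omega> \<T> s"
  unfolding BDM_def
proof (intro CollectI conjI ballI)
  show "(\<lambda>x. (1/2) *\<^sub>R (u x + v x)) \<in> H0div \<Omega>"
    using assms by (intro H0div_average) (auto simp: BDM_def)
  fix K assume K: "K \<in> \<T>"
  obtain a where a: "a \<in> VPoly s" "\<forall>x\<in>interior K. u x = a x"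
    using assms(1) K unfolding BDM_def by blast
  obtain a' where a': "a' \<in> VPoly s" "\<forall>x\<in>interior K. v x = a' x"
    using assms(2) K unfolding BDM_def by blast
  show "\<exists>a\<in>VPoly s. \<forall>x\<in>interior K. (1/2) *\<^sub>R (u x + v x) = a x"
    by (rule bexI[OF _ VPoly_average[OF a(1) a'(1)]]) (use a a' in simp)
qed

lemma RT_pieces:
  assumes "u \<in> RT \<Omega> \<T> s"
  shows "\<exists>w. pieces u w \<and> (\<forall>K\<in>\<T>. divg (w K) \<in> Poly s)"
proof -
  have "\<forall>K\<in>\<T>. \<exists>w. C1v w \<and> (\<forall>x\<in>interior K. u x = w x) \<and> divg w \<in> Poly s"
  proof
    fix K assume "K \<in> \<T>"
    then obtain a b where ab: "a \<in> VPoly s" "b \<in> Poly s" "\<forall>x\<in>interior K. u x = a x + b x *\<^sub>R x"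
      using assms unfolding RT_def by blast
    then show "\<exists>w. C1v w \<and> (\<forall>x\<in>interior K. u x = w x) \<and> divg w \<in> Poly s"
      by (intro exI[of _ "\<lambda>x. a x + b x *\<^sub>R x"]) (simp add: RT_shape)
  qed
  then obtain w where "\<forall>K\<in>\<T>. C1v (w K) \<and> (\<forall>x\<in>interior K. u x = w K x) \<and> divg (w K) \<in> Poly s"
    using bchoice by metis
  then show ?thesis unfolding pieces_def by blast
qed

lemma BDM_pieces:
  assumes "u \<in> BDM \<Omega> \<T> (Suc s)"
  shows "\<exists>w. pieces u w \<and> (\<forall>K\<in>\<T>. divg (w K) \<in> Poly s)"
proof -
  have "\<forall>K\<in>\<T>. \<exists>w. w \<in> VPoly (Suc s) \<and> (\<forall>x\<in>interior K. u x = w x)"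
    using assms unfolding BDM_def by blast
  then obtain w where "\<forall>K\<in>\<T>. w K \<in> VPoly (Suc s) \<and> (\<forall>x\<in>interior K. u x = w K x)"
    using bchoice by metis
  then show ?thesis unfolding pieces_def using VPoly_C1v divg_VPoly by blast
qed

lemma pieces_average:
  assumes "pieces u w" "pieces v z"
  shows "pieces (\<lambda>x. (1/2) *\<^sub>R (u x + v x)) (\<lambda>K x. (1/2) *\<^sub>R (w K x + z K x))"
  using assms by (auto simp: pieces_def intro!: C1v_scaleR C1v_add)

end

section \<open>Conservation properties\<close>

theorem proposition3p2:
  fixes \<Omega> :: "(real^'n::finite) set" and \<T> E :: "(real^'n) set set"
    and \<iota> :: "'n \<Rightarrow> 3" and \<nu> :: "(real^'n) set \<Rightarrow> real^'n"
    and s m :: nat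
    and U :: "(real^'n \<Rightarrow> real^'n) set" and F Q :: "(real^'n \<Rightarrow> real) set"
    and \<alpha> \<beta> :: "(real^'n) set \<Rightarrow> (real^'n \<Rightarrow> real^'n) \<Rightarrow> real^'n \<Rightarrow> real"
    and dt :: real
    and u :: "nat \<Rightarrow> real^'n \<Rightarrow> real^'n" and \<rho> p :: "nat \<Rightarrow> real^'n \<Rightarrow> real"
  assumes dim: "CARD('n) = 2 \<or> CARD('n) = 3"
    and coords: "inj \<iota>" "{1, 2} \<subseteq> range \<iota>"
    and domain: "open \<Omega>" "connected \<Omega>" "bounded \<Omega>" "\<Omega> \<noteq> {}"
    and mesh: "simplicial_mesh \<Omega> \<T>"
    and faces: "E = interior_faces \<Omega> \<T>"
    and normals: "\<forall>e\<in>E. unit_normal e (\<nu> e)"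
    and U: "U = RT \<Omega> \<T> s \<or> U = BDM \<Omega> \<T> (s + 1)"
    and F: "F = DG \<Omega> \<T> m"
    and Q: "Q = DG \<Omega> \<T> s"
    and beta: "\<forall>e\<in>E. \<forall>w\<in>U. \<forall>x\<in>e. \<beta> e w x \<ge> 0 \<and> (normal_comp \<T> \<nu> e w x = 0 \<longrightarrow> \<beta> e w x = 0)"
    and alpha: "\<forall>e\<in>E. \<forall>w\<in>U. (\<forall>x\<in>e. \<alpha> e w x \<ge> 0) \<or>
      (\<exists>c1\<in>{0..1/2}. \<forall>x\<in>e. \<alpha> e w x = c1 * (normal_comp \<T> \<nu> e w x / \<bar>normal_comp \<T> \<nu> e w x\<bar>))"
    and dt: "dt > 0"
    and u_in: "\<forall>k. u k \<in> U"
    and \<rho>_in: "\<forall>k. \<rho> k \<in> F"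
    and p_in: "\<forall>k. p (Suc k) \<in> Q"
    and div_u0: "has_weak_div \<Omega> (u 0) (\<lambda>x. 0)"
    and well_defined: "\<forall>k. \<forall>e\<in>E. \<forall>v\<in>U. \<forall>\<sigma>\<in>F.
      integrable (face_measure e) (alpha_integrand \<iota> \<T> \<nu> e (\<alpha> e (half_step u k))
        (half_step (\<lambda>j x. \<rho> j x *\<^sub>R u j x) k) (half_step u k) v) \<and>
      integrable (face_measure e) (beta_momentum_integrand \<T> \<nu> e (\<beta> e (half_step u k))
        (half_step u k) v (L2_proj \<Omega> F (\<lambda>x. u k x \<bullet> u (Suc k) x)) (half_step \<rho> k)) \<and>
      integrable (face_measure e) (beta_density_integrand \<T> \<nu> e (\<beta> e (half_step u k)) \<sigma> (half_step \<rho> k))"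
    and momentum: "\<forall>k. \<forall>v\<in>U.
        (\<Sum>e\<in>E. LINT x|face_measure e. alpha_integrand \<iota> \<T> \<nu> e (\<alpha> e (half_step u k))
            (half_step (\<lambda>j x. \<rho> j x *\<^sub>R u j x) k) (half_step u k) v x)
      + (\<Sum>e\<in>E. LINT x|face_measure e. beta_momentum_integrand \<T> \<nu> e (\<beta> e (half_step u k))
            (half_step u k) v (L2_proj \<Omega> F (\<lambda>x. u k x \<bullet> u (Suc k) x)) (half_step \<rho> k) x)
      + l2_inner \<Omega> (\<lambda>x. (1/dt) *\<^sub>R (\<rho> (Suc k) x *\<^sub>R u (Suc k) x - \<rho> k x *\<^sub>R u k x)) v
      + a_form \<iota> \<Omega> \<T> \<nu> (half_step (\<lambda>j x. \<rho> j x *\<^sub>R u j x) k) (half_step u k) v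
      - 1/2 * b_form \<Omega> \<T> \<nu> v (L2_proj \<Omega> F (\<lambda>x. u k x \<bullet> u (Suc k) x)) (half_step \<rho> k)
      - l2_inner \<Omega> (p (Suc k)) (weak_div \<Omega> v) = 0"
    and density: "\<forall>k. \<forall>\<sigma>\<in>F.
        l2_inner \<Omega> (\<lambda>x. (\<rho> (Suc k) x - \<rho> k x) / dt) \<sigma>
      - b_form \<Omega> \<T> \<nu> (half_step u k) \<sigma> (half_step \<rho> k)
      + (\<Sum>e\<in>E. LINT x|face_measure e.
            beta_density_integrand \<T> \<nu> e (\<beta> e (half_step u k)) \<sigma> (half_step \<rho> k) x) = 0"
    and incompressible: "\<forall>k. \<forall>q\<in>Q. l2_inner \<Omega> (weak_div \<Omega> (u (Suc k))) q = 0"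
  shows "\<forall>k.
      (LINT x|lebesgue_on \<Omega>. \<rho> (Suc k) x) = (LINT x|lebesgue_on \<Omega>. \<rho> k x) \<and>
      (LINT x|lebesgue_on \<Omega>. (\<rho> (Suc k) x)\<^sup>2) \<le> (LINT x|lebesgue_on \<Omega>. (\<rho> k x)\<^sup>2) \<and>
      ((\<forall>e\<in>E. \<forall>w\<in>U. \<forall>x\<in>e. \<beta> e w x = 0) \<longrightarrow>
         (LINT x|lebesgue_on \<Omega>. (\<rho> (Suc k) x)\<^sup>2) = (LINT x|lebesgue_on \<Omega>. (\<rho> k x)\<^sup>2)) \<and>
      (LINT x|lebesgue_on \<Omega>. \<rho> (Suc k) x * (u (Suc k) x \<bullet> u (Suc k) x))
        = (LINT x|lebesgue_on \<Omega>. \<rho> k x * (u k x \<bullet> u k x))"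
proof (intro allI)
  fix k
  interpret mesh \<Omega> \<T>
    using dim domain mesh by unfold_locales
  define uh where "uh = half_step u k"
  define rh where "rh = half_step \<rho> k"
  have uh: "uh = (\<lambda>x. (1/2) *\<^sub>R (u k x + u (Suc k) x))"
    by (simp add: uh_def half_step_def fun_eq_iff)
  have rh: "rh x = (\<rho> k x + \<rho> (Suc k) x) / 2" for x
    by (simp add: rh_def half_step_def)
  have normals': "\<forall>e\<in>interior_faces \<Omega> \<T>. unit_normal e (\<nu> e)"
    using normals faces by simp
  have U_pieces: "\<exists>w. pieces v w \<and> (\<forall>K\<in>\<T>. divg (w K) \<in> Poly s)" if "v \<in> U" for v
    using that U RT_pieces BDM_pieces by auto
  have U_H0div: "v \<in> H0div \<Omega>" if "v \<in> U" for v
    using that U by (auto simp: RT_def BDM_def)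
  have uh_in: "uh \<in> U"
    unfolding uh using U u_in RT_average BDM_average by auto
  have \<rho>_DG: "\<rho> j \<in> DG \<Omega> \<T> m" for j using \<rho>_in F by simp
  have rh_in: "rh \<in> F"
  proof -
    have "(\<lambda>x. (1/2) * \<rho> (Suc k) x + ((1/2) * \<rho> k x + 0)) \<in> DG \<Omega> \<T> m"
      by (intro DG_combine DG_const \<rho>_DG)
    moreover have "(\<lambda>x. (1/2) * \<rho> (Suc k) x + ((1/2) * \<rho> k x + 0)) = rh"
      by (simp add: rh fun_eq_iff)
    ultimately show ?thesis using F by simp
  qed

  \<comment> \<open>At time zero the constraint is an assumption; later it comes from the third
    equation, which speaks of the weak divergence selected by \<open>weak_div\<close>.\<close>
  have solenoidal: "\<exists>w. pieces (u j) w \<and> (\<forall>K\<in>\<T>. \<forall>x\<in>interior K. divg (w K) x = 0)" for j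
  proof -
    have uj: "u j \<in> U" using u_in by blast
    obtain w where w: "pieces (u j) w" "\<And>K. K \<in> \<T> \<Longrightarrow> divg (w K) \<in> Poly s"
      using U_pieces[OF uj] by blast
    have "\<exists>g. has_weak_div \<Omega> (u j) g \<and> (\<forall>q\<in>Q. l2_inner \<Omega> g q = 0)"
    proof (cases j)
      case 0
      then show ?thesis using div_u0 by (intro exI[of _ "\<lambda>x. 0"]) (simp add: l2_inner_def)
    next
      case (Suc i)
      have "\<exists>g. has_weak_div \<Omega> (u j) g" using U_H0div[OF uj] by (auto simp: H0div_def)
      then have "has_weak_div \<Omega> (u j) (weak_div \<Omega> (u j))"
        unfolding weak_div_def by (rule someI_ex)
      then show ?thesis using incompressible Suc by blast
    qed
    then obtain g where g: "has_weak_div \<Omega> (u j) g" "\<And>q. q \<in> DG \<Omega> \<T> s \<Longrightarrow> l2_inner \<Omega> g q = 0"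
      using Q by blast
    show ?thesis
      using divergence_free[OF g(1) w g(2)] w(1) by blast
  qed
  obtain w where w: "pieces (u k) w" "\<And>K x. K \<in> \<T> \<Longrightarrow> x \<in> interior K \<Longrightarrow> divg (w K) x = 0"
    using solenoidal[of k] by blast
  obtain w' where w': "pieces (u (Suc k)) w'" "\<And>K x. K \<in> \<T> \<Longrightarrow> x \<in> interior K \<Longrightarrow> divg (w' K) x = 0"
    using solenoidal[of "Suc k"] by blast
  define wh where "wh K x = (1/2) *\<^sub>R (w K x + w' K x)" for K x
  have wh: "pieces uh wh"
    unfolding uh wh_def[abs_def] by (rule pieces_average[OF w(1) w'(1)])
  have wh_free: "divg (wh K) x = 0" if K: "K \<in> \<T>" "x \<in> interior K" for K x
  proof -
    have "C1v (w K)" "C1v (w' K)" using w(1) w'(1) K(1) by (auto simp: pieces_def)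
    then show ?thesis
      unfolding wh_def[abs_def] using w(2)[OF K] w'(2)[OF K] by (simp add: divg_scaleR C1v_add divg_add)
  qed
  obtain p0 where p0: "spieces (\<rho> k) p0" using DG_pieces[OF \<rho>_DG] by blast
  obtain p1 where p1: "spieces (\<rho> (Suc k)) p1" using DG_pieces[OF \<rho>_DG] by blast
  obtain ph where ph: "spieces rh ph" using DG_pieces rh_in F by blast
  obtain gd where gd: "has_weak_div \<Omega> uh gd" "normal_trace_zero \<Omega> uh gd"
    using U_H0div[OF uh_in] by (auto simp: H0div_def)

  have int: "integrable (lebesgue_on \<Omega>) (\<rho> k)" "integrable (lebesgue_on \<Omega>) (\<rho> (Suc k))"
    "integrable (lebesgue_on \<Omega>) (\<lambda>x. (\<rho> k x)\<^sup>2)" "integrable (lebesgue_on \<Omega>) (\<lambda>x. (\<rho> (Suc k) x)\<^sup>2)"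
    using spieces_integral(1)[OF p0] spieces_integral(1)[OF p1]
      spieces_integral(1)[OF spieces_mult[OF p0 p0]] spieces_integral(1)[OF spieces_mult[OF p1 p1]]
    by (simp_all add: power2_eq_square)

  have density_k: "l2_inner \<Omega> (\<lambda>x. (\<rho> (Suc k) x - \<rho> k x) / dt) \<sigma> - b_form \<Omega> \<T> \<nu> uh \<sigma> rh
      + (\<Sum>e\<in>E. LINT x|face_measure e. beta_density_integrand \<T> \<nu> e (\<beta> e uh) \<sigma> rh x) = 0" if "\<sigma> \<in> F" for \<sigma>
    using density that unfolding uh_def rh_def by blast

  have mass: "(LINT x|lebesgue_on \<Omega>. \<rho> (Suc k) x) = (LINT x|lebesgue_on \<Omega>. \<rho> k x)"
  proof -
    have "(LINT x|face_measure e. beta_density_integrand \<T> \<nu> e (\<beta> e uh) (\<lambda>x. 1) rh x) = 0" if e: "e \<in> E" for e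
    proof -
      have e': "e \<in> interior_faces \<Omega> \<T>" "unit_normal e (\<nu> e)" using e faces normals by auto
      obtain c where c: "norm (\<nu> e) = 1" "compact e" "affine hull e = {y. y \<bullet> \<nu> e = c}"
        using interior_face_plane[where \<nu> = \<nu>, OF e'] by blast
      show ?thesis
        by (rule face_integral_zero[OF c])
           (simp add: beta_density_integrand_def jump_scalar_const[where \<nu> = \<nu>, OF e'])
    qed
    then have "l2_inner \<Omega> (\<lambda>x. (\<rho> (Suc k) x - \<rho> k x) / dt) (\<lambda>x. 1) = 0"
      using density_k[of "\<lambda>x. 1"] F DG_const b_form_const[where \<nu> = \<nu>, OF normals'] by simp
    then show ?thesis using int dt by (simp add: l2_inner_def)
  qed

  have energy: "(LINT x|lebesgue_on \<Omega>. (\<rho> (Suc k) x)\<^sup>2) - (LINT x|lebesgue_on \<Omega>. (\<rho> k x)\<^sup>2)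
      = - (2 * dt) * (\<Sum>e\<in>E. LINT x|face_measure e. beta_density_integrand \<T> \<nu> e (\<beta> e uh) rh rh x)"
  proof -
    have "b_form \<Omega> \<T> \<nu> uh rh rh = 0"
      by (rule b_form_self[OF gd wh normals' wh_free ph])
    then have "l2_inner \<Omega> (\<lambda>x. (\<rho> (Suc k) x - \<rho> k x) / dt) rh
        = - (\<Sum>e\<in>E. LINT x|face_measure e. beta_density_integrand \<T> \<nu> e (\<beta> e uh) rh rh x)"
      using density_k[OF rh_in] by simp
    \<comment> \<open>Increment times mean of the two densities is half a difference of
      squares.\<close>
    moreover have "l2_inner \<Omega> (\<lambda>x. (\<rho> (Suc k) x - \<rho> k x) / dt) rh
        = (LINT x|lebesgue_on \<Omega>. ((\<rho> (Suc k) x)\<^sup>2 - (\<rho> k x)\<^sup>2) / (2 * dt))"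
      unfolding l2_inner_def inner_real_def
      by (rule Bochner_Integration.integral_cong[OF refl]) (simp add: rh power2_eq_square algebra_simps add_divide_distrib diff_divide_distrib)
    moreover have "\<dots> = ((LINT x|lebesgue_on \<Omega>. (\<rho> (Suc k) x)\<^sup>2) - (LINT x|lebesgue_on \<Omega>. (\<rho> k x)\<^sup>2)) / (2 * dt)"
      using int by simp
    ultimately show ?thesis using dt by (simp add: field_simps)
  qed
  \<comment> \<open>The sign of \<open>\<beta>\<close> is known on \<open>e\<close> only, but
    \<open>e\<close> carries the face measure.\<close>
  have dissipation: "0 \<le> (LINT x|face_measure e. beta_density_integrand \<T> \<nu> e (\<beta> e uh) rh rh x)" if e: "e \<in> E" for e
  proof (rule integral_nonneg_AE)
    have e': "e \<in> interior_faces \<Omega> \<T>" "unit_normal e (\<nu> e)" using e faces normals by auto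
    have "closed e" using interior_face_plane[where \<nu> = \<nu>, OF e'] compact_imp_closed by blast
    from AE_face_measure[OF this] show "AE x in face_measure e. 0 \<le> beta_density_integrand \<T> \<nu> e (\<beta> e uh) rh rh x"
      by eventually_elim (use beta e uh_in in \<open>simp add: beta_density_integrand_def\<close>)
  qed
  have decay: "(LINT x|lebesgue_on \<Omega>. (\<rho> (Suc k) x)\<^sup>2) \<le> (LINT x|lebesgue_on \<Omega>. (\<rho> k x)\<^sup>2)"
  proof -
    have "0 \<le> (2 * dt) * (\<Sum>e\<in>E. LINT x|face_measure e. beta_density_integrand \<T> \<nu> e (\<beta> e uh) rh rh x)"
      using dissipation dt by (intro mult_nonneg_nonneg sum_nonneg) auto
    then show ?thesis using energy by simp
  qed
  have equality: "(LINT x|lebesgue_on \<Omega>. (\<rho> (Suc k) x)\<^sup>2) = (LINT x|lebesgue_on \<Omega>. (\<rho> k x)\<^sup>2)"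
    if zero: "\<forall>e\<in>E. \<forall>w\<in>U. \<forall>x\<in>e. \<beta> e w x = 0"
  proof -
    have "(LINT x|face_measure e. beta_density_integrand \<T> \<nu> e (\<beta> e uh) rh rh x) = 0" if e: "e \<in> E" for e
    proof -
      have e': "e \<in> interior_faces \<Omega> \<T>" "unit_normal e (\<nu> e)" using e faces normals by auto
      obtain c where c: "norm (\<nu> e) = 1" "compact e" "affine hull e = {y. y \<bullet> \<nu> e = c}"
        using interior_face_plane[where \<nu> = \<nu>, OF e'] by blast
      show ?thesis
        by (rule face_integral_zero[OF c]) (use zero e uh_in in \<open>simp add: beta_density_integrand_def\<close>)
    qed
    then show ?thesis using energy by simp
  qed

  have kinetic: "(LINT x|lebesgue_on \<Omega>. \<rho> (Suc k) x * (u (Suc k) x \<bullet> u (Suc k) x))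
        = (LINT x|lebesgue_on \<Omega>. \<rho> k x * (u k x \<bullet> u k x))"
  proof -
    define m0 where "m0 = half_step (\<lambda>j x. \<rho> j x *\<^sub>R u j x) k"
    define g where "g = L2_proj \<Omega> F (\<lambda>x. u k x \<bullet> u (Suc k) x)"
    have uu: "spieces (\<lambda>x. u k x \<bullet> u (Suc k) x) (\<lambda>K x. w K x \<bullet> w' K x)"
      by (rule spieces_inner[OF w(1) w'(1)])
    have g_in: "g \<in> F" and g_proj: "\<And>h. h \<in> F \<Longrightarrow> l2_inner \<Omega> g h = l2_inner \<Omega> (\<lambda>x. u k x \<bullet> u (Suc k) x) h"
      unfolding g_def F using L2_proj[OF uu] by blast+
    have wd: "integrable (face_measure e) (beta_momentum_integrand \<T> \<nu> e (\<beta> e uh) uh uh g rh)"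
      "integrable (face_measure e) (beta_density_integrand \<T> \<nu> e (\<beta> e uh) g rh)" if "e \<in> E" for e
      using well_defined that uh_in g_in unfolding uh_def rh_def g_def by blast+
    \<comment> \<open>This term and \<open>a_form\<close> are antisymmetric in their last two
      arguments, through the cross product and the commutator of directional derivatives.\<close>
    have alpha_zero: "(LINT x|face_measure e. alpha_integrand \<iota> \<T> \<nu> e (\<alpha> e uh) m0 uh uh x) = 0" for e
      by (simp add: alpha_integrand_def jump_cross_def cross_def)
    have a_zero: "a_form \<iota> \<Omega> \<T> \<nu> m0 uh uh = 0"
      by (simp add: a_form_def jump_cross_def cross_def)
    \<comment> \<open>For \<open>v\<close> equal to the velocity the normal components cancel and
      leave 1/2. Where they vanish, both integrands are zero because \<open>\<beta>\<close>
      is.\<close>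
    have beta_half: "(LINT x|face_measure e. beta_momentum_integrand \<T> \<nu> e (\<beta> e uh) uh uh g rh x)
        = (1/2) * (LINT x|face_measure e. beta_density_integrand \<T> \<nu> e (\<beta> e uh) g rh x)" if e: "e \<in> E" for e
    proof -
      have e': "e \<in> interior_faces \<Omega> \<T>" "unit_normal e (\<nu> e)" using e faces normals by auto
      have "closed e" using interior_face_plane[where \<nu> = \<nu>, OF e'] compact_imp_closed by blast
      have "(LINT x|face_measure e. beta_momentum_integrand \<T> \<nu> e (\<beta> e uh) uh uh g rh x)
        = (LINT x|face_measure e. (1/2) * beta_density_integrand \<T> \<nu> e (\<beta> e uh) g rh x)"
      proof (rule integral_cong_AE)
        show "beta_momentum_integrand \<T> \<nu> e (\<beta> e uh) uh uh g rh \<in> borel_measurable (face_measure e)"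
          "(\<lambda>x. (1/2) * beta_density_integrand \<T> \<nu> e (\<beta> e uh) g rh x) \<in> borel_measurable (face_measure e)"
          using wd[OF e] by auto
        from AE_face_measure[OF \<open>closed e\<close>]
        show "AE x in face_measure e. beta_momentum_integrand \<T> \<nu> e (\<beta> e uh) uh uh g rh x
            = (1/2) * beta_density_integrand \<T> \<nu> e (\<beta> e uh) g rh x"
        proof eventually_elim
          fix x assume "x \<in> e"
          then have "normal_comp \<T> \<nu> e uh x = 0 \<longrightarrow> \<beta> e uh x = 0"
            using beta e uh_in by blast
          then show "beta_momentum_integrand \<T> \<nu> e (\<beta> e uh) uh uh g rh x
            = (1/2) * beta_density_integrand \<T> \<nu> e (\<beta> e uh) g rh x"
            by (cases "normal_comp \<T> \<nu> e uh x = 0")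
               (simp_all add: beta_momentum_integrand_def beta_density_integrand_def power2_eq_square)
        qed
      qed
      then show ?thesis by simp
    qed
    \<comment> \<open>Whichever weak divergence is selected, it pairs with the piecewise polynomial
      pressure like the divergence of the pieces \<open>wh\<close>, which is zero.\<close>
    have pressure: "l2_inner \<Omega> (p (Suc k)) (weak_div \<Omega> uh) = 0"
    proof -
      have "has_weak_div \<Omega> uh (weak_div \<Omega> uh)"
        using someI[of "has_weak_div \<Omega> uh", OF gd(1)] by (simp add: weak_div_def)
      moreover obtain pp where pp: "spieces (p (Suc k)) pp"
        using p_in Q DG_pieces by metis
      ultimately have "l2_inner \<Omega> (weak_div \<Omega> uh) (p (Suc k)) = (\<Sum>K\<in>\<T>. LINT x|lebesgue_on K. divg (wh K) x * pp K x)"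
        using wh by (intro weak_div_inner)
      also have "\<dots> = 0"
        by (rule sum.neutral, rule ballI, rule element_integral_nested) (simp_all add: wh_free)
      finally show ?thesis by (simp add: l2_inner_def mult.commute)
    qed
    have momentum_k: "l2_inner \<Omega> (\<lambda>x. (1/dt) *\<^sub>R (\<rho> (Suc k) x *\<^sub>R u (Suc k) x - \<rho> k x *\<^sub>R u k x)) uh
        = 1/2 * (b_form \<Omega> \<T> \<nu> uh g rh - (\<Sum>e\<in>E. LINT x|face_measure e. beta_density_integrand \<T> \<nu> e (\<beta> e uh) g rh x))"
    proof -
      have "(\<Sum>e\<in>E. LINT x|face_measure e. alpha_integrand \<iota> \<T> \<nu> e (\<alpha> e uh) m0 uh uh x)
        + (\<Sum>e\<in>E. LINT x|face_measure e. beta_momentum_integrand \<T> \<nu> e (\<beta> e uh) uh uh g rh x)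
        + l2_inner \<Omega> (\<lambda>x. (1/dt) *\<^sub>R (\<rho> (Suc k) x *\<^sub>R u (Suc k) x - \<rho> k x *\<^sub>R u k x)) uh
        + a_form \<iota> \<Omega> \<T> \<nu> m0 uh uh - 1/2 * b_form \<Omega> \<T> \<nu> uh g rh
        - l2_inner \<Omega> (p (Suc k)) (weak_div \<Omega> uh) = 0"
        using momentum uh_in unfolding uh_def rh_def g_def m0_def by blast
      moreover have "(\<Sum>e\<in>E. LINT x|face_measure e. beta_momentum_integrand \<T> \<nu> e (\<beta> e uh) uh uh g rh x)
          = 1/2 * (\<Sum>e\<in>E. LINT x|face_measure e. beta_density_integrand \<T> \<nu> e (\<beta> e uh) g rh x)"
        by (simp add: beta_half sum_distrib_left)
      ultimately show ?thesis
        by (simp add: alpha_zero a_zero pressure)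
    qed
    define d where "d x = (\<rho> (Suc k) x - \<rho> k x) / dt" for x
    have d_in: "d \<in> F"
    proof -
      have "(\<lambda>x. (1/dt) * \<rho> (Suc k) x + ((-1/dt) * \<rho> k x + 0)) \<in> DG \<Omega> \<T> m"
        by (intro DG_combine DG_const \<rho>_DG)
      moreover have "(\<lambda>x. (1/dt) * \<rho> (Suc k) x + ((-1/dt) * \<rho> k x + 0)) = d"
        by (simp add: d_def fun_eq_iff diff_divide_distrib)
      ultimately show ?thesis using F by simp
    qed
    have "l2_inner \<Omega> d g = b_form \<Omega> \<T> \<nu> uh g rh
        - (\<Sum>e\<in>E. LINT x|face_measure e. beta_density_integrand \<T> \<nu> e (\<beta> e uh) g rh x)"
      using density_k[OF g_in] unfolding d_def[abs_def] by simp
    moreover have "l2_inner \<Omega> d g = l2_inner \<Omega> (\<lambda>x. u k x \<bullet> u (Suc k) x) d"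
      using g_proj[OF d_in] by (simp add: l2_inner_def mult.commute)
    ultimately have balance: "l2_inner \<Omega> (\<lambda>x. (1/dt) *\<^sub>R (\<rho> (Suc k) x *\<^sub>R u (Suc k) x - \<rho> k x *\<^sub>R u k x)) uh
        = 1/2 * l2_inner \<Omega> (\<lambda>x. u k x \<bullet> u (Suc k) x) d"
      using momentum_k by simp
    define A where "A x = \<rho> (Suc k) x * (u (Suc k) x \<bullet> u (Suc k) x)" for x
    define B where "B x = \<rho> k x * (u k x \<bullet> u k x)" for x
    \<comment> \<open>Tested with the mean velocity, the momentum increment is half the change of
      \<open>\<rho>\<close> times the squared speed plus half of \<open>D\<close>. The right-hand
      side of \<open>balance\<close> supplies exactly this second half.\<close>
    define D where "D x = (u k x \<bullet> u (Suc k) x) * d x" for x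
    have int_A: "integrable (lebesgue_on \<Omega>) A" and int_B: "integrable (lebesgue_on \<Omega>) B"
      unfolding A_def[abs_def] B_def[abs_def]
      by (rule spieces_integral(1)[OF spieces_mult[OF p1 spieces_inner[OF w'(1) w'(1)]]],
          rule spieces_integral(1)[OF spieces_mult[OF p0 spieces_inner[OF w(1) w(1)]]])
    obtain pd where pd: "spieces d pd" using DG_pieces d_in F by blast
    have int_D: "integrable (lebesgue_on \<Omega>) D"
      unfolding D_def[abs_def] by (rule spieces_integral(1)[OF spieces_mult[OF uu pd]])
    have "((1/dt) *\<^sub>R (\<rho> (Suc k) x *\<^sub>R u (Suc k) x - \<rho> k x *\<^sub>R u k x)) \<bullet> uh x = (A x - B x) / (2 * dt) + D x / 2" for x
      using dt by (simp add: uh A_def B_def D_def d_def inner_diff_left inner_add_right inner_commute[of "u (Suc k) x" "u k x"] field_simps)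
    then have "l2_inner \<Omega> (\<lambda>x. (1/dt) *\<^sub>R (\<rho> (Suc k) x *\<^sub>R u (Suc k) x - \<rho> k x *\<^sub>R u k x)) uh
        = ((LINT x|lebesgue_on \<Omega>. A x) - (LINT x|lebesgue_on \<Omega>. B x)) / (2 * dt) + (LINT x|lebesgue_on \<Omega>. D x) / 2"
      unfolding l2_inner_def using int_A int_B int_D by simp
    then have "((LINT x|lebesgue_on \<Omega>. A x) - (LINT x|lebesgue_on \<Omega>. B x)) / (2 * dt) = 0"
      using balance by (simp add: l2_inner_def D_def)
    then show ?thesis using dt by (simp add: A_def B_def)
  qed
  show "(LINT x|lebesgue_on \<Omega>. \<rho> (Suc k) x) = (LINT x|lebesgue_on \<Omega>. \<rho> k x) \<and>
      (LINT x|lebesgue_on \<Omega>. (\<rho> (Suc k) x)\<^sup>2) \<le> (LINT x|lebesgue_on \<Omega>. (\<rho> k x)\<^sup>2) \<and>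
      ((\<forall>e\<in>E. \<forall>w\<in>U. \<forall>x\<in>e. \<beta> e w x = 0) \<longrightarrow>
         (LINT x|lebesgue_on \<Omega>. (\<rho> (Suc k) x)\<^sup>2) = (LINT x|lebesgue_on \<Omega>. (\<rho> k x)\<^sup>2)) \<and>
      (LINT x|lebesgue_on \<Omega>. \<rho> (Suc k) x * (u (Suc k) x \<bullet> u (Suc k) x))
        = (LINT x|lebesgue_on \<Omega>. \<rho> k x * (u k x \<bullet> u k x))"
    using mass decay equality kinetic by blast
qed

end
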